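(* Let $p$ be an odd prime. A representation group of $G = \mathbb{H}_{3}(\mathbb{Z}/p\mathbb{Z}\times \mathbb{Z}/p\mathbb{Z})$ is the following group of nilpotency class three: $$\begin{aligned}G^\star =\langle\, x_1,x_2,y_1,y_2 \mid\ & [x_1,x_2]=z_1,\ [y_1,y_2]=z_2,\ [z_1, x_1]=t_1,\ [z_1, x_2]=t_2,\ [z_2, y_1]=t_3,\\ & [z_2, y_2]=t_4,\ [x_1,y_1]=t_5,\ [x_1,y_2]=t_6,\ [x_2,y_1]=t_7,\ [x_2,y_2]=t_8,\\ & x_i^p=y_i^p=z_1^p=z_2^p=1,\ i=1,2\, \rangle.\end{aligned}$$
   Context: $\mathbb{H}_3(R)$ is the group of upper unitriangular $3\times 3$ matrices over the commutative ring $R$. $[x,y]=x^{-1}y^{-1}xy$. Convention for presentations: all commutators between pairs of the named elements ($x_i,y_i,z_i,t_j$) which are not explicitly stated in the presentation are trivial (so in particular all $t_j$ are central, $[z_1,y_i]=[z_2,x_i]=1$ and $[z_1,z_2]=1$). A representation group of a finite group $G$ is a finite group $G^\star$ having a subgroup $A\subseteq Z(G^\star)\cap [G^\star,G^\star]$ with $A\cong \mathrm{H}^2(G,\mathbb{C}^\times)$ (trivial action) and $G^\star/A\cong G$. *)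

theory Defs
  imports "HOL-Algebra.Algebra" "HOL-Number_Theory.Residues"
begin

section \<open>Unitriangular matrices over a commutative ring\<close>

text \<open>An \<open>n \<times> n\<close> matrix is an extensional function on \<open>{..<n} \<times> {..<n}\<close>, so that two matrices
  are equal iff their entries agree.\<close>

definition unitriangular :: "nat \<Rightarrow> ('a, 'b) ring_scheme \<Rightarrow> (nat \<times> nat \<Rightarrow> 'a) monoid" where
  "unitriangular n R =
    \<lparr>carrier = {A \<in> {..<n} \<times> {..<n} \<rightarrow>\<^sub>E carrier R.
                  (\<forall>i<n. A (i, i) = \<one>\<^bsub>R\<^esub>) \<and> (\<forall>i<n. \<forall>j<i. A (i, j) = \<zero>\<^bsub>R\<^esub>)},
     monoid.mult = (\<lambda>A B. \<lambda>(i, j)\<in>{..<n} \<times> {..<n}.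
               finsum R (\<lambda>k. A (i, k) \<otimes>\<^bsub>R\<^esub> B (k, j)) {..<n}),
     one = (\<lambda>(i, j)\<in>{..<n} \<times> {..<n}. if i = j then \<one>\<^bsub>R\<^esub> else \<zero>\<^bsub>R\<^esub>)\<rparr>"

abbreviation heisenberg3 :: "('a, 'b) ring_scheme \<Rightarrow> (nat \<times> nat \<Rightarrow> 'a) monoid" where
  "heisenberg3 \<equiv> unitriangular 3"

section \<open>Commutators, centre, nilpotency class\<close>

definition commutator :: "('a, 'b) monoid_scheme \<Rightarrow> 'a \<Rightarrow> 'a \<Rightarrow> 'a" where
  "commutator G x y = inv\<^bsub>G\<^esub> x \<otimes>\<^bsub>G\<^esub> inv\<^bsub>G\<^esub> y \<otimes>\<^bsub>G\<^esub> x \<otimes>\<^bsub>G\<^esub> y"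

definition group_center :: "('a, 'b) monoid_scheme \<Rightarrow> 'a set" where
  "group_center G = {z \<in> carrier G. \<forall>g \<in> carrier G. z \<otimes>\<^bsub>G\<^esub> g = g \<otimes>\<^bsub>G\<^esub> z}"

text \<open>The index is shifted: \<open>lower_central G n\<close> is the term usually written \<open>\<gamma>\<^sub>n\<^sub>+\<^sub>1(G)\<close>,
  so that the nilpotency class is the least \<open>n\<close> at which it becomes trivial.\<close>

primrec lower_central :: "('a, 'b) monoid_scheme \<Rightarrow> nat \<Rightarrow> 'a set" where
  "lower_central G 0 = carrier G"
| "lower_central G (Suc n) =
     generate G {commutator G a g | a g. a \<in> lower_central G n \<and> g \<in> carrier G}"

definition has_nilpotency_class :: "('a, 'b) monoid_scheme \<Rightarrow> nat \<Rightarrow> bool" where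
  "has_nilpotency_class G c \<longleftrightarrow>
     lower_central G c = {\<one>\<^bsub>G\<^esub>} \<and> (\<forall>d<c. lower_central G d \<noteq> {\<one>\<^bsub>G\<^esub>})"

section \<open>Second cohomology with trivial action\<close>

text \<open>Inhomogeneous 2-cocycles (not assumed normalized) of \<open>G\<close> with values in the abelian group \<open>M\<close>,
  under pointwise multiplication.\<close>

definition cocycles2 ::
  "('a, 'b) monoid_scheme \<Rightarrow> ('m, 'c) monoid_scheme \<Rightarrow> ('a \<times> 'a \<Rightarrow> 'm) monoid" where
  "cocycles2 G M =
    \<lparr>carrier = {f \<in> carrier G \<times> carrier G \<rightarrow>\<^sub>E carrier M.
        \<forall>x \<in> carrier G. \<forall>y \<in> carrier G. \<forall>z \<in> carrier G.
          f (y, z) \<otimes>\<^bsub>M\<^esub> f (x, y \<otimes>\<^bsub>G\<^esub> z) = f (x \<otimes>\<^bsub>G\<^esub> y, z) \<otimes>\<^bsub>M\<^esub> f (x, y)},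
     monoid.mult = (\<lambda>f g. \<lambda>u \<in> carrier G \<times> carrier G. f u \<otimes>\<^bsub>M\<^esub> g u),
     one = (\<lambda>u \<in> carrier G \<times> carrier G. \<one>\<^bsub>M\<^esub>)\<rparr>"

definition coboundaries2 ::
  "('a, 'b) monoid_scheme \<Rightarrow> ('m, 'c) monoid_scheme \<Rightarrow> ('a \<times> 'a \<Rightarrow> 'm) set" where
  "coboundaries2 G M =
    {\<lambda>(x, y)\<in>carrier G \<times> carrier G. h x \<otimes>\<^bsub>M\<^esub> h y \<otimes>\<^bsub>M\<^esub> inv\<^bsub>M\<^esub> (h (x \<otimes>\<^bsub>G\<^esub> y)) | h.
      h \<in> carrier G \<rightarrow> carrier M}"

definition cohomology2 ::
  "('a, 'b) monoid_scheme \<Rightarrow> ('m, 'c) monoid_scheme \<Rightarrow> ('a \<times> 'a \<Rightarrow> 'm) set monoid" where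
  "cohomology2 G M = cocycles2 G M Mod coboundaries2 G M"

definition complex_units :: "complex monoid" where
  "complex_units = \<lparr>carrier = UNIV - {0}, monoid.mult = (*), one = 1\<rparr>"

section \<open>Representation groups\<close>

definition representation_group ::
  "('a, 'b) monoid_scheme \<Rightarrow> ('c, 'd) monoid_scheme \<Rightarrow> bool" where
  "representation_group G Gs \<longleftrightarrow>
     group G \<and> finite (carrier G) \<and> group Gs \<and> finite (carrier Gs) \<and>
     (\<exists>A. subgroup A Gs \<and> A \<subseteq> group_center Gs \<inter> derived Gs (carrier Gs) \<and>
          Gs\<lparr>carrier := A\<rparr> \<cong> cohomology2 G complex_units \<and> Gs Mod A \<cong> G)"

section \<open>Free groups and presentations\<close>

text \<open>A letter \<open>(x, True)\<close> stands for the generator \<open>x\<close>, and \<open>(x, False)\<close> for its inverse.\<close>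

inductive free_eq :: "('x \<times> bool) list \<Rightarrow> ('x \<times> bool) list \<Rightarrow> bool" where
  refl: "free_eq u u"
| sym: "free_eq u v \<Longrightarrow> free_eq v u"
| trans: "free_eq u v \<Longrightarrow> free_eq v w \<Longrightarrow> free_eq u w"
| cancel: "free_eq (u @ [(x, b), (x, \<not> b)] @ v) (u @ v)"

definition free_class :: "('x \<times> bool) list \<Rightarrow> ('x \<times> bool) list set" where
  "free_class u = {v. free_eq u v}"

text \<open>The free group on all elements of the type \<open>'x\<close>.\<close>

definition free_group :: "('x \<times> bool) list set monoid" where
  "free_group = \<lparr>carrier = range free_class,
                 monoid.mult = (\<lambda>U V. \<Union>u\<in>U. \<Union>v\<in>V. free_class (u @ v)),
                 one = free_class []\<rparr>"

definition free_gen :: "'x \<Rightarrow> ('x \<times> bool) list set" where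
  "free_gen x = free_class [(x, True)]"

definition normal_closure :: "('a, 'b) monoid_scheme \<Rightarrow> 'a set \<Rightarrow> 'a set" where
  "normal_closure G S = \<Inter>{N. N \<lhd> G \<and> S \<subseteq> N}"

definition presented_group ::
  "('x \<times> bool) list set set \<Rightarrow> ('x \<times> bool) list set set monoid" where
  "presented_group rels = free_group Mod normal_closure free_group rels"

section \<open>The presentation of \<open>G_star\<close>\<close>

datatype gen = GX1 | GX2 | GY1 | GY2

datatype name = X1 | X2 | Y1 | Y2 | Z1 | Z2 | T1 | T2 | T3 | T4 | T5 | T6 | T7 | T8

text \<open>Only \<open>x\<^sub>1, x\<^sub>2, y\<^sub>1, y\<^sub>2\<close> generate. A relation of the form \<open>[a, b] = c\<close> introduces \<open>c\<close> as
  an abbreviation for the commutator on its left-hand side, taken in the free group.\<close>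

definition named_elt :: "name \<Rightarrow> (gen \<times> bool) list set" where
  "named_elt a =
     (let c = commutator free_group;
          x1 = free_gen GX1; x2 = free_gen GX2; y1 = free_gen GY1; y2 = free_gen GY2;
          z1 = c x1 x2; z2 = c y1 y2
      in case a of
           X1 \<Rightarrow> x1 | X2 \<Rightarrow> x2 | Y1 \<Rightarrow> y1 | Y2 \<Rightarrow> y2 | Z1 \<Rightarrow> z1 | Z2 \<Rightarrow> z2
         | T1 \<Rightarrow> c z1 x1 | T2 \<Rightarrow> c z1 x2 | T3 \<Rightarrow> c z2 y1 | T4 \<Rightarrow> c z2 y2
         | T5 \<Rightarrow> c x1 y1 | T6 \<Rightarrow> c x1 y2 | T7 \<Rightarrow> c x2 y1 | T8 \<Rightarrow> c x2 y2)"

text \<open>The pairs whose commutator is stated explicitly. Every other unordered pair of named elements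
  is required to commute; \<open>(b, a)\<close> counts as stated when \<open>(a, b)\<close> is.\<close>

definition stated_pairs :: "(name \<times> name) set" where
  "stated_pairs = {(X1, X2), (Y1, Y2), (Z1, X1), (Z1, X2), (Z2, Y1), (Z2, Y2),
                   (X1, Y1), (X1, Y2), (X2, Y1), (X2, Y2)}"

definition relators :: "nat \<Rightarrow> (gen \<times> bool) list set set" where
  "relators p =
     {commutator free_group (named_elt a) (named_elt b) | a b.
        (a, b) \<notin> stated_pairs \<and> (b, a) \<notin> stated_pairs} \<union>
     {named_elt a [^]\<^bsub>free_group\<^esub> p | a. a \<in> {X1, X2, Y1, Y2, Z1, Z2}}"

definition G_star :: "nat \<Rightarrow> (gen \<times> bool) list set set monoid" where
  "G_star p = presented_group (relators p)"

end

theory Submission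
  imports Defs
begin

text \<open>Write \<open>G\<close> for the Heisenberg group over \<open>\<int>/p \<times> \<int>/p\<close> and \<open>A\<close> for the subgroup of \<open>G_star p\<close>
  generated by the eight commutators \<open>t\<^sub>1, \<dots>, t\<^sub>8\<close>. The theorem says that
  \<open>1 \<rightarrow> A \<rightarrow> G_star p \<rightarrow> G \<rightarrow> 1\<close> is a central extension with \<open>A\<close> inside the derived subgroup, and that
  \<open>A\<close> has the right isomorphism type.

  Everything rests on a short criterion (\<open>G_star_universal\<close>) for homomorphisms out of \<open>G_star p\<close>:
  a quadruple of elements of order dividing \<open>p\<close> extends to a homomorphism as soon as the eight
  commutators \<open>t\<^sub>j\<close> formed from it are central. The criterion is applied to three targets.

  First, the target \<open>G\<close> itself, where all \<open>t\<^sub>j\<close> are trivial, gives the projection \<open>star_pi\<close>. Modulo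
  \<open>A\<close> every element has the form \<open>x\<^sub>1\<^sup>a x\<^sub>2\<^sup>b z\<^sub>1\<^sup>c y\<^sub>1\<^sup>d y\<^sub>2\<^sup>e z\<^sub>2\<^sup>f\<close> (\<open>star_normal_form\<close>), and the projection recovers
  the exponents modulo \<open>p\<close>; hence its kernel is exactly \<open>A\<close> (\<open>kernel_star_pi\<close>).

  Second, an explicit group of polynomials of degree at most two, on which translations act, serves
  to separate the \<open>t\<^sub>j\<close>: for each \<open>j\<close> there is a homomorphism that kills all of them except \<open>t\<^sub>j\<close>,
  whose image has full order (\<open>separating_hom\<close>). So the \<open>t\<^sub>j\<close> form a basis of \<open>A\<close>, which is a
  product of eight cyclic groups of order \<open>p\<close> (\<open>star_kernel_basis\<close>) and therefore isomorphic to its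
  group of characters (\<open>dual_elementary_abelian\<close>).

  Third, a cocycle \<open>c\<close> of \<open>G\<close> with values in the multiplicative group of \<open>\<complex>\<close> defines a central extension
  of \<open>G\<close>. Since complex numbers have \<open>p\<close>-th roots, the generators of \<open>G\<close> can be lifted to elements of
  order dividing \<open>p\<close>, and the criterion produces a lift of \<open>star_pi\<close> to this extension. Thus \<open>c\<close>
  becomes a coboundary when pulled back to \<open>G_star p\<close> (\<open>pullback_coboundary\<close>). For a central extension
  with this property whose kernel lies in the derived subgroup, composing characters of the kernel with
  the factor set is an isomorphism onto the second cohomology group (\<open>dual_iso_cohomology2\<close>).

  As for the nilpotency class, commutators in \<open>G\<close> are central, so triple commutators in \<open>G_star p\<close>
  lie in the central subgroup \<open>A\<close>; and \<open>t\<^sub>1\<close> is a nontrivial triple commutator.\<close>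

section \<open>Commutators\<close>

context group
begin

lemma commutator_closed [simp, intro]:
  "x \<in> carrier G \<Longrightarrow> y \<in> carrier G \<Longrightarrow> commutator G x y \<in> carrier G"
  by (simp add: commutator_def)

lemma cancel_inv:
  assumes "x \<in> carrier G" "y \<in> carrier G"
  shows "x \<otimes> (inv x \<otimes> y) = y" "inv x \<otimes> (x \<otimes> y) = y"
  using assms by (simp_all flip: m_assoc)

lemma mult_commutator:
  assumes "x \<in> carrier G" "y \<in> carrier G"
  shows "x \<otimes> y = y \<otimes> x \<otimes> commutator G x y"
  using assms by (simp add: commutator_def m_assoc cancel_inv)

lemma commutator_eqI:
  assumes "x \<in> carrier G" "y \<in> carrier G" "c \<in> carrier G" "x \<otimes> y = y \<otimes> x \<otimes> c"
  shows "commutator G x y = c"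
  using mult_commutator[of x y] assms by (metis commutator_closed l_cancel m_closed)

lemma commutator_eq_one_iff:
  assumes "x \<in> carrier G" "y \<in> carrier G"
  shows "commutator G x y = \<one> \<longleftrightarrow> x \<otimes> y = y \<otimes> x"
  using mult_commutator[OF assms] commutator_eqI[OF assms one_closed] assms by auto

lemma commutator_trivial [simp]:
  assumes "x \<in> carrier G"
  shows "commutator G x x = \<one>" "commutator G \<one> x = \<one>" "commutator G x \<one> = \<one>"
  using assms by (simp_all add: commutator_eq_one_iff)

lemma group_center_closed: "z \<in> group_center G \<Longrightarrow> z \<in> carrier G"
  by (simp add: group_center_def)

lemma group_center_comm: "z \<in> group_center G \<Longrightarrow> x \<in> carrier G \<Longrightarrow> z \<otimes> x = x \<otimes> z"
  by (simp add: group_center_def)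

lemma commutator_center [simp]:
  assumes "z \<in> group_center G" "x \<in> carrier G"
  shows "commutator G z x = \<one>" "commutator G x z = \<one>"
  using assms by (simp_all add: commutator_eq_one_iff group_center_closed group_center_comm)

lemma subgroup_commuting:
  assumes "S \<subseteq> carrier G"
  shows "subgroup {x \<in> carrier G. \<forall>s\<in>S. x \<otimes> s = s \<otimes> x} G"
proof (rule subgroupI)
  fix a assume a: "a \<in> {x \<in> carrier G. \<forall>s\<in>S. x \<otimes> s = s \<otimes> x}"
  have "inv a \<otimes> s = s \<otimes> inv a" if "s \<in> S" for s
  proof -
    have c: "a \<in> carrier G" "s \<in> carrier G" "a \<otimes> s = s \<otimes> a"
      using a that assms by auto
    have "inv a \<otimes> (a \<otimes> s) \<otimes> inv a = s \<otimes> inv a"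
      using c(1,2) by (simp flip: m_assoc)
    moreover have "inv a \<otimes> (s \<otimes> a) \<otimes> inv a = inv a \<otimes> s"
      using c(1,2) by (simp add: m_assoc)
    ultimately show ?thesis using c(3) by simp
  qed
  then show "inv a \<in> {x \<in> carrier G. \<forall>s\<in>S. x \<otimes> s = s \<otimes> x}"
    using a by auto
next
  fix a b
  assume a: "a \<in> {x \<in> carrier G. \<forall>s\<in>S. x \<otimes> s = s \<otimes> x}" and b: "b \<in> {x \<in> carrier G. \<forall>s\<in>S. x \<otimes> s = s \<otimes> x}"
  have "a \<otimes> b \<otimes> s = s \<otimes> (a \<otimes> b)" if "s \<in> S" for s
  proof -
    have c: "a \<in> carrier G" "b \<in> carrier G" "s \<in> carrier G"
      and e: "a \<otimes> s = s \<otimes> a" "b \<otimes> s = s \<otimes> b"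
      using a b that assms by auto
    have "a \<otimes> b \<otimes> s = a \<otimes> s \<otimes> b" using c by (simp add: m_assoc e(2))
    also have "\<dots> = s \<otimes> (a \<otimes> b)" using c by (simp add: e flip: m_assoc)
    finally show ?thesis .
  qed
  then show "a \<otimes> b \<in> {x \<in> carrier G. \<forall>s\<in>S. x \<otimes> s = s \<otimes> x}"
    using a b by auto
qed (use assms in \<open>auto simp: subset_iff\<close>)

lemma subgroup_group_center: "subgroup (group_center G) G"
  using subgroup_commuting[OF subset_refl] by (simp add: group_center_def)

lemma group_center_rule:
  assumes "z \<in> group_center G" "x \<in> carrier G" "y \<in> carrier G"
  shows "x \<otimes> (z \<otimes> y) = z \<otimes> (x \<otimes> y)"
  using assms by (metis group_center_closed group_center_comm m_assoc)

lemma commutator_mult_center: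
  assumes xy: "x \<in> carrier G" "y \<in> carrier G" and kl: "k \<in> group_center G" "l \<in> group_center G"
  shows "commutator G (x \<otimes> k) (y \<otimes> l) = commutator G x y"
proof (rule commutator_eqI)
  note c = group_center_closed[OF kl(1)] group_center_closed[OF kl(2)]
  have kl': "k \<otimes> l \<in> group_center G"
    using kl subgroup_group_center by (simp add: subgroup.m_closed)
  have "x \<otimes> k \<otimes> (y \<otimes> l) = x \<otimes> y \<otimes> (k \<otimes> l)"
    using xy c by (simp add: m_assoc group_center_rule[OF kl(1) xy(2) c(2)])
  also have "\<dots> = y \<otimes> x \<otimes> (commutator G x y \<otimes> (k \<otimes> l))"
    using mult_commutator[OF xy] xy c by (simp add: m_assoc)
  also have "commutator G x y \<otimes> (k \<otimes> l) = l \<otimes> k \<otimes> commutator G x y"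
    using xy group_center_comm[OF kl' commutator_closed[OF xy]] group_center_comm[OF kl(1) c(2)]
    by simp
  also have "y \<otimes> x \<otimes> (l \<otimes> k \<otimes> commutator G x y) = y \<otimes> l \<otimes> (x \<otimes> k) \<otimes> commutator G x y"
    using xy c by (simp add: m_assoc group_center_rule[OF kl(2) xy(1)])
  finally show "x \<otimes> k \<otimes> (y \<otimes> l) = y \<otimes> l \<otimes> (x \<otimes> k) \<otimes> commutator G x y" .
qed (use assms group_center_closed in auto)

lemma conj_eq_iff:
  assumes "x \<in> carrier G" "y \<in> carrier G" "w \<in> carrier G"
  shows "inv y \<otimes> x \<otimes> y = w \<longleftrightarrow> x \<otimes> y = y \<otimes> w"
  using assms inv_solve_left[of w y "x \<otimes> y"] by (auto simp: m_assoc)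

lemma conj_commutator:
  assumes "x \<in> carrier G" "y \<in> carrier G" "g \<in> carrier G"
  shows "inv g \<otimes> commutator G x y \<otimes> g =
    commutator G (inv g \<otimes> x \<otimes> g) (inv g \<otimes> y \<otimes> g)"
proof -
  have c: "g \<otimes> (inv g \<otimes> a) = a" if "a \<in> carrier G" for a
    using assms that by (simp flip: m_assoc)
  show ?thesis
    using assms by (simp add: commutator_def inv_mult_group m_assoc c)
qed

text \<open>Conjugation by \<open>y\<close> multiplies \<open>x\<close> and \<open>x'\<close> by the central elements \<open>[x, y]\<close> and \<open>[x', y]\<close>,
  and a commutator does not change when its arguments are multiplied by central elements.\<close>

lemma commutator_commutes:
  assumes c: "x \<in> carrier G" "x' \<in> carrier G" "y \<in> carrier G"
    and k: "commutator G x y \<in> group_center G" "commutator G x' y \<in> group_center G"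
  shows "commutator G x x' \<otimes> y = y \<otimes> commutator G x x'"
proof -
  have conj: "inv y \<otimes> a \<otimes> y = a \<otimes> commutator G a y" if "a \<in> carrier G" for a
    using mult_commutator[of a y] that c by (simp add: m_assoc cancel_inv)
  have "inv y \<otimes> commutator G x x' \<otimes> y = commutator G x x'"
    using c k by (simp add: conj_commutator conj[of x] conj[of x'] commutator_mult_center del: commutator_center)
  then show ?thesis
    using c by (simp add: conj_eq_iff)
qed

lemma commutator_flip_center:
  assumes "x \<in> carrier G" "y \<in> carrier G" "commutator G x y \<in> group_center G"
  shows "commutator G y x \<in> group_center G"
proof -
  have "commutator G y x = inv commutator G x y"
    using assms by (simp add: commutator_def inv_mult_group m_assoc)
  then show ?thesis
    using assms subgroup.m_inv_closed[OF subgroup_group_center] by simp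
qed

lemma pow_mem_group_center: "t \<in> group_center G \<Longrightarrow> t [^] (n::nat) \<in> group_center G"
  using subgroup_group_center
  by (induction n) (simp_all add: subgroup.one_closed subgroup.m_closed)

text \<open>Collection of powers when \<open>t = [z, x]\<close> is central. Sorting \<open>(x z)\<^sup>n\<close> moves a \<open>z\<close> past an \<open>x\<close> once for
  every pair of factors, which explains the binomial coefficient.\<close>

lemma pow_commutator:
  fixes n :: nat
  assumes c: "x \<in> carrier G" "z \<in> carrier G" and t: "t \<in> group_center G"
    and zx: "z \<otimes> x = x \<otimes> z \<otimes> t"
  shows "z [^] n \<otimes> x = x \<otimes> z [^] n \<otimes> t [^] n" (is ?A)
    and "z \<otimes> x [^] n = x [^] n \<otimes> z \<otimes> t [^] n" (is ?B)
    and "(x \<otimes> z) [^] n = x [^] n \<otimes> z [^] n \<otimes> t [^] (n choose 2)" (is ?C)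
proof -
  note tc = pow_mem_group_center[OF t]
  note tcc = group_center_closed[OF tc] group_center_closed[OF t]
  have A: "z [^] n \<otimes> x = x \<otimes> z [^] n \<otimes> t [^] n" for n :: nat
  proof (induction n)
    case (Suc n)
    have "z [^] Suc n \<otimes> x = z [^] n \<otimes> (x \<otimes> z \<otimes> t)"
      using c by (simp add: m_assoc zx)
    also have "\<dots> = z [^] n \<otimes> x \<otimes> (z \<otimes> t)"
      using c tcc by (simp add: m_assoc)
    also have "\<dots> = x \<otimes> z [^] n \<otimes> (t [^] n \<otimes> (z \<otimes> t))"
      using c tcc Suc by (simp add: m_assoc)
    also have "t [^] n \<otimes> (z \<otimes> t) = z \<otimes> t [^] Suc n"
      using c tcc by (simp add: group_center_rule[OF tc, symmetric])
    finally show ?case using c tcc by (simp add: m_assoc)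
  qed (use c in simp)
  show ?A by (rule A)
  show ?B
  proof (induction n)
    case (Suc n)
    have "z \<otimes> x [^] Suc n = x [^] n \<otimes> z \<otimes> (t [^] n \<otimes> x)"
      using c tcc Suc by (simp add: m_assoc[symmetric])
    also have "t [^] n \<otimes> x = x \<otimes> t [^] n"
      using c by (rule_tac group_center_comm[OF tc])
    also have "x [^] n \<otimes> z \<otimes> (x \<otimes> t [^] n) = x [^] n \<otimes> (z \<otimes> x) \<otimes> t [^] n"
      using c tcc by (simp add: m_assoc)
    also have "\<dots> = x [^] Suc n \<otimes> z \<otimes> (t \<otimes> t [^] n)"
      unfolding zx using c tcc by (simp add: m_assoc)
    also have "t \<otimes> t [^] n = t [^] Suc n"
      using tcc nat_pow_Suc2 by metis
    finally show ?case .
  qed (use c in simp)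
  show ?C
  proof (induction n)
    case (Suc n)
    let ?T = "t [^] (n choose 2)"
    have "(x \<otimes> z) [^] Suc n = x [^] n \<otimes> z [^] n \<otimes> (?T \<otimes> (x \<otimes> z))"
      using c tcc Suc by (simp add: m_assoc)
    also have "?T \<otimes> (x \<otimes> z) = x \<otimes> z \<otimes> ?T"
      using c by (rule_tac group_center_comm[OF tc]) auto
    also have "x [^] n \<otimes> z [^] n \<otimes> (x \<otimes> z \<otimes> ?T) = x [^] n \<otimes> (z [^] n \<otimes> x) \<otimes> (z \<otimes> ?T)"
      using c tcc by (simp add: m_assoc)
    also have "\<dots> = x [^] Suc n \<otimes> z [^] n \<otimes> (t [^] n \<otimes> (z \<otimes> ?T))"
      unfolding A using c tcc by (simp add: m_assoc)
    also have "t [^] n \<otimes> (z \<otimes> ?T) = z \<otimes> t [^] (Suc n choose 2)"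
      using c tcc by (simp add: group_center_rule[OF tc, symmetric] numeral_2_eq_2 nat_pow_mult)
    finally show ?case using c tcc by (simp add: m_assoc)
  qed (use c in \<open>simp add: numeral_2_eq_2\<close>)
qed

text \<open>Moving \<open>x\<close> past \<open>y\<^sup>n\<close> produces \<open>[x, y]\<^sup>n\<close>.\<close>

lemma commutator_pow_center:
  fixes n :: nat
  assumes c: "x \<in> carrier G" "y \<in> carrier G" and t: "commutator G x y \<in> group_center G"
    and yn: "y [^] n = \<one>"
  shows "commutator G x y [^] n = \<one>"
  using pow_commutator(2)[OF c(2,1) t mult_commutator[OF c], of n] c yn by simp

text \<open>Conjugating \<open>x\<^sup>p = \<one>\<close> by \<open>y\<close> gives \<open>(x z)\<^sup>p = \<one>\<close> with \<open>z = [x, y]\<close>. For odd \<open>p\<close> the central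
  correction \<open>t\<^bsup>p (p - 1) / 2\<^esup>\<close> in the expansion of \<open>(x z)\<^sup>p\<close> vanishes, since \<open>t = [z, x]\<close> satisfies
  \<open>t\<^sup>p = [z, x\<^sup>p] = \<one>\<close>. This is the point where an even \<open>p\<close> would fail.\<close>

lemma pow_commutator_eq_one:
  fixes p :: nat
  assumes c: "x \<in> carrier G" "y \<in> carrier G" and xp: "x [^] p = \<one>" and p: "odd p"
    and t: "commutator G (commutator G x y) x \<in> group_center G"
  shows "commutator G x y [^] p = \<one>"
proof -
  define z where "z = commutator G x y"
  define t where "t = commutator G z x"
  have zc: "z \<in> carrier G" and tc: "t \<in> group_center G" "t \<in> carrier G"
    using c t by (auto simp: z_def t_def)
  have zx: "z \<otimes> x = x \<otimes> z \<otimes> t"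
    unfolding t_def by (rule mult_commutator) (use zc c in auto)
  have tp: "t [^] p = \<one>"
    using commutator_pow_center[OF zc c(1) _ xp] tc(1) by (simp add: t_def)
  \<comment> \<open>Oddness of \<open>p\<close> makes \<open>p\<close> divide the binomial coefficient \<open>p choose 2\<close>.\<close>
  have "p * (p - 1) div 2 = p * ((p - 1) div 2)"
    using p by (simp add: div_mult_swap)
  then have tb: "t [^] (p choose 2) = \<one>"
    using tp tc nat_pow_pow[of t p "(p - 1) div 2"] by (simp add: choose_two)
  have conj: "inv y \<otimes> x \<otimes> y = x \<otimes> z"
    using mult_commutator[OF c] c zc unfolding z_def[symmetric]
    by (simp add: m_assoc cancel_inv)
  have pow: "(inv y \<otimes> x \<otimes> y) [^] n = inv y \<otimes> x [^] n \<otimes> y" for n :: nat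
  proof (induction n)
    case (Suc n)
    then show ?case unfolding nat_pow_Suc Suc using c by (simp add: m_assoc cancel_inv)
  qed (use c in simp)
  have "(x \<otimes> z) [^] p = \<one>"
    unfolding conj[symmetric] pow xp using c by simp
  then show "commutator G x y [^] p = \<one>"
    using pow_commutator(3)[OF c(1) zc tc(1) zx, of p] xp tb zc by (simp add: z_def)
qed

end

lemma (in group_hom) hom_commutator:
  assumes "x \<in> carrier G" "y \<in> carrier G"
  shows "h (commutator G x y) = commutator H (h x) (h y)"
  using assms by (simp add: commutator_def)

section \<open>Free groups and presentations\<close>

lemma free_eq_append:
  assumes "free_eq u u'" "free_eq v v'"
  shows "free_eq (u @ v) (u' @ v')"
proof -
  have left: "free_eq (w @ u) (w @ v)" if "free_eq u v" for u v w :: "('a \<times> bool) list"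
    using that
  proof (induction rule: free_eq.induct)
    case (cancel u x b v)
    then show ?case using free_eq.cancel[of "w @ u"] by simp
  qed (auto intro: free_eq.intros)
  have right: "free_eq (u @ w) (v @ w)" if "free_eq u v" for u v w :: "('a \<times> bool) list"
    using that
  proof (induction rule: free_eq.induct)
    case (cancel u x b v)
    then show ?case using free_eq.cancel[of u x b "v @ w"] by simp
  qed (auto intro: free_eq.intros)
  show ?thesis
    using left[OF assms(2)] right[OF assms(1)] free_eq.trans by blast
qed

lemma free_class_eq_iff: "free_class u = free_class v \<longleftrightarrow> free_eq u v"
  unfolding free_class_def using free_eq.intros(1-3) by blast

lemma free_group_mult: "free_class u \<otimes>\<^bsub>free_group\<^esub> free_class v = free_class (u @ v)"
proof -
  have "free_class (u' @ v') = free_class (u @ v)"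
    if "u' \<in> free_class u" "v' \<in> free_class v" for u' v'
    using that free_eq_append free_eq.sym by (metis free_class_def free_class_eq_iff mem_Collect_eq)
  moreover have "u \<in> free_class u" "v \<in> free_class v"
    by (simp_all add: free_class_def free_eq.refl)
  ultimately have "(\<Union>u'\<in>free_class u. \<Union>v'\<in>free_class v. free_class (u' @ v')) = free_class (u @ v)"
    by blast
  then show ?thesis
    by (simp add: free_group_def)
qed

lemma carrier_free_group: "carrier free_group = range free_class"
  by (simp add: free_group_def)

lemma one_free_group: "\<one>\<^bsub>free_group\<^esub> = free_class []"
  by (simp add: free_group_def)

definition inv_word :: "('x \<times> bool) list \<Rightarrow> ('x \<times> bool) list" where
  "inv_word u = rev (map (\<lambda>(x, b). (x, \<not> b)) u)"

lemma free_eq_inv_word: "free_eq (inv_word u @ u) []"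
proof (induction u)
  case (Cons l u)
  obtain x b where l: "l = (x, b)" by force
  have "free_eq (inv_word (l # u) @ l # u) (inv_word u @ u)"
    using free_eq.cancel[of "inv_word u" x "\<not> b" u] by (simp add: l inv_word_def)
  then show ?case using Cons free_eq.trans by blast
qed (simp add: inv_word_def free_eq.refl)

lemma group_free_group: "group free_group"
proof (rule groupI)
  fix x assume "x \<in> carrier (free_group :: ('a \<times> bool) list set monoid)"
  then obtain u where u: "x = free_class u" by (auto simp: carrier_free_group)
  have "free_class (inv_word u) \<otimes>\<^bsub>free_group\<^esub> x = \<one>\<^bsub>free_group\<^esub>"
    by (simp add: u free_group_mult one_free_group free_class_eq_iff free_eq_inv_word)
  then show "\<exists>y\<in>carrier free_group. y \<otimes>\<^bsub>free_group\<^esub> x = \<one>\<^bsub>free_group\<^esub>"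
    by (auto simp: carrier_free_group)
qed (auto simp: carrier_free_group one_free_group free_group_mult)

lemma free_gen_closed [simp]: "free_gen x \<in> carrier free_group"
  by (simp add: carrier_free_group free_gen_def)

lemma inv_free_gen: "inv\<^bsub>free_group\<^esub> (free_gen x) = free_class [(x, False)]"
  by (rule group.inv_equality[OF group_free_group])
    (use free_eq.cancel[of "[]" x False "[]"] rangeI[of free_class]
      in \<open>simp_all add: free_gen_def free_group_mult one_free_group free_class_eq_iff carrier_free_group\<close>)

lemma free_group_induct [consumes 1, case_names one gen inv]:
  assumes "w \<in> carrier free_group"
    and "P \<one>\<^bsub>free_group\<^esub>"
    and "\<And>w x. w \<in> carrier free_group \<Longrightarrow> P w \<Longrightarrow> P (w \<otimes>\<^bsub>free_group\<^esub> free_gen x)"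
    and "\<And>w x. w \<in> carrier free_group \<Longrightarrow> P w \<Longrightarrow> P (w \<otimes>\<^bsub>free_group\<^esub> inv\<^bsub>free_group\<^esub> (free_gen x))"
  shows "P w"
proof -
  have "P (free_class u)" for u
  proof (induction u rule: rev_induct)
    case Nil
    then show ?case using assms(2) by (simp add: one_free_group)
  next
    case (snoc l u)
    obtain x b where l: "l = (x, b)" by force
    have "free_class u \<in> carrier free_group" by (simp add: carrier_free_group)
    with assms(3)[OF this snoc, of x] assms(4)[OF this snoc, of x] show ?case
      by (cases b) (simp_all add: l inv_free_gen, simp_all add: free_gen_def free_group_mult)
  qed
  then show ?thesis using assms(1) by (auto simp: carrier_free_group)
qed

primrec eval_word :: "('e, 'd) monoid_scheme \<Rightarrow> ('x \<Rightarrow> 'e) \<Rightarrow> ('x \<times> bool) list \<Rightarrow> 'e" where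
  "eval_word E v [] = \<one>\<^bsub>E\<^esub>"
| "eval_word E v (l # u) =
     (if snd l then v (fst l) else inv\<^bsub>E\<^esub> (v (fst l))) \<otimes>\<^bsub>E\<^esub> eval_word E v u"

context group
begin

lemma eval_word_closed:
  assumes "range v \<subseteq> carrier G"
  shows "eval_word G v u \<in> carrier G"
  using assms by (induction u) auto

lemma eval_word_append:
  assumes "range v \<subseteq> carrier G"
  shows "eval_word G v (u @ w) = eval_word G v u \<otimes> eval_word G v w"
proof (induction u)
  case (Cons l u)
  have "v (fst l) \<in> carrier G" using assms by auto
  with Cons show ?case by (simp add: m_assoc eval_word_closed[OF assms])
qed (simp add: eval_word_closed[OF assms])

lemma eval_word_free_eq:
  assumes v: "range v \<subseteq> carrier G" and "free_eq u w"
  shows "eval_word G v u = eval_word G v w"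
  using assms(2)
proof (induction rule: free_eq.induct)
  case (cancel u x b w)
  have "v x \<in> carrier G" using v by auto
  then show ?case
    by (simp add: eval_word_append[OF v] eval_word_closed[OF v] cancel_inv)
qed simp_all

theorem free_group_universal:
  assumes v: "range v \<subseteq> carrier G"
  obtains h where "h \<in> hom free_group G" "\<And>x. h (free_gen x) = v x"
proof
  define h where "h W = eval_word G v (SOME u. W = free_class u)" for W
  have h: "h (free_class u) = eval_word G v u" for u
  proof -
    have "free_class u = free_class (SOME w. free_class u = free_class w)"
      by (rule someI) simp
    then show ?thesis
      unfolding h_def using eval_word_free_eq[OF v] by (metis free_class_eq_iff)
  qed
  show "h \<in> hom free_group G"
    by (rule homI)
      (auto simp: carrier_free_group h free_group_mult eval_word_append[OF v] eval_word_closed[OF v])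
  show "h (free_gen x) = v x" for x
    using range_subsetD[OF v] by (simp add: free_gen_def h)
qed

end

lemma normal_normal_closure:
  assumes "group G" "S \<subseteq> carrier G"
  shows "normal_closure G S \<lhd> G" "S \<subseteq> normal_closure G S"
proof -
  interpret group G by fact
  have c: "carrier G \<lhd> G"
    unfolding normal_inv_iff by (simp add: subgroup_self)
  have sub: "subgroup (normal_closure G S) G"
    unfolding normal_closure_def
    by (rule subgroups_Inter) (use c assms in \<open>auto simp: normal_def\<close>)
  show "normal_closure G S \<lhd> G"
    unfolding normal_inv_iff
  proof (intro conjI ballI sub)
    fix x h assume x: "x \<in> carrier G" and h: "h \<in> normal_closure G S"
    show "x \<otimes>\<^bsub>G\<^esub> h \<otimes>\<^bsub>G\<^esub> inv\<^bsub>G\<^esub> x \<in> normal_closure G S"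
      using h x unfolding normal_closure_def by (auto intro: normal.inv_op_closed2)
  qed
  show "S \<subseteq> normal_closure G S"
    by (auto simp: normal_closure_def)
qed

locale presentation =
  fixes rels :: "('x \<times> bool) list set set"
  assumes rels: "rels \<subseteq> carrier free_group"
begin

definition proj :: "('x \<times> bool) list set \<Rightarrow> ('x \<times> bool) list set set" where
  "proj w = normal_closure free_group rels #>\<^bsub>free_group\<^esub> w"

lemmas normal_rels = normal_normal_closure[OF group_free_group rels]

lemma group_presented: "group (presented_group rels)"
  unfolding presented_group_def by (rule normal.factorgroup_is_group[OF normal_rels(1)])

lemma proj_hom: "group_hom free_group (presented_group rels) proj"
  using normal.r_coset_hom_Mod[OF normal_rels(1)] group_presented group_free_group
  unfolding proj_def [abs_def] presented_group_def by (simp add: group_hom_def group_hom_axioms_def)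

lemma proj_surj: "carrier (presented_group rels) = proj ` carrier free_group"
  unfolding presented_group_def proj_def carrier_FactGroup ..

lemma proj_rels:
  assumes "r \<in> rels"
  shows "proj r = \<one>\<^bsub>presented_group rels\<^esub>"
proof -
  have "subgroup (normal_closure free_group rels) free_group"
    using normal_rels(1) by (rule normal_imp_subgroup)
  then show ?thesis
    using subgroup.rcos_const[OF _ group_free_group] assms normal_rels(2)
    unfolding proj_def presented_group_def one_FactGroup by blast
qed

lemma presented_induct [consumes 1, case_names one gen inv]:
  assumes "g \<in> carrier (presented_group rels)"
    and "P \<one>\<^bsub>presented_group rels\<^esub>"
    and "\<And>g x. g \<in> carrier (presented_group rels) \<Longrightarrow> P g \<Longrightarrow>
      P (g \<otimes>\<^bsub>presented_group rels\<^esub> proj (free_gen x))"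
    and "\<And>g x. g \<in> carrier (presented_group rels) \<Longrightarrow> P g \<Longrightarrow>
      P (g \<otimes>\<^bsub>presented_group rels\<^esub> inv\<^bsub>presented_group rels\<^esub> proj (free_gen x))"
  shows "P g"
proof -
  interpret group_hom free_group "presented_group rels" proj by (rule proj_hom)
  have "P (proj w)" if "w \<in> carrier free_group" for w
    using that
  proof (induction rule: free_group_induct)
    case one then show ?case using assms(2) by simp
  next
    case (gen w x) then show ?case using assms(3)[of "proj w" x] by simp
  next
    case (inv w x) then show ?case using assms(4)[of "proj w" x] by simp
  qed
  then show ?thesis using assms(1) by (auto simp: proj_surj)
qed

theorem presented_universal:
  assumes E: "group E" and h: "h \<in> hom free_group E" and r: "\<And>r. r \<in> rels \<Longrightarrow> h r = \<one>\<^bsub>E\<^esub>"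
  obtains k where "group_hom (presented_group rels) E k"
    "\<And>w. w \<in> carrier free_group \<Longrightarrow> k (proj w) = h w"
proof -
  interpret h: group_hom free_group E h
    using E h by (simp add: group_hom_def group_hom_axioms_def group_free_group)
  have "normal_closure free_group rels \<subseteq> kernel free_group E h"
    unfolding normal_closure_def
    by (rule Inter_lower) (use h.normal_kernel r rels in \<open>auto simp: kernel_def\<close>)
  then have one: "h w = \<one>\<^bsub>E\<^esub>" if "w \<in> normal_closure free_group rels" for w
    using that by (auto simp: kernel_def)
  have eq: "h w = h w'" if w: "w \<in> carrier free_group" "w' \<in> carrier free_group" and p: "proj w = proj w'" for w w'
  proof -
    have "w \<in> proj w'"
      using group.rcos_self[OF group_free_group w(1) normal_imp_subgroup[OF normal_rels(1)]] p
      by (simp add: proj_def)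
    then obtain n where "n \<in> normal_closure free_group rels" "w = n \<otimes>\<^bsub>free_group\<^esub> w'"
      by (auto simp: proj_def r_coset_def)
    moreover then have "n \<in> carrier free_group"
      using normal_imp_subgroup[OF normal_rels(1)] by (meson subgroup.mem_carrier)
    ultimately show ?thesis using w one by simp
  qed
  define k where "k W = h (SOME w. w \<in> carrier free_group \<and> proj w = W)" for W
  have k: "k (proj w) = h w" if "w \<in> carrier free_group" for w
    unfolding k_def by (rule eq, use someI[of "\<lambda>u. u \<in> carrier free_group \<and> proj u = proj w" w] that in auto)
  interpret p: group_hom free_group "presented_group rels" proj by (rule proj_hom)
  have "k \<in> hom (presented_group rels) E"
    by (rule homI) (auto simp: proj_surj k simp flip: p.hom_mult)
  then show ?thesis
    using that k by (simp add: group_hom_def group_hom_axioms_def group_presented E)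
qed

end

section \<open>The universal property of \<open>G_star\<close>\<close>

text \<open>The recipe of \<open>named_elt\<close>, carried out in an arbitrary group with arbitrary images of the four
  generators.\<close>

definition named_in :: "('e, 'd) monoid_scheme \<Rightarrow> (gen \<Rightarrow> 'e) \<Rightarrow> name \<Rightarrow> 'e" where
  "named_in E v a =
     (let c = commutator E; x1 = v GX1; x2 = v GX2; y1 = v GY1; y2 = v GY2;
          z1 = c x1 x2; z2 = c y1 y2
      in case a of
           X1 \<Rightarrow> x1 | X2 \<Rightarrow> x2 | Y1 \<Rightarrow> y1 | Y2 \<Rightarrow> y2 | Z1 \<Rightarrow> z1 | Z2 \<Rightarrow> z2
         | T1 \<Rightarrow> c z1 x1 | T2 \<Rightarrow> c z1 x2 | T3 \<Rightarrow> c z2 y1 | T4 \<Rightarrow> c z2 y2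
         | T5 \<Rightarrow> c x1 y1 | T6 \<Rightarrow> c x1 y2 | T7 \<Rightarrow> c x2 y1 | T8 \<Rightarrow> c x2 y2)"

abbreviation tnames :: "name set" where
  "tnames \<equiv> {T1, T2, T3, T4, T5, T6, T7, T8}"

lemma named_elt_eq_named_in: "named_elt a = named_in free_group free_gen a"
  unfolding named_elt_def named_in_def ..

lemma named_in_simps [simp]:
  "named_in E v X1 = v GX1" "named_in E v X2 = v GX2"
  "named_in E v Y1 = v GY1" "named_in E v Y2 = v GY2"
  "named_in E v Z1 = commutator E (v GX1) (v GX2)"
  "named_in E v Z2 = commutator E (v GY1) (v GY2)"
  "named_in E v T1 = commutator E (commutator E (v GX1) (v GX2)) (v GX1)"
  "named_in E v T2 = commutator E (commutator E (v GX1) (v GX2)) (v GX2)"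
  "named_in E v T3 = commutator E (commutator E (v GY1) (v GY2)) (v GY1)"
  "named_in E v T4 = commutator E (commutator E (v GY1) (v GY2)) (v GY2)"
  "named_in E v T5 = commutator E (v GX1) (v GY1)"
  "named_in E v T6 = commutator E (v GX1) (v GY2)"
  "named_in E v T7 = commutator E (v GX2) (v GY1)"
  "named_in E v T8 = commutator E (v GX2) (v GY2)"
  by (simp_all add: named_in_def Let_def)

lemma (in group) named_in_closed:
  assumes "\<And>g. v g \<in> carrier G"
  shows "named_in G v a \<in> carrier G"
  using assms by (cases a) simp_all

lemma (in group_hom) hom_named_in:
  assumes "\<And>g. v g \<in> carrier G"
  shows "h (named_in G v a) = named_in H (\<lambda>g. h (v g)) a"
  using assms by (cases a) (simp_all add: hom_commutator)

text \<open>For odd \<open>p\<close> these conditions imply all relations of the presentation, in any group: the commutators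
  \<open>[z\<^sub>1, y\<^sub>j]\<close>, \<open>[z\<^sub>2, x\<^sub>j]\<close>, \<open>[z\<^sub>1, z\<^sub>2]\<close> are trivial by \<open>star_tuple_z_commute\<close>, and \<open>z\<^sub>1\<^sup>p = z\<^sub>2\<^sup>p = \<one>\<close>
  holds by \<open>pow_commutator_eq_one\<close>.\<close>

definition star_tuple :: "nat \<Rightarrow> ('e, 'd) monoid_scheme \<Rightarrow> (gen \<Rightarrow> 'e) \<Rightarrow> bool" where
  "star_tuple p E v \<longleftrightarrow> (\<forall>g. v g \<in> carrier E \<and> v g [^]\<^bsub>E\<^esub> p = \<one>\<^bsub>E\<^esub>) \<and>
     (\<forall>a\<in>tnames. named_in E v a \<in> group_center E)"

context group
begin

text \<open>The \<open>x\<^sub>i\<close> commute with the \<open>y\<^sub>j\<close> up to the central elements \<open>t\<^sub>5, \<dots>, t\<^sub>8\<close>, so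
  \<open>commutator_commutes\<close> applies.\<close>

lemma star_tuple_z_commute:
  assumes v: "star_tuple p G v"
  shows "commutator G (v GX1) (v GX2) \<otimes> v GY1 = v GY1 \<otimes> commutator G (v GX1) (v GX2)"
    and "commutator G (v GX1) (v GX2) \<otimes> v GY2 = v GY2 \<otimes> commutator G (v GX1) (v GX2)"
    and "commutator G (v GY1) (v GY2) \<otimes> v GX1 = v GX1 \<otimes> commutator G (v GY1) (v GY2)"
    and "commutator G (v GY1) (v GY2) \<otimes> v GX2 = v GX2 \<otimes> commutator G (v GY1) (v GY2)"
    and "commutator G (v GX1) (v GX2) \<otimes> commutator G (v GY1) (v GY2) =
      commutator G (v GY1) (v GY2) \<otimes> commutator G (v GX1) (v GX2)"
proof -
  have c: "v g \<in> carrier G" for g using v by (simp add: star_tuple_def)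
  have t: "commutator G (v GX1) (v GY1) \<in> group_center G" "commutator G (v GX1) (v GY2) \<in> group_center G"
    "commutator G (v GX2) (v GY1) \<in> group_center G" "commutator G (v GX2) (v GY2) \<in> group_center G"
    using v by (simp_all add: star_tuple_def)
  note t' = t[THEN commutator_flip_center[OF c c]]
  show z1y: "commutator G (v GX1) (v GX2) \<otimes> v GY1 = v GY1 \<otimes> commutator G (v GX1) (v GX2)"
    "commutator G (v GX1) (v GX2) \<otimes> v GY2 = v GY2 \<otimes> commutator G (v GX1) (v GX2)"
    by (rule commutator_commutes[OF c c c]; fact t)+
  show "commutator G (v GY1) (v GY2) \<otimes> v GX1 = v GX1 \<otimes> commutator G (v GY1) (v GY2)"
    "commutator G (v GY1) (v GY2) \<otimes> v GX2 = v GX2 \<otimes> commutator G (v GY1) (v GY2)"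
    by (rule commutator_commutes[OF c c c]; fact t')+
  have one: "\<one> \<in> group_center G" using subgroup_group_center by (rule subgroup.one_closed)
  show "commutator G (v GX1) (v GX2) \<otimes> commutator G (v GY1) (v GY2) =
      commutator G (v GY1) (v GY2) \<otimes> commutator G (v GX1) (v GX2)"
    by (rule commutator_commutes[symmetric])
      (use c z1y one in \<open>simp_all add: iffD2[OF commutator_eq_one_iff]\<close>)
qed

lemma star_tuple_unstated:
  assumes v: "star_tuple p G v" and ab: "(a, b) \<notin> stated_pairs" "(b, a) \<notin> stated_pairs"
  shows "commutator G (named_in G v a) (named_in G v b) = \<one>"
proof -
  have c: "v g \<in> carrier G" for g using v by (simp add: star_tuple_def)
  consider "a \<in> tnames" | "b \<in> tnames" | "a \<notin> tnames" "b \<notin> tnames" by blast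
  then show ?thesis
  proof cases
    case 1
    then have "named_in G v a \<in> group_center G" using v unfolding star_tuple_def by blast
    then show ?thesis by (simp add: named_in_closed c)
  next
    case 2
    then have "named_in G v b \<in> group_center G" using v unfolding star_tuple_def by blast
    then show ?thesis by (simp add: named_in_closed c)
  next
    case 3
    note z = star_tuple_z_commute[OF v]
    have "named_in G v a \<otimes> named_in G v b = named_in G v b \<otimes> named_in G v a"
      using 3 ab unfolding stated_pairs_def
      by (cases a; cases b; simp only: named_in_simps z; simp)
    then show ?thesis
      by (simp add: commutator_eq_one_iff named_in_closed c)
  qed
qed

lemma star_tuple_pow:
  assumes v: "star_tuple p G v" and p: "odd p" and a: "a \<in> {X1, X2, Y1, Y2, Z1, Z2}"
  shows "named_in G v a [^] p = \<one>"
  using a v pow_commutator_eq_one[of "v GX1" "v GX2" p]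
    pow_commutator_eq_one[of "v GY1" "v GY2" p] p
  by (auto simp: star_tuple_def)

end

interpretation star: presentation "relators p" for p
  by unfold_locales
    (auto simp: relators_def named_elt_eq_named_in
      intro!: group.commutator_closed[OF group_free_group] group.named_in_closed[OF group_free_group]
        monoid.nat_pow_closed[OF group.is_monoid[OF group_free_group]])

definition star_gen :: "nat \<Rightarrow> gen \<Rightarrow> (gen \<times> bool) list set set" where
  "star_gen p g = star.proj p (free_gen g)"

abbreviation star_elt :: "nat \<Rightarrow> name \<Rightarrow> (gen \<times> bool) list set set" where
  "star_elt p \<equiv> named_in (G_star p) (star_gen p)"

lemma group_G_star: "group (G_star p)"
  unfolding G_star_def by (rule star.group_presented)

lemma group_hom_star_proj: "group_hom free_group (G_star p) (star.proj p)"
  unfolding G_star_def by (rule star.proj_hom)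

lemma star_gen_closed [simp]: "star_gen p g \<in> carrier (G_star p)"
proof -
  interpret group_hom free_group "G_star p" "star.proj p" by (rule group_hom_star_proj)
  show ?thesis by (simp add: star_gen_def)
qed

lemma star_proj_named: "star.proj p (named_elt a) = star_elt p a"
  unfolding named_elt_eq_named_in star_gen_def
  by (rule group_hom.hom_named_in[OF group_hom_star_proj]) simp

lemma G_star_subgroup_eq:
  assumes S: "subgroup S (G_star p)" and "\<And>g. star_gen p g \<in> S"
  shows "carrier (G_star p) = S"
proof -
  have "x \<in> S" if "x \<in> carrier (G_star p)" for x
    using that[unfolded G_star_def]
    by (induction rule: star.presented_induct)
      (use assms in \<open>auto simp: star_gen_def G_star_def
        intro: subgroup.one_closed subgroup.m_closed subgroup.m_inv_closed\<close>)
  then show ?thesis using subgroup.subset[OF S] by blast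
qed

lemma group_hom_G_star_eqI:
  assumes "group_hom (G_star p) H h" "group_hom (G_star p) H k"
    and "\<And>g. h (star_gen p g) = k (star_gen p g)" and "x \<in> carrier (G_star p)"
  shows "h x = k x"
proof -
  interpret h: group_hom "G_star p" H h by fact
  interpret k: group_hom "G_star p" H k by fact
  have "subgroup {x \<in> carrier (G_star p). h x = k x} (G_star p)"
    by (rule group.subgroupI[OF group_G_star]) auto
  from G_star_subgroup_eq[OF this] show ?thesis using assms(3,4) by auto
qed

lemma star_tuple_star_gen: "star_tuple p (G_star p) (star_gen p)"
proof -
  interpret group_hom free_group "G_star p" "star.proj p" by (rule group_hom_star_proj)
  have cl: "named_elt a \<in> carrier free_group" for a
    unfolding named_elt_eq_named_in by (rule G.named_in_closed) simp
  have comm: "commutator (G_star p) (star_elt p a) (star_elt p b) = \<one>\<^bsub>G_star p\<^esub>"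
    if "(a, b) \<notin> stated_pairs" "(b, a) \<notin> stated_pairs" for a b
  proof -
    have "star.proj p (commutator free_group (named_elt a) (named_elt b)) = \<one>\<^bsub>G_star p\<^esub>"
      unfolding G_star_def by (rule star.proj_rels) (use that in \<open>auto simp: relators_def\<close>)
    then show ?thesis by (simp add: hom_commutator cl star_proj_named)
  qed
  have "star_gen p g [^]\<^bsub>G_star p\<^esub> p = \<one>\<^bsub>G_star p\<^esub>" for g
  proof -
    obtain a where a: "a \<in> {X1, X2, Y1, Y2}" "star_gen p g = star_elt p a"
      by (cases g) (auto intro: that[of X1] that[of X2] that[of Y1] that[of Y2])
    have "star.proj p (named_elt a [^]\<^bsub>free_group\<^esub> p) = \<one>\<^bsub>G_star p\<^esub>"
      unfolding G_star_def by (rule star.proj_rels) (use a in \<open>auto simp: relators_def\<close>)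
    then show ?thesis by (simp add: hom_nat_pow cl star_proj_named a)
  qed
  moreover have "star_elt p a \<in> group_center (G_star p)" if a: "a \<in> tnames" for a
  proof -
    let ?C = "{x \<in> carrier (G_star p). \<forall>s\<in>{star_elt p a}. x \<otimes>\<^bsub>G_star p\<^esub> s = s \<otimes>\<^bsub>G_star p\<^esub> x}"
    have ac: "star_elt p a \<in> carrier (G_star p)" by (rule H.named_in_closed) simp
    have "star_gen p g \<in> ?C" for g
    proof -
      obtain b where b: "b \<in> {X1, X2, Y1, Y2}" "star_gen p g = star_elt p b"
        by (cases g) (auto intro: that[of X1] that[of X2] that[of Y1] that[of Y2])
      have "commutator (G_star p) (star_gen p g) (star_elt p a) = \<one>\<^bsub>G_star p\<^esub>"
        unfolding b(2) by (rule comm) (use a b(1) in \<open>auto simp: stated_pairs_def\<close>)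
      then show ?thesis using ac by (simp add: H.commutator_eq_one_iff)
    qed
    then have "carrier (G_star p) = ?C"
      by (intro G_star_subgroup_eq H.subgroup_commuting) (use ac in auto)
    then show ?thesis using ac unfolding group_center_def by auto
  qed
  ultimately show ?thesis by (simp add: star_tuple_def)
qed

text \<open>The only source of homomorphisms out of \<open>G_star p\<close> below. The targets will be the Heisenberg group,
  the group \<open>quad_group p\<close>, and central extensions of the Heisenberg group by nonzero complex numbers.\<close>

theorem G_star_universal:
  assumes E: "group E" and p: "odd p" and v: "star_tuple p E v"
  obtains k where "group_hom (G_star p) E k" "\<And>g. k (star_gen p g) = v g"
    "\<And>a. k (star_elt p a) = named_in E v a"
proof -
  interpret E: group E by fact
  have vc: "v g \<in> carrier E" for g using v by (simp add: star_tuple_def)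
  obtain h where h: "h \<in> hom free_group E" "\<And>x. h (free_gen x) = v x"
    using E.free_group_universal[of v] vc by blast
  interpret h: group_hom free_group E h
    using E h by (simp add: group_hom_def group_hom_axioms_def group_free_group)
  have named: "h (named_elt a) = named_in E v a" for a
    unfolding named_elt_eq_named_in by (subst h.hom_named_in) (simp_all add: h(2))
  have cl: "named_elt a \<in> carrier free_group" for a
    unfolding named_elt_eq_named_in by (rule group.named_in_closed[OF group_free_group]) simp
  have "h r = \<one>\<^bsub>E\<^esub>" if "r \<in> relators p" for r
    using that unfolding relators_def
  proof (elim UnE CollectE exE conjE)
    fix a b assume "r = commutator free_group (named_elt a) (named_elt b)"
      "(a, b) \<notin> stated_pairs" "(b, a) \<notin> stated_pairs"
    then show ?thesis
      using E.star_tuple_unstated[OF v] by (simp add: h.hom_commutator cl named del: named_in_simps)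
  next
    fix a assume "r = named_elt a [^]\<^bsub>free_group\<^esub> p" "a \<in> {X1, X2, Y1, Y2, Z1, Z2}"
    then show ?thesis
      using E.star_tuple_pow[OF v p] by (simp add: h.hom_nat_pow cl named del: named_in_simps insert_iff)
  qed
  from star.presented_universal[OF E h(1) this]
  obtain k where k: "group_hom (G_star p) E k"
    "\<And>w. w \<in> carrier free_group \<Longrightarrow> k (star.proj p w) = h w"
    unfolding G_star_def by blast
  have kg: "k (star_gen p g) = v g" for g by (simp add: star_gen_def k(2) h(2))
  show ?thesis
    by (rule that[OF k(1) kg], subst group_hom.hom_named_in[OF k(1)]) (simp_all add: kg)
qed

section \<open>The Heisenberg group\<close>

text \<open>The unitriangular matrix with \<open>a\<close>, \<open>b\<close> above the diagonal and \<open>c\<close> in the corner.\<close>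

definition heis :: "('a, 'b) ring_scheme \<Rightarrow> 'a \<Rightarrow> 'a \<Rightarrow> 'a \<Rightarrow> nat \<times> nat \<Rightarrow> 'a" where
  "heis R a b c = (\<lambda>(i, j)\<in>{..<3} \<times> {..<3}.
     if i = j then \<one>\<^bsub>R\<^esub> else if (i, j) = (0, 1) then a else if (i, j) = (1, 2) then b
     else if (i, j) = (0, 2) then c else \<zero>\<^bsub>R\<^esub>)"

lemma lessThan_3: "{..<3 :: nat} = {0, Suc 0, 2}"
  by auto

context ring
begin

lemma heis_eq_iff: "heis R a b c = heis R a' b' c' \<longleftrightarrow> a = a' \<and> b = b' \<and> c = c'"
proof
  assume eq: "heis R a b c = heis R a' b' c'"
  show "a = a' \<and> b = b' \<and> c = c'"
    using fun_cong[OF eq, of "(0, 1)"] fun_cong[OF eq, of "(1, 2)"] fun_cong[OF eq, of "(0, 2)"]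
    by (simp add: heis_def)
qed simp

lemma heis_entries:
  "heis R a b c (0, 0) = \<one>" "heis R a b c (0, Suc 0) = a" "heis R a b c (0, 2) = c"
  "heis R a b c (Suc 0, 0) = \<zero>" "heis R a b c (Suc 0, Suc 0) = \<one>" "heis R a b c (Suc 0, 2) = b"
  "heis R a b c (2, 0) = \<zero>" "heis R a b c (2, Suc 0) = \<zero>" "heis R a b c (2, 2) = \<one>"
  by (simp_all add: heis_def)

lemma less_3_cases:
  assumes "ij \<in> {..<3} \<times> {..<3}"
  obtains "ij = (0, 0)" | "ij = (0, Suc 0)" | "ij = (0, 2)" | "ij = (Suc 0, 0)" | "ij = (Suc 0, Suc 0)"
    | "ij = (Suc 0, 2)" | "ij = (2, 0)" | "ij = (2, Suc 0)" | "ij = (2, 2 :: nat)"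
proof -
  obtain i j where ij: "ij = (i, j)" "i < 3" "j < 3" using assms by auto
  then have "i = 0 \<or> i = Suc 0 \<or> i = 2" "j = 0 \<or> j = Suc 0 \<or> j = 2" by linarith+
  then show ?thesis using that unfolding ij(1) by (elim disjE) simp_all
qed

lemma heis_closed:
  "a \<in> carrier R \<Longrightarrow> b \<in> carrier R \<Longrightarrow> c \<in> carrier R \<Longrightarrow> heis R a b c \<in> carrier (heisenberg3 R)"
  by (auto simp: unitriangular_def heis_def)

lemma heis_exhaust:
  assumes "A \<in> carrier (heisenberg3 R)"
  obtains a b c where "a \<in> carrier R" "b \<in> carrier R" "c \<in> carrier R" "A = heis R a b c"
proof
  have A: "A \<in> {..<3} \<times> {..<3} \<rightarrow>\<^sub>E carrier R" "\<And>i. i < 3 \<Longrightarrow> A (i, i) = \<one>"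
    "\<And>i j. i < 3 \<Longrightarrow> j < i \<Longrightarrow> A (i, j) = \<zero>"
    using assms by (auto simp: unitriangular_def)
  show "A (0, 1) \<in> carrier R" "A (1, 2) \<in> carrier R" "A (0, 2) \<in> carrier R"
    using A(1) by (auto simp: PiE_def Pi_def)
  show "A = heis R (A (0, 1)) (A (1, 2)) (A (0, 2))"
  proof (rule extensionalityI[where A = "{..<3} \<times> {..<3}"])
    fix ij :: "nat \<times> nat" assume "ij \<in> {..<3} \<times> {..<3}"
    then show "A ij = heis R (A (0, 1)) (A (1, 2)) (A (0, 2)) ij"
      by (cases rule: less_3_cases)
        (simp_all add: heis_entries A(2)[of 0] A(2)[of "Suc 0"] A(2)[of 2]
          A(3)[of "Suc 0" 0] A(3)[of 2 0] A(3)[of 2 "Suc 0"])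
  qed (use A(1) in \<open>auto simp: PiE_def heis_def\<close>)
qed

lemma heis_mult:
  assumes "a \<in> carrier R" "b \<in> carrier R" "c \<in> carrier R" "a' \<in> carrier R" "b' \<in> carrier R" "c' \<in> carrier R"
  shows "heis R a b c \<otimes>\<^bsub>heisenberg3 R\<^esub> heis R a' b' c' =
    heis R (a \<oplus> a') (b \<oplus> b') (c \<oplus> c' \<oplus> a \<otimes> b')"
proof (rule extensionalityI[where A = "{..<3} \<times> {..<3}"])
  fix ij :: "nat \<times> nat" assume "ij \<in> {..<3} \<times> {..<3}"
  moreover from this have "(heis R a b c \<otimes>\<^bsub>heisenberg3 R\<^esub> heis R a' b' c') ij =
      (\<Oplus>k\<in>{0, Suc 0, 2}. heis R a b c (fst ij, k) \<otimes> heis R a' b' c' (k, snd ij))"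
    by (simp add: unitriangular_def lessThan_3 case_prod_beta)
  ultimately show "(heis R a b c \<otimes>\<^bsub>heisenberg3 R\<^esub> heis R a' b' c') ij =
      heis R (a \<oplus> a') (b \<oplus> b') (c \<oplus> c' \<oplus> a \<otimes> b') ij"
    using assms by (cases rule: less_3_cases) (simp_all add: heis_entries a_ac)
qed (auto simp: unitriangular_def heis_def)

lemma heis_one: "\<one>\<^bsub>heisenberg3 R\<^esub> = heis R \<zero> \<zero> \<zero>"
  by (rule ext) (auto simp: unitriangular_def heis_def)

lemma group_heisenberg3: "group (heisenberg3 R)"
proof (rule groupI)
  fix x assume "x \<in> carrier (heisenberg3 R)"
  then obtain a b c where x: "a \<in> carrier R" "b \<in> carrier R" "c \<in> carrier R" "x = heis R a b c"
    by (rule heis_exhaust)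
  have "heis R (\<ominus> a) (\<ominus> b) (a \<otimes> b \<ominus> c) \<otimes>\<^bsub>heisenberg3 R\<^esub> x = \<one>\<^bsub>heisenberg3 R\<^esub>"
    using x(1-3) by (simp add: x(4) heis_mult heis_one l_neg l_minus minus_eq a_ac)
      (simp add: a_assoc[symmetric] r_neg l_neg)
  then show "\<exists>y\<in>carrier (heisenberg3 R). y \<otimes>\<^bsub>heisenberg3 R\<^esub> x = \<one>\<^bsub>heisenberg3 R\<^esub>"
    using x heis_closed[of "\<ominus> a" "\<ominus> b" "a \<otimes> b \<ominus> c"] by auto
qed (auto elim!: heis_exhaust simp: heis_mult heis_one heis_closed heis_eq_iff l_distr r_distr a_ac)

end

section \<open>A test group for the central commutators\<close>

text \<open>An element \<open>qmod p l u b c\<close> stands for the translation by \<open>l\<close> together with the polynomial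
  \<open>q(X) = u X\<^sup>2 + b X + c\<close> modulo \<open>p\<close>. The product of \<open>(l, q)\<close> and \<open>(l', q')\<close> is
  \<open>(l + l', q(X) + q'(X + l))\<close>, a semidirect product. Commutators with a translation are difference
  operators, so a translation and \<open>X\<^sup>2\<close> generate a group of class three, whereas a translation and
  \<open>X\<close> generate a Heisenberg group. Working with \<open>X\<^sup>2\<close> instead of a binomial coefficient keeps all
  formulas integral.\<close>

definition qmod :: "nat \<Rightarrow> int \<Rightarrow> int \<Rightarrow> int \<Rightarrow> int \<Rightarrow> int \<times> int \<times> int \<times> int" where
  "qmod p l u b c = (l mod int p, u mod int p, b mod int p, c mod int p)"

definition quad_group :: "nat \<Rightarrow> (int \<times> int \<times> int \<times> int) monoid" where
  "quad_group p = \<lparr>carrier = {qmod p l u b c | l u b c. True},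
     monoid.mult = (\<lambda>(l, u, b, c) (l', u', b', c').
       qmod p (l + l') (u + u') (b + b' + 2 * l * u') (c + c' + l * b' + l\<^sup>2 * u')),
     one = qmod p 0 0 0 0\<rparr>"

lemma qmod_closed [simp]: "qmod p l u b c \<in> carrier (quad_group p)"
  by (auto simp: quad_group_def)

lemma qmod_eq_iff:
  "qmod p l u b c = qmod p l' u' b' c' \<longleftrightarrow>
    [l = l'] (mod int p) \<and> [u = u'] (mod int p) \<and> [b = b'] (mod int p) \<and> [c = c'] (mod int p)"
  by (simp add: qmod_def cong_def)

lemma qmod_mult [simp]:
  "qmod p l u b c \<otimes>\<^bsub>quad_group p\<^esub> qmod p l' u' b' c' =
    qmod p (l + l') (u + u') (b + b' + 2 * l * u') (c + c' + l * b' + l\<^sup>2 * u')"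
proof -
  have "qmod p l u b c \<otimes>\<^bsub>quad_group p\<^esub> qmod p l' u' b' c' =
    qmod p (l mod p + l' mod p) (u mod p + u' mod p)
      (b mod p + b' mod p + 2 * (l mod p) * (u' mod p))
      (c mod p + c' mod p + (l mod p) * (b' mod p) + (l mod p)\<^sup>2 * (u' mod p))"
    by (simp add: quad_group_def qmod_def[of p l u b c] qmod_def[of p l' u' b' c'])
  also have "\<dots> = qmod p (l + l') (u + u') (b + b' + 2 * l * u') (c + c' + l * b' + l\<^sup>2 * u')"
    unfolding qmod_eq_iff by (intro conjI cong_add cong_mult cong_pow) (simp_all add: cong_def)
  finally show ?thesis .
qed

lemma quad_group_exhaust:
  assumes "x \<in> carrier (quad_group p)"
  obtains l u b c where "x = qmod p l u b c"
  using assms by (auto simp: quad_group_def)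

lemma qmod_one: "\<one>\<^bsub>quad_group p\<^esub> = qmod p 0 0 0 0"
  by (simp add: quad_group_def)

lemma group_quad_group: "group (quad_group p)"
proof (rule groupI)
  fix x assume "x \<in> carrier (quad_group p)"
  then obtain l u b c where x: "x = qmod p l u b c" by (auto simp: quad_group_def)
  have "qmod p (- l) (- u) (2 * l * u - b) (l * b - l\<^sup>2 * u - c) \<otimes>\<^bsub>quad_group p\<^esub> x = \<one>\<^bsub>quad_group p\<^esub>"
    by (simp add: x qmod_one)
  then show "\<exists>y\<in>carrier (quad_group p). y \<otimes>\<^bsub>quad_group p\<^esub> x = \<one>\<^bsub>quad_group p\<^esub>"
    using qmod_closed by blast
next
  fix x y z assume "x \<in> carrier (quad_group p)" "y \<in> carrier (quad_group p)" "z \<in> carrier (quad_group p)"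
  then show "x \<otimes>\<^bsub>quad_group p\<^esub> y \<otimes>\<^bsub>quad_group p\<^esub> z = x \<otimes>\<^bsub>quad_group p\<^esub> (y \<otimes>\<^bsub>quad_group p\<^esub> z)"
    by (elim quad_group_exhaust) (simp add: algebra_simps power2_eq_square)
qed (auto elim!: quad_group_exhaust simp: qmod_one)

lemma qmod_center: "qmod p 0 0 0 c \<in> group_center (quad_group p)"
  unfolding group_center_def
  by (auto elim!: quad_group_exhaust simp: add.commute)

lemma commutator_qmod:
  "commutator (quad_group p) (qmod p l u b c) (qmod p l' u' b' c') =
    qmod p 0 0 (2 * (l * u' - l' * u))
      (l * b' - l' * b + l\<^sup>2 * u' - l'\<^sup>2 * u - 2 * (l + l') * (l * u' - l' * u))"
  by (rule group.commutator_eqI[OF group_quad_group])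
    (simp_all add: algebra_simps power2_eq_square)

lemma qmod_pow:
  assumes "l = 0 \<or> u = 0 \<and> b = 0"
  shows "qmod p l u b c [^]\<^bsub>quad_group p\<^esub> (n::nat) = qmod p (n * l) (n * u) (n * b) (n * c)"
  using assms by (induction n) (auto simp: qmod_one algebra_simps)

text \<open>The hypothesis says that each \<open>[x\<^sub>i, y\<^sub>j]\<close> is a constant polynomial; the triple commutators
  are constant in any case, as second differences of quadratic polynomials.\<close>

lemma named_qmod:
  fixes p :: nat and l u b :: "gen \<Rightarrow> int"
  defines "E \<equiv> quad_group p" and "v \<equiv> \<lambda>g. qmod p (l g) (u g) (b g) 0"
  assumes lu: "\<And>x y. x \<in> {GX1, GX2} \<Longrightarrow> y \<in> {GY1, GY2} \<Longrightarrow> l x * u y = l y * u x"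
  shows "named_in E v T1 = qmod p 0 0 0 (- 2 * l GX1 * (l GX1 * u GX2 - l GX2 * u GX1))"
    and "named_in E v T2 = qmod p 0 0 0 (- 2 * l GX2 * (l GX1 * u GX2 - l GX2 * u GX1))"
    and "named_in E v T3 = qmod p 0 0 0 (- 2 * l GY1 * (l GY1 * u GY2 - l GY2 * u GY1))"
    and "named_in E v T4 = qmod p 0 0 0 (- 2 * l GY2 * (l GY1 * u GY2 - l GY2 * u GY1))"
    and "\<And>x y. x \<in> {GX1, GX2} \<Longrightarrow> y \<in> {GY1, GY2} \<Longrightarrow> commutator E (v x) (v y) =
      qmod p 0 0 0 (l x * b y - l y * b x + (l x)\<^sup>2 * u y - (l y)\<^sup>2 * u x)"
proof -
  show "commutator E (v x) (v y) =
      qmod p 0 0 0 (l x * b y - l y * b x + (l x)\<^sup>2 * u y - (l y)\<^sup>2 * u x)"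
    if "x \<in> {GX1, GX2}" "y \<in> {GY1, GY2}" for x y
  proof -
    have e: "l x * u y - l y * u x = 0" using lu[OF that] by simp
    show ?thesis unfolding E_def v_def commutator_qmod e by simp
  qed
qed (simp_all add: E_def v_def commutator_qmod algebra_simps)

lemma star_tuple_qmod:
  assumes "\<And>g. l g = 0 \<or> u g = 0 \<and> b g = 0"
    and "\<And>x y. x \<in> {GX1, GX2} \<Longrightarrow> y \<in> {GY1, GY2} \<Longrightarrow> l x * u y = l y * u x"
  shows "star_tuple p (quad_group p) (\<lambda>g. qmod p (l g) (u g) (b g) 0)"
  unfolding star_tuple_def
proof (intro conjI allI ballI)
  fix g show "qmod p (l g) (u g) (b g) 0 [^]\<^bsub>quad_group p\<^esub> p = \<one>\<^bsub>quad_group p\<^esub>"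
    using assms(1)[of g] by (simp add: qmod_pow qmod_one qmod_eq_iff cong_def)
next
  fix a assume "a \<in> tnames"
  then show "named_in (quad_group p) (\<lambda>g. qmod p (l g) (u g) (b g) 0) a \<in> group_center (quad_group p)"
    using named_qmod[where l = l and u = u and b = b, OF assms(2)] by (auto simp: qmod_center simp del: named_in_simps(7-10))
qed simp

section \<open>The projection of \<open>G_star\<close> onto the Heisenberg group\<close>

abbreviation zp2 :: "nat \<Rightarrow> (int \<times> int) ring" where
  "zp2 p \<equiv> RDirProd (residue_ring (int p)) (residue_ring (int p))"

text \<open>Elements of the Heisenberg group over \<open>\<int>/p \<times> \<int>/p\<close> in integer coordinates: \<open>a, b, c\<close> belong to
  the first factor of the ring and \<open>a', b', c'\<close> to the second. Every integer tuple is admissible, so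
  computations need no carrier conditions.\<close>

definition hz :: "nat \<Rightarrow> int \<Rightarrow> int \<Rightarrow> int \<Rightarrow> int \<Rightarrow> int \<Rightarrow> int \<Rightarrow> nat \<times> nat \<Rightarrow> int \<times> int" where
  "hz p a b c a' b' c' = heis (zp2 p) (a mod int p, a' mod int p) (b mod int p, b' mod int p)
     (c mod int p, c' mod int p)"

locale heisenberg_mod =
  fixes p :: nat
  assumes p_gt_1: "1 < p" and odd_p: "odd p"
begin

sublocale res: residues "int p" "residue_ring (int p)"
  by unfold_locales (use p_gt_1 in simp_all)

sublocale R: ring "zp2 p"
  by (rule RDirProd_ring) (rule res.ring_axioms)+

sublocale H: group "heisenberg3 (zp2 p)"
  by (rule R.group_heisenberg3)

lemma zp2_simps:
  "carrier (zp2 p) = {0..<int p} \<times> {0..<int p}"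
  "(a, a') \<oplus>\<^bsub>zp2 p\<^esub> (b, b') = ((a + b) mod int p, (a' + b') mod int p)"
  "(a, a') \<otimes>\<^bsub>zp2 p\<^esub> (b, b') = (a * b mod int p, a' * b' mod int p)"
  "\<zero>\<^bsub>zp2 p\<^esub> = (0, 0)"
  by (auto simp: RDirProd_def DirProd_def monoid.defs residue_ring_def)

lemma mod_closed: "(a mod int p, b mod int p) \<in> carrier (zp2 p)"
  using p_gt_1 by (simp add: zp2_simps)

lemma hz_closed [simp]: "hz p a b c a' b' c' \<in> carrier (heisenberg3 (zp2 p))"
  unfolding hz_def by (intro R.heis_closed mod_closed)

lemma hz_exhaust:
  assumes "x \<in> carrier (heisenberg3 (zp2 p))"
  obtains a b c a' b' c' where "x = hz p a b c a' b' c'"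
proof -
  obtain a b c where "a \<in> carrier (zp2 p)" "b \<in> carrier (zp2 p)" "c \<in> carrier (zp2 p)"
    "x = heis (zp2 p) a b c"
    using assms by (rule R.heis_exhaust)
  then have "x = hz p (fst a) (fst b) (fst c) (snd a) (snd b) (snd c)"
    by (auto simp: hz_def zp2_simps)
  then show ?thesis by (rule that)
qed

lemma hz_eq_iff: "hz p a b c a' b' c' = hz p x y z x' y' z' \<longleftrightarrow>
    [a = x] (mod int p) \<and> [b = y] (mod int p) \<and> [c = z] (mod int p) \<and>
    [a' = x'] (mod int p) \<and> [b' = y'] (mod int p) \<and> [c' = z'] (mod int p)"
  unfolding hz_def R.heis_eq_iff cong_def by auto

lemma hz_mult [simp]:
  "hz p a b c a' b' c' \<otimes>\<^bsub>heisenberg3 (zp2 p)\<^esub> hz p x y z x' y' z' =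
    hz p (a + x) (b + y) (c + z + a * y) (a' + x') (b' + y') (c' + z' + a' * y')"
  unfolding hz_def R.heis_mult[OF mod_closed mod_closed mod_closed mod_closed mod_closed mod_closed]
  by (simp add: zp2_simps mod_simps)

lemma hz_one: "\<one>\<^bsub>heisenberg3 (zp2 p)\<^esub> = hz p 0 0 0 0 0 0"
  by (simp add: R.heis_one hz_def zp2_simps)

lemma commutator_hz:
  "commutator (heisenberg3 (zp2 p)) (hz p a b c a' b' c') (hz p x y z x' y' z') =
    hz p 0 0 (a * y - x * b) 0 0 (a' * y' - x' * b')"
  by (rule H.commutator_eqI) (simp_all add: algebra_simps)

lemma hz_center: "hz p 0 0 c 0 0 c' \<in> group_center (heisenberg3 (zp2 p))"
  unfolding group_center_def by (auto elim!: hz_exhaust simp: add.commute)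

lemma hz_pow:
  assumes "a = 0 \<or> b = 0" "a' = 0 \<or> b' = 0"
  shows "hz p a b c a' b' c' [^]\<^bsub>heisenberg3 (zp2 p)\<^esub> (n::nat) =
    hz p (n * a) (n * b) (n * c) (n * a') (n * b') (n * c')"
  using assms by (induction n) (auto simp: hz_one algebra_simps)

primrec heis_gen :: "gen \<Rightarrow> nat \<times> nat \<Rightarrow> int \<times> int" where
  "heis_gen GX1 = hz p 1 0 0 0 0 0"
| "heis_gen GX2 = hz p 0 1 0 0 0 0"
| "heis_gen GY1 = hz p 0 0 0 1 0 0"
| "heis_gen GY2 = hz p 0 0 0 0 1 0"

lemma named_heis_gen:
  "a \<in> tnames \<Longrightarrow> named_in (heisenberg3 (zp2 p)) heis_gen a = \<one>\<^bsub>heisenberg3 (zp2 p)\<^esub>"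
  by (auto simp: commutator_hz hz_one)

lemma star_tuple_heis_gen: "star_tuple p (heisenberg3 (zp2 p)) heis_gen"
  unfolding star_tuple_def
proof (intro conjI allI ballI)
  fix g
  show "heis_gen g \<in> carrier (heisenberg3 (zp2 p))" by (cases g) simp_all
  show "heis_gen g [^]\<^bsub>heisenberg3 (zp2 p)\<^esub> p = \<one>\<^bsub>heisenberg3 (zp2 p)\<^esub>"
    by (cases g) (simp_all add: hz_pow hz_one hz_eq_iff cong_def)
next
  fix a assume "a \<in> tnames"
  then show "named_in (heisenberg3 (zp2 p)) heis_gen a \<in> group_center (heisenberg3 (zp2 p))"
    using subgroup.one_closed[OF H.subgroup_group_center] named_heis_gen by metis
qed

end

section \<open>Normal forms modulo the central commutators\<close>

text \<open>Collected words in two elements and their commutator.\<close>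

definition xyz :: "('e, 'd) monoid_scheme \<Rightarrow> 'e \<Rightarrow> 'e \<Rightarrow> nat \<Rightarrow> nat \<Rightarrow> nat \<Rightarrow> 'e" where
  "xyz G x y a b c = x [^]\<^bsub>G\<^esub> a \<otimes>\<^bsub>G\<^esub> y [^]\<^bsub>G\<^esub> b \<otimes>\<^bsub>G\<^esub> commutator G x y [^]\<^bsub>G\<^esub> c"

context group
begin

lemma xyz_closed [simp]:
  "x \<in> carrier G \<Longrightarrow> y \<in> carrier G \<Longrightarrow> xyz G x y a b c \<in> carrier G"
  by (simp add: xyz_def)

lemma inv_pow_eq:
  assumes "x \<in> carrier G" "x [^] (p::nat) = \<one>" "0 < p"
  shows "inv x = x [^] (p - 1)"
  using assms nat_pow_Suc[of x "p - 1"] by (intro inv_equality) auto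

lemma xyz_step:
  fixes p :: nat
  assumes c: "x \<in> carrier G" "y \<in> carrier G" and z: "commutator G x y \<in> group_center G"
    and zp: "commutator G x y [^] p = \<one>" "0 < p"
  shows "\<exists>a' b' c'. xyz G x y a b c \<otimes> x = xyz G x y a' b' c'"
    and "\<exists>a' b' c'. xyz G x y a b c \<otimes> y = xyz G x y a' b' c'"
proof -
  let ?z = "commutator G x y"
  note zc = pow_mem_group_center[OF z]
  note zcc = group_center_closed[OF zc]
  have "inv ?z = commutator G y x"
    using c by (simp add: commutator_def inv_mult_group m_assoc)
  then have yx: "y \<otimes> x = x \<otimes> y \<otimes> ?z [^] (p - 1)"
    using mult_commutator[OF c(2,1)] inv_pow_eq[OF _ zp] c by simp
  have "xyz G x y a b c \<otimes> y = x [^] a \<otimes> y [^] b \<otimes> (?z [^] c \<otimes> y)"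
    using c by (simp add: xyz_def m_assoc)
  also have "\<dots> = xyz G x y a (Suc b) c"
    unfolding group_center_comm[OF zc c(2)] using c by (simp add: xyz_def m_assoc)
  finally show "\<exists>a' b' c'. xyz G x y a b c \<otimes> y = xyz G x y a' b' c'" by blast
  have "xyz G x y a b c \<otimes> x = x [^] a \<otimes> (y [^] b \<otimes> x) \<otimes> ?z [^] c"
    using c group_center_comm[OF zc c(1), of c] by (simp add: xyz_def m_assoc)
  also have "y [^] b \<otimes> x = x \<otimes> y [^] b \<otimes> ?z [^] ((p - 1) * b)"
    using pow_commutator(1)[OF c zc yx, of b] c by (simp add: nat_pow_pow)
  also have "x [^] a \<otimes> (x \<otimes> y [^] b \<otimes> ?z [^] ((p - 1) * b)) \<otimes> ?z [^] c =
      xyz G x y (Suc a) b ((p - 1) * b + c)"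
    using c by (simp add: xyz_def m_assoc nat_pow_mult)
  finally show "\<exists>a' b' c'. xyz G x y a b c \<otimes> x = xyz G x y a' b' c'" by blast
qed

lemma pow_commutes:
  assumes "x \<in> carrier G" "y \<in> carrier G" "x \<otimes> y = y \<otimes> x"
  shows "x [^] (n::nat) \<otimes> y = y \<otimes> x [^] n"
  using group_commutes_pow assms by blast

lemma xyz_commutes:
  assumes "x \<in> carrier G" "y \<in> carrier G" "g \<in> carrier G" "x \<otimes> g = g \<otimes> x" "y \<otimes> g = g \<otimes> y"
    "commutator G x y \<otimes> g = g \<otimes> commutator G x y"
  shows "xyz G x y a b c \<otimes> g = g \<otimes> xyz G x y a b c"
proof -
  have "subgroup {x \<in> carrier G. \<forall>s\<in>{g}. x \<otimes> s = s \<otimes> x} G" (is "subgroup ?C G")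
    using assms by (intro subgroup_commuting) simp
  moreover have "x [^] a \<in> ?C" "y [^] b \<in> ?C" "commutator G x y [^] c \<in> ?C"
    using assms pow_commutes by auto
  ultimately have "xyz G x y a b c \<in> ?C"
    unfolding xyz_def by (intro subgroup.m_closed)
  then show ?thesis by simp
qed

text \<open>The set of normal forms is stable under right multiplication by the four generators, hence also by
  their inverses, which are positive powers. It is therefore stable under right multiplication by the
  whole group, and it contains \<open>\<one>\<close>.\<close>

lemma star_normal_form:
  assumes v: "star_tuple p G v" and t: "\<And>a. a \<in> tnames \<Longrightarrow> named_in G v a = \<one>"
    and p: "odd p"
    and gen: "\<And>S. subgroup S G \<Longrightarrow> range v \<subseteq> S \<Longrightarrow> carrier G \<subseteq> S"
    and g: "g \<in> carrier G"
  shows "\<exists>a b c a' b' c'. g = xyz G (v GX1) (v GX2) a b c \<otimes> xyz G (v GY1) (v GY2) a' b' c'"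
proof -
  have vc [simp]: "v g \<in> carrier G" for g using v by (simp add: star_tuple_def)
  have p0: "0 < p" using p by (cases p) auto
  have tt: "commutator G (commutator G (v GX1) (v GX2)) (v GX1) = \<one>"
    "commutator G (commutator G (v GX1) (v GX2)) (v GX2) = \<one>"
    "commutator G (commutator G (v GY1) (v GY2)) (v GY1) = \<one>"
    "commutator G (commutator G (v GY1) (v GY2)) (v GY2) = \<one>"
    "commutator G (v GX1) (v GY1) = \<one>" "commutator G (v GX1) (v GY2) = \<one>"
    "commutator G (v GX2) (v GY1) = \<one>" "commutator G (v GX2) (v GY2) = \<one>"
    using t[of T1] t[of T2] t[of T3] t[of T4] t[of T5] t[of T6] t[of T7] t[of T8] by simp_all
  note comm = tt[THEN iffD1[OF commutator_eq_one_iff, rotated 2], simplified]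
  note zcomm = star_tuple_z_commute[OF v]
  have central: "z \<in> group_center G" if "z \<in> carrier G" "\<And>g. v g \<otimes> z = z \<otimes> v g" for z
  proof -
    have "carrier G \<subseteq> {x \<in> carrier G. \<forall>s\<in>{z}. x \<otimes> s = s \<otimes> x}"
      by (rule gen, rule subgroup_commuting) (use that in auto)
    then show ?thesis using that unfolding group_center_def by auto
  qed
  have z1: "commutator G (v GX1) (v GX2) \<in> group_center G"
  proof (rule central)
    fix g show "v g \<otimes> commutator G (v GX1) (v GX2) = commutator G (v GX1) (v GX2) \<otimes> v g"
      by (cases g) (simp_all only: comm zcomm)
  qed simp
  have z2: "commutator G (v GY1) (v GY2) \<in> group_center G"
  proof (rule central)
    fix g show "v g \<otimes> commutator G (v GY1) (v GY2) = commutator G (v GY1) (v GY2) \<otimes> v g"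
      by (cases g) (simp_all only: comm zcomm)
  qed simp
  have zp: "commutator G (v GX1) (v GX2) [^] p = \<one>" "commutator G (v GY1) (v GY2) [^] p = \<one>"
    using star_tuple_pow[OF v p, of Z1] star_tuple_pow[OF v p, of Z2] by simp_all
  define N where "N = {xyz G (v GX1) (v GX2) a b c \<otimes> xyz G (v GY1) (v GY2) a' b' c' | a b c a' b' c'. True}"
  have Nc: "N \<subseteq> carrier G" by (auto simp: N_def)
  have step: "s \<otimes> v g \<in> N" if sN: "s \<in> N" for s g
  proof -
    obtain a b c a' b' c' where s: "s = xyz G (v GX1) (v GX2) a b c \<otimes> xyz G (v GY1) (v GY2) a' b' c'"
      using sN unfolding N_def by blast
    have "s \<otimes> v g = xyz G (v GX1) (v GX2) a b c \<otimes> (xyz G (v GY1) (v GY2) a' b' c' \<otimes> v g)"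
      by (simp add: s m_assoc)
    moreover have "xyz G (v GY1) (v GY2) a' b' c' \<otimes> v g = v g \<otimes> xyz G (v GY1) (v GY2) a' b' c'"
      if "g \<in> {GX1, GX2}"
      using that by (intro xyz_commutes) (auto simp: zcomm comm)
    ultimately have mv: "s \<otimes> v g = xyz G (v GX1) (v GX2) a b c \<otimes> v g \<otimes> xyz G (v GY1) (v GY2) a' b' c'"
      if "g \<in> {GX1, GX2}"
      using that by (simp add: m_assoc)
    show ?thesis
    proof (cases g)
      case GX1
      then show ?thesis
        using mv xyz_step(1)[OF vc vc z1 zp(1) p0, of a b c] unfolding N_def by auto metis
    next
      case GX2
      then show ?thesis
        using mv xyz_step(2)[OF vc vc z1 zp(1) p0, of a b c] unfolding N_def by auto metis
    next
      case GY1
      then show ?thesis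
        using xyz_step(1)[OF vc vc z2 zp(2) p0, of a' b' c'] unfolding N_def s by (simp add: m_assoc) metis
    next
      case GY2
      then show ?thesis
        using xyz_step(2)[OF vc vc z2 zp(2) p0, of a' b' c'] unfolding N_def s by (simp add: m_assoc) metis
    qed
  qed
  have powstep: "s \<otimes> v g [^] n \<in> N" if "s \<in> N" for s g and n :: nat
  proof (induction n)
    case 0
    then show ?case using that Nc by auto
  next
    case (Suc n)
    then show ?case using step[OF Suc, of g] that Nc by (auto simp: m_assoc)
  qed
  \<comment> \<open>Stability under \<open>h\<close> alone would only define a submonoid.\<close>
  let ?R = "{h \<in> carrier G. \<forall>s\<in>N. s \<otimes> h \<in> N \<and> s \<otimes> inv h \<in> N}"
  have "carrier G \<subseteq> ?R"
  proof (rule gen)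
    show "subgroup ?R G"
    proof (rule subgroupI)
      have "\<one> \<in> ?R" using Nc by auto
      then show "?R \<noteq> {}" by blast
    next
      fix h k assume hk: "h \<in> ?R" "k \<in> ?R"
      have "s \<otimes> (h \<otimes> k) \<in> N \<and> s \<otimes> inv (h \<otimes> k) \<in> N" if "s \<in> N" for s
      proof -
        have sc: "s \<in> carrier G" using that Nc by blast
        have "s \<otimes> h \<otimes> k \<in> N" "s \<otimes> inv k \<otimes> inv h \<in> N" using hk that by auto
        then show ?thesis using hk sc by (simp add: m_assoc inv_mult_group)
      qed
      then show "h \<otimes> k \<in> ?R" using hk by simp
    qed auto
    have "inv (v g) = v g [^] (p - 1)" for g
      by (rule inv_pow_eq) (use v p0 in \<open>auto simp: star_tuple_def\<close>)
    then show "range v \<subseteq> ?R" using step powstep by auto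
  qed
  moreover have "\<one> \<in> N"
    unfolding N_def xyz_def by (auto intro!: exI[of _ 0])
  ultimately have "\<one> \<otimes> g \<in> N" using g by blast
  then show ?thesis using g unfolding N_def by auto
qed

end

lemma (in group_hom) hom_xyz:
  assumes "x \<in> carrier G" "y \<in> carrier G"
  shows "h (xyz G x y a b c) = xyz H (h x) (h y) a b c"
  using assms by (simp add: xyz_def hom_nat_pow hom_commutator)

section \<open>The kernel of the projection\<close>

lemma (in group) commutator_mem_derived:
  assumes "x \<in> carrier G" "y \<in> carrier G"
  shows "commutator G x y \<in> derived G (carrier G)"
proof -
  have "commutator G x y = inv x \<otimes> inv y \<otimes> inv (inv x) \<otimes> inv (inv y)"
    using assms by (simp add: commutator_def)
  then have "commutator G x y \<in> derived_set G (carrier G)"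
    using assms inv_closed by blast
  then show ?thesis unfolding derived_def by (rule generate.incl)
qed

definition star_kernel :: "nat \<Rightarrow> (gen \<times> bool) list set set set" where
  "star_kernel p = generate (G_star p) (star_elt p ` tnames)"

definition star_kernel_group :: "nat \<Rightarrow> (gen \<times> bool) list set set monoid" where
  "star_kernel_group p = G_star p\<lparr>carrier := star_kernel p\<rparr>"

context heisenberg_mod
begin

sublocale S: group "G_star p" by (rule group_G_star)

definition star_pi :: "(gen \<times> bool) list set set \<Rightarrow> nat \<times> nat \<Rightarrow> int \<times> int" where
  "star_pi = (SOME k. group_hom (G_star p) (heisenberg3 (zp2 p)) k \<and> (\<forall>g. k (star_gen p g) = heis_gen g))"

lemma star_pi: "group_hom (G_star p) (heisenberg3 (zp2 p)) star_pi" "star_pi (star_gen p g) = heis_gen g"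
proof -
  have "\<exists>k. group_hom (G_star p) (heisenberg3 (zp2 p)) k \<and> (\<forall>g. k (star_gen p g) = heis_gen g)"
    using G_star_universal[OF H.is_group odd_p star_tuple_heis_gen] by metis
  then have "group_hom (G_star p) (heisenberg3 (zp2 p)) star_pi \<and> (\<forall>g. star_pi (star_gen p g) = heis_gen g)"
    unfolding star_pi_def by (rule someI_ex)
  then show "group_hom (G_star p) (heisenberg3 (zp2 p)) star_pi" "star_pi (star_gen p g) = heis_gen g"
    by simp_all
qed

sublocale pi: group_hom "G_star p" "heisenberg3 (zp2 p)" star_pi by (rule star_pi)

lemma star_elt_closed [simp]: "star_elt p a \<in> carrier (G_star p)"
  by (rule S.named_in_closed) simp

lemma star_gen_pow: "star_gen p g [^]\<^bsub>G_star p\<^esub> p = \<one>\<^bsub>G_star p\<^esub>"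
  using star_tuple_star_gen[of p] unfolding star_tuple_def by blast

lemma star_elt_center: "a \<in> tnames \<Longrightarrow> star_elt p a \<in> group_center (G_star p)"
  using star_tuple_star_gen[of p] unfolding star_tuple_def by blast

lemma star_elts_subset: "star_elt p ` tnames \<subseteq> carrier (G_star p)"
  using star_elt_closed by blast

lemma subgroup_star_kernel: "subgroup (star_kernel p) (G_star p)"
  unfolding star_kernel_def by (rule S.generate_is_subgroup[OF star_elts_subset])

lemma star_elt_kernel: "a \<in> tnames \<Longrightarrow> star_elt p a \<in> star_kernel p"
  unfolding star_kernel_def by (blast intro: generate.incl)

lemma star_kernel_least:
  "subgroup K (G_star p) \<Longrightarrow> (\<And>a. a \<in> tnames \<Longrightarrow> star_elt p a \<in> K) \<Longrightarrow> star_kernel p \<subseteq> K"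
  unfolding star_kernel_def by (rule S.generate_subgroup_incl[OF image_subsetI])

lemma star_kernel_center: "star_kernel p \<subseteq> group_center (G_star p)"
  by (rule star_kernel_least[OF S.subgroup_group_center star_elt_center])

lemma star_kernel_derived: "star_kernel p \<subseteq> derived (G_star p) (carrier (G_star p))"
proof (rule star_kernel_least)
  show "subgroup (derived (G_star p) (carrier (G_star p))) (G_star p)"
    by (rule S.derived_is_subgroup) simp
  show "star_elt p a \<in> derived (G_star p) (carrier (G_star p))" if "a \<in> tnames" for a
    using that by (auto intro!: S.commutator_mem_derived S.commutator_closed)
qed

lemma normal_star_kernel: "star_kernel p \<lhd> G_star p"
  unfolding S.normal_inv_iff
proof (intro conjI ballI subgroup_star_kernel)
  fix x h assume x: "x \<in> carrier (G_star p)" and h: "h \<in> star_kernel p"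
  have hc: "h \<in> group_center (G_star p)" using h star_kernel_center by blast
  have "x \<otimes>\<^bsub>G_star p\<^esub> h \<otimes>\<^bsub>G_star p\<^esub> inv\<^bsub>G_star p\<^esub> x = h"
    using x S.group_center_comm[OF hc x, symmetric] S.group_center_closed[OF hc] by (simp add: S.m_assoc)
  then show "x \<otimes>\<^bsub>G_star p\<^esub> h \<otimes>\<^bsub>G_star p\<^esub> inv\<^bsub>G_star p\<^esub> x \<in> star_kernel p" using h by simp
qed

lemma star_pi_kernel_subset: "star_kernel p \<subseteq> kernel (G_star p) (heisenberg3 (zp2 p)) star_pi"
proof (rule star_kernel_least[OF pi.subgroup_kernel])
  fix a assume "a \<in> tnames"
  then show "star_elt p a \<in> kernel (G_star p) (heisenberg3 (zp2 p)) star_pi"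
    using pi.hom_named_in[of "star_gen p" a] named_heis_gen[of a] by (simp add: kernel_def star_pi(2))
qed

abbreviation star_nf :: "nat \<Rightarrow> nat \<Rightarrow> nat \<Rightarrow> nat \<Rightarrow> nat \<Rightarrow> nat \<Rightarrow> (gen \<times> bool) list set set" where
  "star_nf a b c a' b' c' \<equiv> xyz (G_star p) (star_gen p GX1) (star_gen p GX2) a b c
     \<otimes>\<^bsub>G_star p\<^esub> xyz (G_star p) (star_gen p GY1) (star_gen p GY2) a' b' c'"

lemma star_pi_nf: "star_pi (star_nf a b c a' b' c') =
    hz p (int a) (int b) (int c + int a * int b) (int a') (int b') (int c' + int a' * int b')"
  by (simp add: pi.hom_xyz star_pi(2)) (simp add: xyz_def commutator_hz hz_pow add.commute)

lemma pow_dvd_eq_one: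
  assumes "p dvd n" and "x \<in> carrier (G_star p)" "x [^]\<^bsub>G_star p\<^esub> p = \<one>\<^bsub>G_star p\<^esub>"
  shows "x [^]\<^bsub>G_star p\<^esub> n = \<one>\<^bsub>G_star p\<^esub>"
proof -
  obtain k where "n = p * k" using assms(1) by blast
  then show ?thesis using S.nat_pow_pow[OF assms(2), of p k] assms(3) by simp
qed

text \<open>Let \<open>x\<close> be in the kernel. Modulo \<open>star_kernel p\<close> it equals a normal form, on which the projection
  reads off the exponents modulo \<open>p\<close>. They all vanish, so the normal form is trivial.\<close>

lemma kernel_star_pi: "kernel (G_star p) (heisenberg3 (zp2 p)) star_pi = star_kernel p"
proof
  let ?Q = "G_star p Mod star_kernel p"
  let ?q = "\<lambda>x. star_kernel p #>\<^bsub>G_star p\<^esub> x"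
  interpret Q: group ?Q by (rule normal.factorgroup_is_group[OF normal_star_kernel])
  interpret q: group_hom "G_star p" ?Q ?q
    using normal.r_coset_hom_Mod[OF normal_star_kernel] by unfold_locales simp
  show "kernel (G_star p) (heisenberg3 (zp2 p)) star_pi \<subseteq> star_kernel p"
  proof
    fix x assume "x \<in> kernel (G_star p) (heisenberg3 (zp2 p)) star_pi"
    then have x: "x \<in> carrier (G_star p)" "star_pi x = hz p 0 0 0 0 0 0"
      by (simp_all add: kernel_def hz_one)
    have qt: "named_in ?Q (\<lambda>g. ?q (star_gen p g)) a = \<one>\<^bsub>?Q\<^esub>" if "a \<in> tnames" for a
    proof -
      have "?q (star_elt p a) = star_kernel p"
        using subgroup.rcos_const[OF subgroup_star_kernel S.is_group star_elt_kernel[OF that]] .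
      then show ?thesis by (simp add: q.hom_named_in[symmetric] del: named_in_simps)
    qed
    have st: "star_tuple p ?Q (\<lambda>g. ?q (star_gen p g))"
      unfolding star_tuple_def
    proof (intro conjI allI ballI)
      fix g show "?q (star_gen p g) \<in> carrier ?Q" by (rule q.hom_closed) simp
      show "?q (star_gen p g) [^]\<^bsub>?Q\<^esub> p = \<one>\<^bsub>?Q\<^esub>"
        using q.hom_nat_pow[of "star_gen p g" p] q.hom_one star_gen_pow[of g] by simp
    next
      fix a assume "a \<in> tnames"
      then show "named_in ?Q (\<lambda>g. ?q (star_gen p g)) a \<in> group_center ?Q"
        using qt[of a] subgroup.one_closed[OF Q.subgroup_group_center] by (simp del: named_in_simps)
    qed
    have gen: "carrier ?Q \<subseteq> K" if K: "subgroup K ?Q" "range (\<lambda>g. ?q (star_gen p g)) \<subseteq> K" for K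
    proof -
      have "subgroup {x \<in> carrier (G_star p). ?q x \<in> K} (G_star p)"
      proof (rule S.subgroupI)
        show "{x \<in> carrier (G_star p). ?q x \<in> K} \<noteq> {}"
          using subgroup.one_closed[OF K(1)] q.hom_one by (metis (mono_tags, lifting) S.one_closed empty_iff mem_Collect_eq)
      qed (use K(1) in \<open>auto simp: q.hom_inv q.hom_mult simp del: mult_FactGroup
            intro: subgroup.m_closed subgroup.m_inv_closed\<close>)
      from G_star_subgroup_eq[OF this] K(2) have "carrier (G_star p) = {x \<in> carrier (G_star p). ?q x \<in> K}"
        by auto
      then show ?thesis by (auto simp: carrier_FactGroup)
    qed
    obtain a b c a' b' c' where "?q x = xyz ?Q (?q (star_gen p GX1)) (?q (star_gen p GX2)) a b c
       \<otimes>\<^bsub>?Q\<^esub> xyz ?Q (?q (star_gen p GY1)) (?q (star_gen p GY2)) a' b' c'"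
      using Q.star_normal_form[OF st qt odd_p gen q.hom_closed[OF x(1)]] by blast
    then have "?q x = ?q (star_nf a b c a' b' c')"
      using q.hom_xyz by (simp add: q.hom_mult del: mult_FactGroup)
    then have "x \<in> ?q (star_nf a b c a' b' c')"
      using S.rcos_self[OF x(1) subgroup_star_kernel] by simp
    then obtain t where t: "t \<in> star_kernel p" "x = t \<otimes>\<^bsub>G_star p\<^esub> star_nf a b c a' b' c'"
      by (auto simp: r_coset_def)
    have tc: "t \<in> carrier (G_star p)" using t(1) subgroup_star_kernel by (meson subgroup.mem_carrier)
    have "star_pi t = \<one>\<^bsub>heisenberg3 (zp2 p)\<^esub>"
      using t(1) star_pi_kernel_subset by (auto simp: kernel_def)
    then have "star_pi x = star_pi (star_nf a b c a' b' c')"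
      unfolding t(2) using tc by (simp del: star_pi_nf)
    then have eq: "[int a = 0] (mod int p)" "[int b = 0] (mod int p)"
      "[int c + int a * int b = 0] (mod int p)" "[int a' = 0] (mod int p)" "[int b' = 0] (mod int p)"
      "[int c' + int a' * int b' = 0] (mod int p)"
      unfolding x(2) star_pi_nf hz_eq_iff by (simp_all add: cong_sym_eq)
    then have ab: "p dvd a" "p dvd b" "p dvd a'" "p dvd b'"
      by (simp_all add: cong_0_iff)
    then have "int p dvd int a * int b" "int p dvd int a' * int b'"
      by simp_all
    then have c: "p dvd c" "p dvd c'"
      using eq(3,6) by (simp_all add: cong_0_iff dvd_add_left_iff)
    note gen_one = pow_dvd_eq_one[OF _ star_gen_closed star_gen_pow]
    note comm_one = pow_dvd_eq_one[OF _ S.commutator_closed[OF star_gen_closed star_gen_closed]]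
    have z: "commutator (G_star p) (star_gen p GX1) (star_gen p GX2) [^]\<^bsub>G_star p\<^esub> p = \<one>\<^bsub>G_star p\<^esub>"
      "commutator (G_star p) (star_gen p GY1) (star_gen p GY2) [^]\<^bsub>G_star p\<^esub> p = \<one>\<^bsub>G_star p\<^esub>"
      using S.star_tuple_pow[OF star_tuple_star_gen odd_p, of Z1]
        S.star_tuple_pow[OF star_tuple_star_gen odd_p, of Z2] by simp_all
    have "star_nf a b c a' b' c' = \<one>\<^bsub>G_star p\<^esub>"
      unfolding xyz_def gen_one[OF ab(1)] gen_one[OF ab(2)] gen_one[OF ab(3)] gen_one[OF ab(4)]
        comm_one[OF c(1) z(1)] comm_one[OF c(2) z(2)] by simp
    then show "x \<in> star_kernel p" using t tc by simp
  qed
qed (rule star_pi_kernel_subset)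

lemma star_pi_surj: "star_pi ` carrier (G_star p) = carrier (heisenberg3 (zp2 p))"
proof
  show "carrier (heisenberg3 (zp2 p)) \<subseteq> star_pi ` carrier (G_star p)"
  proof
    fix x assume "x \<in> carrier (heisenberg3 (zp2 p))"
    then obtain a b c a' b' c' where x: "x = hz p a b c a' b' c'" by (rule hz_exhaust)
    let ?n = "\<lambda>k. nat (k mod int p)"
    have n: "int (?n k) = k mod int p" for k using p_gt_1 by simp
    have m: "[k mod int p = k] (mod int p)" for k by (simp add: cong_def)
    have m2: "[(i - j * k) mod int p + j mod int p * (k mod int p) = i] (mod int p)" for i j k
    proof -
      have "[(i - j * k) mod int p + j mod int p * (k mod int p) = (i - j * k) + j * k] (mod int p)"
        by (intro cong_add cong_mult) (simp_all add: cong_def)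
      then show ?thesis by simp
    qed
    have "star_pi (star_nf (?n a) (?n b) (?n (c - a * b)) (?n a') (?n b') (?n (c' - a' * b'))) = x"
      unfolding star_pi_nf x hz_eq_iff n by (intro conjI m m2)
    then show "x \<in> star_pi ` carrier (G_star p)" by (rule image_eqI[OF HOL.sym]) simp
  qed
qed auto

lemma G_star_Mod_kernel: "G_star p Mod star_kernel p \<cong> heisenberg3 (zp2 p)"
  using pi.FactGroup_iso[OF star_pi_surj] by (simp add: kernel_star_pi)

end

section \<open>Elementary abelian groups given by a basis\<close>

text \<open>Products over the abelian subgroup \<open>A\<close> are sent to a group that may be non-abelian, where no
  product over an index set is available; for the trivial value this does not matter.\<close>

lemma (in group_hom) hom_finprod_one:
  assumes A: "comm_group (G\<lparr>carrier := A\<rparr>)" "A \<subseteq> carrier G" and f: "\<And>i. i \<in> I \<Longrightarrow> f i \<in> A"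
    and one: "\<And>i. i \<in> I \<Longrightarrow> h (f i) = \<one>\<^bsub>H\<^esub>"
  shows "h (finprod (G\<lparr>carrier := A\<rparr>) f I) = \<one>\<^bsub>H\<^esub>"
proof -
  interpret A: comm_group "G\<lparr>carrier := A\<rparr>" by fact
  show ?thesis
    using f one
  proof (induction I rule: infinite_finite_induct)
    case (insert i I)
    have "finprod (G\<lparr>carrier := A\<rparr>) f I \<in> A" using A.finprod_closed[of f I] insert.prems by auto
    moreover have "finprod (G\<lparr>carrier := A\<rparr>) f (insert i I) = f i \<otimes>\<^bsub>G\<^esub> finprod (G\<lparr>carrier := A\<rparr>) f I"
      using A.finprod_insert[of I i f] insert by auto
    ultimately show ?case using insert assms(2) by (auto simp: subset_iff)
  qed (use A.finprod_infinite A.finprod_empty in auto)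
qed

lemma (in group) int_pow_mod:
  fixes p :: nat
  assumes "x \<in> carrier G" "x [^] p = \<one>"
  shows "x [^] (k mod int p) = x [^] k"
proof -
  have "x [^] k = x [^] (int p * (k div int p) + k mod int p)" by simp
  also have "\<dots> = (x [^] int p) [^] (k div int p) \<otimes> x [^] (k mod int p)"
    using assms(1) by (simp only: int_pow_mult int_pow_pow)
  finally show ?thesis using assms by (simp add: int_pow_int)
qed

lemma (in comm_group) elementary_abelian_basis:
  fixes p :: nat
  assumes I: "finite I" "t \<in> I \<rightarrow> carrier G" and tp: "\<And>i. i \<in> I \<Longrightarrow> t i [^] p = \<one>" and p: "0 < p"
    and gen: "\<And>K. subgroup K G \<Longrightarrow> t ` I \<subseteq> K \<Longrightarrow> carrier G \<subseteq> K"
    and indep: "\<And>n i. (\<Otimes>i\<in>I. t i [^] (n i :: int)) = \<one> \<Longrightarrow> i \<in> I \<Longrightarrow> int p dvd n i"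
  shows "(\<lambda>n. \<Otimes>i\<in>I. t i [^] n i) \<in> iso (product_group I (\<lambda>_. integer_mod_group p)) G" (is "?f \<in> iso ?E G")
proof -
  have E: "group ?E" by (rule product_group) simp
  have pc: "(\<lambda>i. t i [^] (n i :: int)) \<in> I \<rightarrow> carrier G" for n using I(2) by auto
  interpret f: group_hom ?E G ?f
  proof (unfold group_hom_def group_hom_axioms_def, intro conjI E is_group homI)
    fix m n assume "m \<in> carrier ?E" "n \<in> carrier ?E"
    have "?f (m \<otimes>\<^bsub>?E\<^esub> n) = (\<Otimes>i\<in>I. t i [^] m i \<otimes> t i [^] n i)"
    proof (rule finprod_cong')
      fix i assume i: "i \<in> I"
      then show "t i [^] (m \<otimes>\<^bsub>?E\<^esub> n) i = t i [^] m i \<otimes> t i [^] n i"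
        using I(2) tp by (simp add: Pi_iff int_pow_mod int_pow_mult)
    qed (use I(2) in auto)
    then show "?f (m \<otimes>\<^bsub>?E\<^esub> n) = ?f m \<otimes> ?f n" by (simp add: pc)
  qed (use pc in simp)
  show ?thesis
    unfolding f.iso_iff
  proof (intro conjI ballI impI)
    show "carrier G \<subseteq> ?f ` carrier ?E"
    proof (rule gen[OF f.img_is_subgroup], rule image_subsetI)
      fix i assume i: "i \<in> I"
      \<comment> \<open>The reduction matters only for \<open>p = 1\<close>, where \<open>1\<close> is not a reduced residue.\<close>
      let ?n = "\<lambda>j\<in>I. (if j = i then 1 else 0) mod int p"
      have "?f ?n = (\<Otimes>j\<in>I. if j = i then t j else \<one>)"
        using I(2) tp by (intro finprod_cong') (auto simp: int_pow_mod Pi_iff)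
      also have "\<dots> = t i" by (rule finprod_singleton_swap[OF i I])
      finally have "t i = ?f ?n" by simp
      moreover have "?n \<in> carrier ?E"
        using p by (auto simp: carrier_integer_mod_group)
      ultimately show "t i \<in> ?f ` carrier ?E" by (rule image_eqI)
    qed
  next
    fix n assume n: "n \<in> carrier ?E" "?f n = \<one>"
    have "n i = 0" if i: "i \<in> I" for i
    proof -
      have "n i \<in> carrier (integer_mod_group p)" using PiE_mem[OF n(1)[simplified] i] .
      then have "0 \<le> n i" "n i < int p" using p by (simp_all add: carrier_integer_mod_group)
      then show ?thesis using indep[OF n(2) i] by (metis dvd_imp_mod_0 mod_pos_pos_trivial)
    qed
    then show "n = \<one>\<^bsub>?E\<^esub>"
      using n(1) by (auto simp: PiE_def extensional_def restrict_def)
  qed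
qed


section \<open>Independence of the central commutators\<close>

lemma qmod_int_pow: "qmod p 0 0 0 c [^]\<^bsub>quad_group p\<^esub> (n::int) = qmod p 0 0 0 (n * c)"
proof (cases n rule: int_cases2)
  case (nonneg m)
  then show ?thesis by (simp add: int_pow_int qmod_pow)
next
  case (nonpos m)
  have "inv\<^bsub>quad_group p\<^esub> (qmod p 0 0 0 (int m * c)) = qmod p 0 0 0 (n * c)"
    by (rule group.inv_equality[OF group_quad_group]) (simp_all add: qmod_one nonpos)
  then show ?thesis
    using group.int_pow_neg_int[OF group_quad_group qmod_closed[of p 0 0 0 c], of m]
    by (simp add: nonpos qmod_pow)
qed

text \<open>When the generators are sent to \<open>qmod p (l g) (u g) (b g) 0\<close>, the image of each \<open>t\<^sub>j\<close> is a constant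
  polynomial with the following value, provided that the \<open>x\<^sub>i\<close> and \<open>y\<^sub>j\<close> satisfy the hypothesis
  of \<open>named_qmod\<close>.\<close>

definition quad_value :: "(gen \<Rightarrow> int) \<Rightarrow> (gen \<Rightarrow> int) \<Rightarrow> (gen \<Rightarrow> int) \<Rightarrow> name \<Rightarrow> int" where
  "quad_value l u b a =
     (let c = (\<lambda>x y. l x * b y - l y * b x + (l x)\<^sup>2 * u y - (l y)\<^sup>2 * u x);
          d = (\<lambda>x y. l x * u y - l y * u x)
      in case a of
           T1 \<Rightarrow> - 2 * l GX1 * d GX1 GX2 | T2 \<Rightarrow> - 2 * l GX2 * d GX1 GX2
         | T3 \<Rightarrow> - 2 * l GY1 * d GY1 GY2 | T4 \<Rightarrow> - 2 * l GY2 * d GY1 GY2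
         | T5 \<Rightarrow> c GX1 GY1 | T6 \<Rightarrow> c GX1 GY2 | T7 \<Rightarrow> c GX2 GY1 | T8 \<Rightarrow> c GX2 GY2 | _ \<Rightarrow> 0)"

context heisenberg_mod
begin

lemma hom_to_quad:
  assumes "\<And>g. l g = 0 \<or> u g = 0 \<and> b g = 0"
    and "\<And>x y. x \<in> {GX1, GX2} \<Longrightarrow> y \<in> {GY1, GY2} \<Longrightarrow> l x * u y = l y * u x"
  obtains k where "group_hom (G_star p) (quad_group p) k"
    "\<And>a. a \<in> tnames \<Longrightarrow> k (star_elt p a) = qmod p 0 0 0 (quad_value l u b a)"
proof -
  note nq = named_qmod[where p = p and l = l and u = u and b = b, OF assms(2)]
  have nq': "named_in (quad_group p) (\<lambda>g. qmod p (l g) (u g) (b g) 0) a = qmod p 0 0 0 (quad_value l u b a)"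
    if "a \<in> tnames" for a
    using that nq(1-4) nq(5)[of GX1 GY1] nq(5)[of GX1 GY2] nq(5)[of GX2 GY1] nq(5)[of GX2 GY2]
    unfolding insert_iff empty_iff
    by (elim disjE FalseE; simp only: quad_value_def Let_def name.case named_in_simps simp_thms)
  show ?thesis
  proof (rule G_star_universal[OF group_quad_group odd_p star_tuple_qmod[OF assms]])
    fix k
    assume "group_hom (G_star p) (quad_group p) k"
      "\<And>a. k (star_elt p a) = named_in (quad_group p) (\<lambda>g. qmod p (l g) (u g) (b g) 0) a"
    then show thesis by (intro that[of k]) (simp_all only: nq')
  qed
qed

text \<open>To isolate one of \<open>t\<^sub>1, \<dots>, t\<^sub>4\<close>, such as \<open>t\<^sub>1 = [[x\<^sub>1, x\<^sub>2], x\<^sub>1]\<close>, send the generator that occurs twice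
  to the translation by \<open>1\<close>, its partner to \<open>X\<^sup>2\<close>, and the other two to \<open>\<one>\<close>; up to sign this gives
  the second difference of \<open>X\<^sup>2\<close>, which is \<open>2\<close>, a unit modulo the odd number \<open>p\<close>. To isolate one of \<open>t\<^sub>5, \<dots>, t\<^sub>8\<close>, such as
  \<open>t\<^sub>5 = [x\<^sub>1, y\<^sub>1]\<close>, send the two generators to the translation and to \<open>X\<close>.\<close>

lemma separating_hom:
  assumes i: "i \<in> tnames"
  obtains k c where "group_hom (G_star p) (quad_group p) k" "coprime c (int p)"
    "k (star_elt p i) = qmod p 0 0 0 c"
    "\<And>j. j \<in> tnames - {i} \<Longrightarrow> k (star_elt p j) = \<one>\<^bsub>quad_group p\<^esub>"
proof -
  have two: "coprime (2 :: int) (int p)" using odd_p by simp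
  have key: "\<exists>k c. group_hom (G_star p) (quad_group p) k \<and> coprime c (int p) \<and>
      k (star_elt p i) = qmod p 0 0 0 c \<and> (\<forall>j\<in>tnames - {i}. k (star_elt p j) = \<one>\<^bsub>quad_group p\<^esub>)"
    if lub: "\<And>g. l g = 0 \<or> u g = 0 \<and> b g = 0"
      "\<And>x y. x \<in> {GX1, GX2} \<Longrightarrow> y \<in> {GY1, GY2} \<Longrightarrow> l x * u y = l y * u x"
      and ti: "quad_value l u b i \<in> {1, 2, - 2}" and tj: "\<And>j. j \<in> tnames - {i} \<Longrightarrow> quad_value l u b j = 0" for l u b
  proof (rule hom_to_quad[of l u b])
    show "l g = 0 \<or> u g = 0 \<and> b g = 0" for g by (rule lub(1))
    show "l x * u y = l y * u x" if "x \<in> {GX1, GX2}" "y \<in> {GY1, GY2}" for x y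
      by (rule lub(2)[OF that])
    fix k
    assume k: "group_hom (G_star p) (quad_group p) k"
      "\<And>a. a \<in> tnames \<Longrightarrow> k (star_elt p a) = qmod p 0 0 0 (quad_value l u b a)"
    have "coprime (quad_value l u b i) (int p)" using ti two by auto
    moreover have "k (star_elt p j) = \<one>\<^bsub>quad_group p\<^esub>" if "j \<in> tnames - {i}" for j
      using k(2)[of j] tj[OF that] that by (simp only: qmod_one Diff_iff)
    ultimately show ?thesis using k(1) k(2)[OF i] by metis
  qed
  let ?e = "\<lambda>g h. of_bool (h = g) :: int"
  have "\<exists>k c. group_hom (G_star p) (quad_group p) k \<and> coprime c (int p) \<and>
      k (star_elt p i) = qmod p 0 0 0 c \<and> (\<forall>j\<in>tnames - {i}. k (star_elt p j) = \<one>\<^bsub>quad_group p\<^esub>)"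
    using i unfolding insert_iff empty_iff
  proof (elim disjE FalseE)
    assume "i = T1" then show ?thesis by (intro key[of "?e GX1" "?e GX2" "\<lambda>_. 0"]) (auto simp: quad_value_def)
  next
    assume "i = T2" then show ?thesis by (intro key[of "?e GX2" "?e GX1" "\<lambda>_. 0"]) (auto simp: quad_value_def)
  next
    assume "i = T3" then show ?thesis by (intro key[of "?e GY1" "?e GY2" "\<lambda>_. 0"]) (auto simp: quad_value_def)
  next
    assume "i = T4" then show ?thesis by (intro key[of "?e GY2" "?e GY1" "\<lambda>_. 0"]) (auto simp: quad_value_def)
  next
    assume "i = T5" then show ?thesis by (intro key[of "?e GX1" "\<lambda>_. 0" "?e GY1"]) (auto simp: quad_value_def)
  next
    assume "i = T6" then show ?thesis by (intro key[of "?e GX1" "\<lambda>_. 0" "?e GY2"]) (auto simp: quad_value_def)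
  next
    assume "i = T7" then show ?thesis by (intro key[of "?e GX2" "\<lambda>_. 0" "?e GY1"]) (auto simp: quad_value_def)
  next
    assume "i = T8" then show ?thesis by (intro key[of "?e GX2" "\<lambda>_. 0" "?e GY2"]) (auto simp: quad_value_def)
  qed
  then show ?thesis using that by metis
qed

lemma comm_group_star_kernel: "comm_group (star_kernel_group p)"
proof (rule group.group_comm_groupI)
  show "group (star_kernel_group p)"
    unfolding star_kernel_group_def by (rule S.subgroup_imp_group[OF subgroup_star_kernel])
  fix x y assume "x \<in> carrier (star_kernel_group p)" "y \<in> carrier (star_kernel_group p)"
  then have "x \<in> group_center (G_star p)" "y \<in> carrier (G_star p)"
    using star_kernel_center subgroup.mem_carrier[OF subgroup_star_kernel]
    by (auto simp: star_kernel_group_def)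
  then show "x \<otimes>\<^bsub>star_kernel_group p\<^esub> y = y \<otimes>\<^bsub>star_kernel_group p\<^esub> x"
    using S.group_center_comm by (simp add: star_kernel_group_def)
qed

lemma star_elt_pow:
  assumes "a \<in> tnames"
  shows "star_elt p a [^]\<^bsub>G_star p\<^esub> p = \<one>\<^bsub>G_star p\<^esub>"
proof -
  have c: "commutator (G_star p) x (star_gen p g) [^]\<^bsub>G_star p\<^esub> p = \<one>\<^bsub>G_star p\<^esub>"
    if "x \<in> carrier (G_star p)" "commutator (G_star p) x (star_gen p g) \<in> group_center (G_star p)" for x g
    using S.commutator_pow_center[OF that(1) star_gen_closed that(2) star_gen_pow] .
  show ?thesis
    using assms star_elt_center[OF assms] by (elim insertE emptyE; simp add: c)
qed

text \<open>The homomorphism that separates \<open>t\<^sub>i\<close> maps a relation \<open>\<Prod>\<^sub>a t\<^sub>a\<^bsup>n(a)\<^esup> = \<one>\<close> to the constant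
  polynomial \<open>n(i) c\<close> with \<open>c\<close> coprime to \<open>p\<close>.\<close>

lemma star_kernel_basis:
  "(\<lambda>n. \<Otimes>\<^bsub>star_kernel_group p\<^esub>a\<in>tnames. star_elt p a [^]\<^bsub>star_kernel_group p\<^esub> n a)
     \<in> iso (product_group tnames (\<lambda>_. integer_mod_group p)) (star_kernel_group p)"
proof -
  interpret A: comm_group "star_kernel_group p" by (rule comm_group_star_kernel)
  have cA: "carrier (star_kernel_group p) = star_kernel p" by (simp add: star_kernel_group_def)
  have mult: "x \<otimes>\<^bsub>star_kernel_group p\<^esub> y = x \<otimes>\<^bsub>G_star p\<^esub> y" for x y
    by (simp add: star_kernel_group_def)
  have one: "\<one>\<^bsub>star_kernel_group p\<^esub> = \<one>\<^bsub>G_star p\<^esub>"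
    by (simp add: star_kernel_group_def)
  have int_pow: "x [^]\<^bsub>star_kernel_group p\<^esub> (n::int) = x [^]\<^bsub>G_star p\<^esub> n" if "x \<in> star_kernel p" for x n
    using S.int_pow_consistent[OF subgroup_star_kernel that] by (simp add: star_kernel_group_def)
  show ?thesis
  proof (rule A.elementary_abelian_basis)
    show "star_elt p \<in> tnames \<rightarrow> carrier (star_kernel_group p)"
      unfolding cA using star_elt_kernel by blast
    show "star_elt p a [^]\<^bsub>star_kernel_group p\<^esub> p = \<one>\<^bsub>star_kernel_group p\<^esub>" if "a \<in> tnames" for a
      using star_elt_pow[OF that] by (simp add: star_kernel_group_def S.nat_pow_consistent[symmetric] del: named_in_simps)
  next
    fix K assume K: "subgroup K (star_kernel_group p)" "star_elt p ` tnames \<subseteq> K"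
    have "subgroup K (G_star p)"
      using S.incl_subgroup[OF subgroup_star_kernel] K(1) by (simp add: star_kernel_group_def)
    then show "carrier (star_kernel_group p) \<subseteq> K"
      unfolding cA by (rule star_kernel_least) (use K(2) in blast)
  next
    fix n :: "name \<Rightarrow> int" and i
    assume eq: "(\<Otimes>\<^bsub>star_kernel_group p\<^esub>a\<in>tnames. star_elt p a [^]\<^bsub>star_kernel_group p\<^esub> n a) = \<one>\<^bsub>star_kernel_group p\<^esub>"
      and i: "i \<in> tnames"
    let ?f = "\<lambda>a. star_elt p a [^]\<^bsub>star_kernel_group p\<^esub> n a"
    obtain k c where k: "group_hom (G_star p) (quad_group p) k" "coprime c (int p)"
      "k (star_elt p i) = qmod p 0 0 0 c"
      "\<And>j. j \<in> tnames - {i} \<Longrightarrow> k (star_elt p j) = \<one>\<^bsub>quad_group p\<^esub>"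
      using separating_hom[OF i] by metis
    interpret k: group_hom "G_star p" "quad_group p" k by fact
    have fA: "?f a \<in> star_kernel p" if "a \<in> tnames" for a
      using A.int_pow_closed[of "star_elt p a" "n a"] star_elt_kernel[OF that] unfolding cA by blast
    have kf: "k (?f a) = k (star_elt p a) [^]\<^bsub>quad_group p\<^esub> n a" if "a \<in> tnames" for a
      by (simp only: int_pow[OF star_elt_kernel[OF that]] k.hom_int_pow[OF star_elt_closed])
    let ?P = "finprod (star_kernel_group p) ?f (tnames - {i})"
    have P: "?P \<in> star_kernel p"
      using A.finprod_closed[of ?f "tnames - {i}"] fA unfolding cA by blast
    have kP: "k ?P = \<one>\<^bsub>quad_group p\<^esub>"
      unfolding star_kernel_group_def
    proof (rule k.hom_finprod_one)
      show "comm_group (G_star p\<lparr>carrier := star_kernel p\<rparr>)"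
        using comm_group_star_kernel by (simp add: star_kernel_group_def)
      show "star_kernel p \<subseteq> carrier (G_star p)"
        using subgroup_star_kernel by (rule subgroup.subset)
      fix a assume a: "a \<in> tnames - {i}"
      then have at: "a \<in> tnames" by blast
      show "star_elt p a [^]\<^bsub>G_star p\<lparr>carrier := star_kernel p\<rparr>\<^esub> n a \<in> star_kernel p"
        using fA[OF at] by (simp only: star_kernel_group_def)
      show "k (star_elt p a [^]\<^bsub>G_star p\<lparr>carrier := star_kernel p\<rparr>\<^esub> n a) = \<one>\<^bsub>quad_group p\<^esub>"
        using kf[OF at] by (simp only: star_kernel_group_def k(4)[OF a] k.H.int_pow_one)
    qed
    have "finprod (star_kernel_group p) ?f (insert i (tnames - {i})) = ?f i \<otimes>\<^bsub>star_kernel_group p\<^esub> ?P"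
      by (rule A.finprod_insert) (use fA i in \<open>unfold cA, blast+\<close>)
    moreover have "insert i (tnames - {i}) = tnames" using i by blast
    ultimately have "?f i \<otimes>\<^bsub>G_star p\<^esub> ?P = \<one>\<^bsub>G_star p\<^esub>"
      using eq by (simp only: mult one)
    moreover have "k (?f i \<otimes>\<^bsub>G_star p\<^esub> ?P) = k (?f i) \<otimes>\<^bsub>quad_group p\<^esub> k ?P"
      by (rule k.hom_mult; rule subgroup.mem_carrier[OF subgroup_star_kernel]; fact fA[OF i] P)
    ultimately have "k (?f i) \<otimes>\<^bsub>quad_group p\<^esub> k ?P = \<one>\<^bsub>quad_group p\<^esub>"
      by (simp only: k.hom_one)
    then have "qmod p 0 0 0 (n i * c) = \<one>\<^bsub>quad_group p\<^esub>"
      unfolding kP kf[OF i] k(3) qmod_int_pow by simp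
    then have "int p dvd n i * c" by (simp add: qmod_one qmod_eq_iff cong_0_iff)
    then show "int p dvd n i" using k(2) by (simp add: coprime_dvd_mult_left_iff coprime_commute)
  qed (use p_gt_1 in simp_all)
qed

end

section \<open>Duals of elementary abelian groups\<close>

lemma comm_group_complex_units: "comm_group complex_units"
proof (rule comm_groupI)
  fix x assume "x \<in> carrier complex_units"
  then show "\<exists>y\<in>carrier complex_units. y \<otimes>\<^bsub>complex_units\<^esub> x = \<one>\<^bsub>complex_units\<^esub>"
    by (intro bexI[of _ "inverse x"]) (auto simp: complex_units_def)
qed (auto simp: complex_units_def)

lemma complex_units_simps:
  "carrier complex_units = UNIV - {0}" "x \<otimes>\<^bsub>complex_units\<^esub> y = x * y" "\<one>\<^bsub>complex_units\<^esub> = 1"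
  by (simp_all add: complex_units_def)

lemma inv_complex_units: "x \<noteq> 0 \<Longrightarrow> inv\<^bsub>complex_units\<^esub> x = inverse x"
  by (rule group.inv_equality[OF comm_group.axioms(2)[OF comm_group_complex_units]])
    (simp_all add: complex_units_simps)

lemma nat_pow_complex_units: "x [^]\<^bsub>complex_units\<^esub> (n::nat) = x ^ n"
  by (induction n) (simp_all add: complex_units_simps)

definition dual_group :: "('a, 'b) monoid_scheme \<Rightarrow> ('a \<Rightarrow> complex) monoid" where
  "dual_group A =
    \<lparr>carrier = hom A complex_units \<inter> extensional (carrier A),
     monoid.mult = (\<lambda>\<chi> \<psi>. \<lambda>a\<in>carrier A. \<chi> a * \<psi> a),
     one = (\<lambda>a\<in>carrier A. 1)\<rparr>"

lemma comm_group_dual_group: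
  assumes "group A"
  shows "comm_group (dual_group A)"
proof -
  interpret A: group A by fact
  show ?thesis
  proof (rule comm_groupI)
    fix \<chi> assume \<chi>: "\<chi> \<in> carrier (dual_group A)"
    let ?\<psi> = "\<lambda>a\<in>carrier A. inverse (\<chi> a)"
    have "?\<psi> \<in> carrier (dual_group A)" "?\<psi> \<otimes>\<^bsub>dual_group A\<^esub> \<chi> = \<one>\<^bsub>dual_group A\<^esub>"
      using \<chi> by (auto simp: dual_group_def hom_def complex_units_simps Pi_iff fun_eq_iff)
    then show "\<exists>\<psi>\<in>carrier (dual_group A). \<psi> \<otimes>\<^bsub>dual_group A\<^esub> \<chi> = \<one>\<^bsub>dual_group A\<^esub>" by blast
  qed (auto simp: dual_group_def hom_def complex_units_simps Pi_iff fun_eq_iff restrict_def extensional_def)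
qed

definition unity_root :: "nat \<Rightarrow> int \<Rightarrow> complex" where
  "unity_root p k = cis (2 * pi * real_of_int k / real p)"

lemma unity_root_add: "unity_root p (k + l) = unity_root p k * unity_root p l"
  by (simp add: unity_root_def cis_mult distrib_left add_divide_distrib)

lemma unity_root_nonzero [simp]: "unity_root p k \<noteq> 0"
  by (simp add: unity_root_def)

lemma unity_root_0 [simp]: "unity_root p 0 = 1"
  by (simp add: unity_root_def)

lemma unity_root_mod:
  assumes "0 < p"
  shows "unity_root p (k mod int p) = unity_root p k"
proof -
  have "2 * pi * real_of_int (int p * (k div int p)) / real p = 2 * pi * real_of_int (k div int p)"
    using assms by simp
  then have "unity_root p (int p * (k div int p)) = 1"
    unfolding unity_root_def by (simp only: cis_multiple_2pi[OF Ints_of_int])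
  then have "unity_root p (int p * (k div int p) + k mod int p) = unity_root p (k mod int p)"
    by (simp only: unity_root_add mult_1)
  then show ?thesis by simp
qed

lemma unity_root_power: "unity_root p k ^ n = unity_root p (int n * k)"
  by (induction n) (simp_all add: unity_root_add distrib_right)

lemma unity_root_inj:
  assumes "0 \<le> k" "k < int p" "unity_root p k = 1"
  shows "k = 0"
proof -
  have "bij_betw (\<lambda>k. cis (2 * pi * real k / real p)) {..<p} {z. z ^ p = 1}"
    by (rule bij_betw_roots_unity) (use assms in simp)
  then have "inj_on (\<lambda>k. cis (2 * pi * real k / real p)) {..<p}" by (rule bij_betw_imp_inj_on)
  from inj_onD[OF this, of "nat k" 0] show ?thesis using assms by (simp add: unity_root_def)
qed

lemma unity_root_surj:
  assumes "0 < p" "z ^ p = 1"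
  obtains k where "0 \<le> k" "k < int p" "z = unity_root p k"
proof -
  have "z \<in> (\<lambda>k. cis (2 * pi * real k / real p)) ` {..<p}"
    using bij_betw_roots_unity[OF assms(1)] assms(2) by (simp add: bij_betw_def)
  then obtain k where "k < p" "z = cis (2 * pi * real k / real p)" by auto
  then show ?thesis by (intro that[of "int k"]) (simp_all add: unity_root_def)
qed

lemma (in comm_group) hom_complex_finprod:
  assumes "\<chi> \<in> hom G complex_units" "finite I" "f \<in> I \<rightarrow> carrier G"
  shows "\<chi> (finprod G f I) = (\<Prod>i\<in>I. \<chi> (f i))"
proof -
  interpret \<chi>: group_hom G complex_units \<chi>
    using assms(1) comm_group.axioms(2)[OF comm_group_complex_units]
    by (simp add: group_hom_def group_hom_axioms_def)
  show ?thesis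
    using assms(2,3) by (induction I rule: finite_induct) (simp_all add: complex_units_simps)
qed

text \<open>A basis identifies the group with tuples of residues \<open>m\<close>, and the tuple \<open>n\<close> gives the character
  \<open>m \<mapsto> \<zeta>\<^bsup>\<Sum> n(i) m(i)\<^esup>\<close> with \<open>\<zeta> = unity_root p 1\<close>. Every character arises since its values on the basis are \<open>p\<close>-th
  roots of unity.\<close>

lemma (in comm_group) dual_elementary_abelian:
  fixes p :: nat
  assumes p: "0 < p" and I: "finite I" "t \<in> I \<rightarrow> carrier G" and tp: "\<And>i. i \<in> I \<Longrightarrow> t i [^] p = \<one>"
    and iso: "(\<lambda>n. \<Otimes>i\<in>I. t i [^] (n i :: int)) \<in> iso (product_group I (\<lambda>_. integer_mod_group p)) G"
  shows "product_group I (\<lambda>_. integer_mod_group p) \<cong> dual_group G"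
proof -
  let ?E = "product_group I (\<lambda>_. integer_mod_group p)"
  let ?f = "\<lambda>n. \<Otimes>i\<in>I. t i [^] (n i :: int)"
  interpret E: group ?E by (rule product_group) simp
  interpret D: comm_group "dual_group G" by (rule comm_group_dual_group) simp
  define m where "m = inv_into (carrier ?E) ?f"
  have m: "m \<in> iso G ?E" unfolding m_def by (rule E.iso_set_sym[OF iso])
  have mE: "m a \<in> carrier ?E" if "a \<in> carrier G" for a
    using m that by (auto simp: iso_def hom_def)
  have fm: "?f (m a) = a" if "a \<in> carrier G" for a
    using f_inv_into_f[of a ?f "carrier ?E"] iso that unfolding m_def iso_def bij_betw_def by blast
  have mf: "m (?f n) = n" if "n \<in> carrier ?E" for n
    using inv_into_f_f[of ?f "carrier ?E" n] iso that unfolding m_def iso_def bij_betw_def by blast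
  have fG: "?f n \<in> carrier G" if "n \<in> carrier ?E" for n
    using iso that by (auto simp: iso_def hom_def)
  have range: "0 \<le> n i" "n i < int p" if "n \<in> carrier ?E" "i \<in> I" for n i
    using PiE_mem[OF that(1)[simplified] that(2)] p by (simp_all add: carrier_integer_mod_group)
  have mod: "unity_root p (k * (l mod int p)) = unity_root p (k * l)" for k l
    using unity_root_mod[OF p, of "k * (l mod int p)"] unity_root_mod[OF p, of "k * l"] by (simp add: mod_simps)
  define \<Psi> where "\<Psi> n = (\<lambda>a\<in>carrier G. \<Prod>i\<in>I. unity_root p (n i * m a i))" for n
  have \<Psi>_closed: "\<Psi> n \<in> carrier (dual_group G)" for n
  proof -
    have "m (a \<otimes> b) = (\<lambda>i\<in>I. (m a i + m b i) mod int p)" if "a \<in> carrier G" "b \<in> carrier G" for a b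
      using m that by (auto simp: iso_def hom_def)
    then have "(\<Prod>i\<in>I. unity_root p (n i * m (a \<otimes> b) i)) =
        (\<Prod>i\<in>I. unity_root p (n i * m a i)) * (\<Prod>i\<in>I. unity_root p (n i * m b i))"
      if "a \<in> carrier G" "b \<in> carrier G" for a b
      using that by (simp add: mod distrib_left unity_root_add prod.distrib)
    then show ?thesis
      using I(1) by (auto simp: \<Psi>_def dual_group_def hom_def complex_units_simps)
  qed
  have \<Psi>_f: "\<Psi> n (?f k) = (\<Prod>i\<in>I. unity_root p (n i * k i))" if "k \<in> carrier ?E" for n k
    using fG[OF that] by (simp add: \<Psi>_def mf[OF that])
  interpret \<Psi>: group_hom ?E "dual_group G" \<Psi>
  proof (unfold group_hom_def group_hom_axioms_def, intro conjI homI)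
    fix n k assume "n \<in> carrier ?E" "k \<in> carrier ?E"
    have "(\<Prod>i\<in>I. unity_root p ((n \<otimes>\<^bsub>?E\<^esub> k) i * m a i)) =
        (\<Prod>i\<in>I. unity_root p (n i * m a i)) * (\<Prod>i\<in>I. unity_root p (k i * m a i))" for a
      by (simp add: mult.commute[of _ "m a _"] mod distrib_left unity_root_add prod.distrib)
    then show "\<Psi> (n \<otimes>\<^bsub>?E\<^esub> k) = \<Psi> n \<otimes>\<^bsub>dual_group G\<^esub> \<Psi> k"
      unfolding \<Psi>_def dual_group_def by (simp add: restrict_def fun_eq_iff del: mult_product_group)
  qed (use \<Psi>_closed in auto)
  have "\<Psi> \<in> iso ?E (dual_group G)"
    unfolding \<Psi>.iso_iff
  proof (intro conjI subsetI ballI impI)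
    fix \<chi> assume "\<chi> \<in> carrier (dual_group G)"
    then have \<chi>: "\<chi> \<in> hom G complex_units" "\<chi> \<in> extensional (carrier G)"
      by (simp_all add: dual_group_def)
    interpret \<chi>: group_hom G complex_units \<chi>
      using \<chi>(1) comm_group.axioms(2)[OF comm_group_complex_units]
      by (simp add: group_hom_def group_hom_axioms_def)
    have "\<exists>k. 0 \<le> k \<and> k < int p \<and> \<chi> (t i) = unity_root p k" if i: "i \<in> I" for i
    proof -
      have "\<chi> (t i) ^ p = 1"
        using \<chi>.hom_nat_pow[of "t i" p] tp[OF i] I(2) i
        by (auto simp: nat_pow_complex_units complex_units_simps)
      then show ?thesis using unity_root_surj[OF p] by metis
    qed
    then obtain n where n: "\<And>i. i \<in> I \<Longrightarrow> 0 \<le> n i \<and> n i < int p \<and> \<chi> (t i) = unity_root p (n i)"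
      by metis
    let ?n = "restrict n I"
    have nE: "?n \<in> carrier ?E" using n p by (auto simp: carrier_integer_mod_group)
    have "\<Psi> ?n = \<chi>"
    proof (rule extensionalityI)
      fix a assume a: "a \<in> carrier G"
      have pow: "\<chi> (t i [^] m a i) = unity_root p (n i * m a i)" if i: "i \<in> I" for i
      proof -
        have "t i [^] m a i = t i [^] nat (m a i)"
          using range(1)[OF mE[OF a] i] int_pow_int[of G "t i" "nat (m a i)"] by simp
        then have "\<chi> (t i [^] m a i) = \<chi> (t i) ^ nat (m a i)"
          using \<chi>.hom_nat_pow[of "t i"] I(2) i by (auto simp: nat_pow_complex_units)
        then show ?thesis
          using n[OF i] range(1)[OF mE[OF a] i] by (simp add: unity_root_power mult.commute)
      qed
      have "\<chi> a = \<chi> (?f (m a))" using fm[OF a] by simp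
      also have "\<dots> = (\<Prod>i\<in>I. \<chi> (t i [^] m a i))"
        by (rule hom_complex_finprod[OF \<chi>(1) I(1)]) (use I(2) in auto)
      finally show "\<Psi> ?n a = \<chi> a"
        using a by (simp add: \<Psi>_def pow)
    qed (use \<chi>(2) in \<open>auto simp: \<Psi>_def\<close>)
    then show "\<chi> \<in> \<Psi> ` carrier ?E" using nE by blast
  next
    fix n assume n: "n \<in> carrier ?E" "\<Psi> n = \<one>\<^bsub>dual_group G\<^esub>"
    have "n i = 0" if i: "i \<in> I" for i
    proof -
      let ?k = "\<lambda>j\<in>I. (if j = i then 1 else 0) mod int p"
      have k: "?k \<in> carrier ?E" using p by (auto simp: carrier_integer_mod_group)
      have "1 = \<Psi> n (?f ?k)" using n(2) fG[OF k] by (simp add: dual_group_def)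
      also have "\<dots> = (\<Prod>j\<in>I. if j = i then unity_root p (n j) else 1)"
        unfolding \<Psi>_f[OF k] by (rule prod.cong) (auto simp: mod)
      also have "\<dots> = unity_root p (n i)" using I(1) i by simp
      finally show ?thesis using unity_root_inj range[OF n(1) i] by metis
    qed
    then show "n = \<one>\<^bsub>?E\<^esub>"
      using n(1) by (auto simp: PiE_def extensional_def restrict_def)
  qed
  then show ?thesis by (rule is_isoI)
qed

section \<open>The second cohomology group\<close>

lemma comm_group_cocycles2:
  assumes "group G" "comm_group M"
  shows "comm_group (cocycles2 G M)"
proof -
  interpret G: group G by fact
  interpret M: comm_group M by fact
  show ?thesis
  proof (rule comm_groupI)
    fix f g assume "f \<in> carrier (cocycles2 G M)" "g \<in> carrier (cocycles2 G M)"
    then have c: "f (x, y) \<in> carrier M" "g (x, y) \<in> carrier M"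
      and f: "f (y, z) \<otimes>\<^bsub>M\<^esub> f (x, y \<otimes>\<^bsub>G\<^esub> z) = f (x \<otimes>\<^bsub>G\<^esub> y, z) \<otimes>\<^bsub>M\<^esub> f (x, y)"
      and g: "g (y, z) \<otimes>\<^bsub>M\<^esub> g (x, y \<otimes>\<^bsub>G\<^esub> z) = g (x \<otimes>\<^bsub>G\<^esub> y, z) \<otimes>\<^bsub>M\<^esub> g (x, y)"
      if "x \<in> carrier G" "y \<in> carrier G" "z \<in> carrier G" for x y z
      using that by (auto simp: cocycles2_def PiE_def Pi_def)
    have "f (y, z) \<otimes>\<^bsub>M\<^esub> g (y, z) \<otimes>\<^bsub>M\<^esub> (f (x, y \<otimes>\<^bsub>G\<^esub> z) \<otimes>\<^bsub>M\<^esub> g (x, y \<otimes>\<^bsub>G\<^esub> z)) =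
        f (x \<otimes>\<^bsub>G\<^esub> y, z) \<otimes>\<^bsub>M\<^esub> g (x \<otimes>\<^bsub>G\<^esub> y, z) \<otimes>\<^bsub>M\<^esub> (f (x, y) \<otimes>\<^bsub>M\<^esub> g (x, y))"
      if "x \<in> carrier G" "y \<in> carrier G" "z \<in> carrier G" for x y z
    proof -
      have "f (y, z) \<otimes>\<^bsub>M\<^esub> g (y, z) \<otimes>\<^bsub>M\<^esub> (f (x, y \<otimes>\<^bsub>G\<^esub> z) \<otimes>\<^bsub>M\<^esub> g (x, y \<otimes>\<^bsub>G\<^esub> z)) =
        f (y, z) \<otimes>\<^bsub>M\<^esub> f (x, y \<otimes>\<^bsub>G\<^esub> z) \<otimes>\<^bsub>M\<^esub> (g (y, z) \<otimes>\<^bsub>M\<^esub> g (x, y \<otimes>\<^bsub>G\<^esub> z))"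
        using that c by (simp add: M.m_ac)
      also have "\<dots> = f (x \<otimes>\<^bsub>G\<^esub> y, z) \<otimes>\<^bsub>M\<^esub> f (x, y) \<otimes>\<^bsub>M\<^esub> (g (x \<otimes>\<^bsub>G\<^esub> y, z) \<otimes>\<^bsub>M\<^esub> g (x, y))"
        unfolding f[OF that] g[OF that] ..
      also have "\<dots> = f (x \<otimes>\<^bsub>G\<^esub> y, z) \<otimes>\<^bsub>M\<^esub> g (x \<otimes>\<^bsub>G\<^esub> y, z) \<otimes>\<^bsub>M\<^esub> (f (x, y) \<otimes>\<^bsub>M\<^esub> g (x, y))"
        using that c by (simp add: M.m_ac)
      finally show ?thesis .
    qed
    then show "f \<otimes>\<^bsub>cocycles2 G M\<^esub> g \<in> carrier (cocycles2 G M)"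
      using c by (auto simp: cocycles2_def)
    show "f \<otimes>\<^bsub>cocycles2 G M\<^esub> g = g \<otimes>\<^bsub>cocycles2 G M\<^esub> f"
      using c M.m_comm by (auto simp: cocycles2_def fun_eq_iff)
  next
    fix f g h assume "f \<in> carrier (cocycles2 G M)" "g \<in> carrier (cocycles2 G M)" "h \<in> carrier (cocycles2 G M)"
    then have "f u \<in> carrier M" "g u \<in> carrier M" "h u \<in> carrier M" if "u \<in> carrier G \<times> carrier G" for u
      using that by (auto simp: cocycles2_def PiE_def Pi_def)
    then show "f \<otimes>\<^bsub>cocycles2 G M\<^esub> g \<otimes>\<^bsub>cocycles2 G M\<^esub> h = f \<otimes>\<^bsub>cocycles2 G M\<^esub> (g \<otimes>\<^bsub>cocycles2 G M\<^esub> h)"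
      by (auto simp: cocycles2_def fun_eq_iff M.m_assoc)
  next
    show "\<one>\<^bsub>cocycles2 G M\<^esub> \<in> carrier (cocycles2 G M)"
      by (auto simp: cocycles2_def)
  next
    fix f assume f: "f \<in> carrier (cocycles2 G M)"
    then have c: "f u \<in> carrier M" if "u \<in> carrier G \<times> carrier G" for u
      using that by (auto simp: cocycles2_def PiE_def Pi_def)
    show "\<one>\<^bsub>cocycles2 G M\<^esub> \<otimes>\<^bsub>cocycles2 G M\<^esub> f = f"
      using f c by (intro extensionalityI[where A = "carrier G \<times> carrier G"])
        (auto simp: cocycles2_def PiE_def)
    let ?g = "\<lambda>u\<in>carrier G \<times> carrier G. inv\<^bsub>M\<^esub> f u"
    have "inv\<^bsub>M\<^esub> f (y, z) \<otimes>\<^bsub>M\<^esub> inv\<^bsub>M\<^esub> f (x, y \<otimes>\<^bsub>G\<^esub> z) =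
        inv\<^bsub>M\<^esub> f (x \<otimes>\<^bsub>G\<^esub> y, z) \<otimes>\<^bsub>M\<^esub> inv\<^bsub>M\<^esub> f (x, y)"
      if "x \<in> carrier G" "y \<in> carrier G" "z \<in> carrier G" for x y z
    proof -
      have "f (y, z) \<otimes>\<^bsub>M\<^esub> f (x, y \<otimes>\<^bsub>G\<^esub> z) = f (x \<otimes>\<^bsub>G\<^esub> y, z) \<otimes>\<^bsub>M\<^esub> f (x, y)"
        using f that by (simp add: cocycles2_def)
      then show ?thesis using that c by (simp flip: M.inv_mult)
    qed
    then have "?g \<in> carrier (cocycles2 G M)"
      using c by (auto simp: cocycles2_def)
    moreover have "?g \<otimes>\<^bsub>cocycles2 G M\<^esub> f = \<one>\<^bsub>cocycles2 G M\<^esub>"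
      using c by (auto simp: cocycles2_def fun_eq_iff)
    ultimately show "\<exists>g\<in>carrier (cocycles2 G M). g \<otimes>\<^bsub>cocycles2 G M\<^esub> f = \<one>\<^bsub>cocycles2 G M\<^esub>" by blast
  qed
qed

text \<open>For values in \<open>complex_units\<close> the group operations are those of the field, which lets field
  arithmetic take over.\<close>

lemma cocycle_iff: "f \<in> carrier (cocycles2 G complex_units) \<longleftrightarrow>
    f \<in> extensional (carrier G \<times> carrier G) \<and>
    (\<forall>x\<in>carrier G. \<forall>y\<in>carrier G. f (x, y) \<noteq> 0) \<and>
    (\<forall>x\<in>carrier G. \<forall>y\<in>carrier G. \<forall>z\<in>carrier G.
      f (y, z) * f (x, y \<otimes>\<^bsub>G\<^esub> z) = f (x \<otimes>\<^bsub>G\<^esub> y, z) * f (x, y))"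
  by (auto simp: cocycles2_def complex_units_simps PiE_def Pi_def)

definition coboundary :: "('a, 'b) monoid_scheme \<Rightarrow> ('a \<Rightarrow> complex) \<Rightarrow> 'a \<times> 'a \<Rightarrow> complex" where
  "coboundary G h = (\<lambda>(x, y)\<in>carrier G \<times> carrier G. h x * h y / h (x \<otimes>\<^bsub>G\<^esub> y))"

lemma coboundaries2_eq:
  assumes "group G"
  shows "coboundaries2 G complex_units = {coboundary G h | h. h \<in> carrier G \<rightarrow> UNIV - {0}}"
proof -
  interpret group G by fact
  have "(\<lambda>(x, y)\<in>carrier G \<times> carrier G. h x \<otimes>\<^bsub>complex_units\<^esub> h y \<otimes>\<^bsub>complex_units\<^esub>
      inv\<^bsub>complex_units\<^esub> (h (x \<otimes>\<^bsub>G\<^esub> y))) = coboundary G h" if "h \<in> carrier G \<rightarrow> UNIV - {0}" for h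
    using that by (auto simp: coboundary_def complex_units_simps inv_complex_units fun_eq_iff divide_inverse Pi_iff)
  then show ?thesis
    unfolding coboundaries2_def complex_units_simps(1)
    by (intro Collect_cong ex_cong1 iffI; elim conjE; simp only: simp_thms)
qed

lemma subgroup_coboundaries2:
  assumes "group G"
  shows "subgroup (coboundaries2 G complex_units) (cocycles2 G complex_units)"
proof -
  interpret G: group G by fact
  interpret Z: comm_group "cocycles2 G complex_units"
    by (rule comm_group_cocycles2[OF assms comm_group_complex_units])
  have cl: "coboundary G h \<in> carrier (cocycles2 G complex_units)" if "h \<in> carrier G \<rightarrow> UNIV - {0}" for h
    using that by (auto simp: cocycle_iff coboundary_def Pi_iff G.m_assoc)
  have mult: "coboundary G h \<otimes>\<^bsub>cocycles2 G complex_units\<^esub> coboundary G k = coboundary G (\<lambda>x. h x * k x)" for h k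
    by (auto simp: coboundary_def cocycles2_def complex_units_simps fun_eq_iff)
  have one: "\<one>\<^bsub>cocycles2 G complex_units\<^esub> = coboundary G (\<lambda>_. 1)"
    by (auto simp: coboundary_def cocycles2_def complex_units_simps fun_eq_iff)
  show ?thesis
    unfolding coboundaries2_eq[OF assms]
  proof (rule Z.subgroupI)
    have "coboundary G (\<lambda>_. 1) \<in> {coboundary G h |h. h \<in> carrier G \<rightarrow> UNIV - {0}}"
      by (intro CollectI exI[of _ "\<lambda>_. 1"]) simp
    then show "{coboundary G h |h. h \<in> carrier G \<rightarrow> UNIV - {0}} \<noteq> {}" by blast
  next
    fix a assume "a \<in> {coboundary G h |h. h \<in> carrier G \<rightarrow> UNIV - {0}}"
    then obtain h where h: "a = coboundary G h" "h \<in> carrier G \<rightarrow> UNIV - {0}" by auto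
    then have h': "(\<lambda>x. inverse (h x)) \<in> carrier G \<rightarrow> UNIV - {0}" by (auto simp: Pi_iff)
    have "coboundary G (\<lambda>x. inverse (h x)) \<otimes>\<^bsub>cocycles2 G complex_units\<^esub> a = \<one>\<^bsub>cocycles2 G complex_units\<^esub>"
      unfolding h(1) mult one using h(2) by (auto simp: coboundary_def fun_eq_iff Pi_iff)
    then have "inv\<^bsub>cocycles2 G complex_units\<^esub> a = coboundary G (\<lambda>x. inverse (h x))"
      by (rule Z.inv_equality) (use cl h h' in auto)
    then show "inv\<^bsub>cocycles2 G complex_units\<^esub> a \<in> {coboundary G h |h. h \<in> carrier G \<rightarrow> UNIV - {0}}"
      using h' by blast
  next
    fix a b assume "a \<in> {coboundary G h |h. h \<in> carrier G \<rightarrow> UNIV - {0}}"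
      "b \<in> {coboundary G h |h. h \<in> carrier G \<rightarrow> UNIV - {0}}"
    then obtain h k where "a = coboundary G h" "b = coboundary G k"
      "h \<in> carrier G \<rightarrow> UNIV - {0}" "k \<in> carrier G \<rightarrow> UNIV - {0}" by blast
    then show "a \<otimes>\<^bsub>cocycles2 G complex_units\<^esub> b \<in> {coboundary G h |h. h \<in> carrier G \<rightarrow> UNIV - {0}}"
      by (auto simp: mult Pi_iff intro!: exI[of _ "\<lambda>x. h x * k x"])
  qed (use cl in auto)
qed

section \<open>Transgression\<close>

locale central_extension = group_hom G H \<pi> for G :: "('g, 'c) monoid_scheme" (structure)
    and H :: "('q, 'd) monoid_scheme" (structure) and \<pi> +
  assumes surj: "\<pi> ` carrier G = carrier H"
    and central: "kernel G H \<pi> \<subseteq> group_center G"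
begin

definition sec :: "'q \<Rightarrow> 'g" where
  "sec x = (SOME h. h \<in> carrier G \<and> \<pi> h = x)"

lemma sec:
  assumes "x \<in> carrier H"
  shows "sec x \<in> carrier G" "\<pi> (sec x) = x"
proof -
  have "\<exists>h. h \<in> carrier G \<and> \<pi> h = x" using assms unfolding surj[symmetric] by (elim imageE) (intro exI conjI, simp_all)
  then have "sec x \<in> carrier G \<and> \<pi> (sec x) = x" unfolding sec_def by (rule someI_ex)
  then show "sec x \<in> carrier G" "\<pi> (sec x) = x" by simp_all
qed

text \<open>The factor set of the extension with respect to the section \<open>sec\<close>; the section need not
  preserve \<open>\<one>\<close>, so the factor set need not be normalized.\<close>

definition factor :: "'q \<Rightarrow> 'q \<Rightarrow> 'g" where
  "factor x y = sec x \<otimes>\<^bsub>G\<^esub> sec y \<otimes>\<^bsub>G\<^esub> inv\<^bsub>G\<^esub> sec (x \<otimes>\<^bsub>H\<^esub> y)"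

abbreviation K :: "'g set" where "K \<equiv> kernel G H \<pi>"

lemma K_closed: "a \<in> K \<Longrightarrow> a \<in> carrier G"
  by (simp add: kernel_def)

lemma K_comm: "a \<in> K \<Longrightarrow> h \<in> carrier G \<Longrightarrow> a \<otimes>\<^bsub>G\<^esub> h = h \<otimes>\<^bsub>G\<^esub> a"
  using central G.group_center_comm by blast

lemma factor_K: "x \<in> carrier H \<Longrightarrow> y \<in> carrier H \<Longrightarrow> factor x y \<in> K"
  by (simp add: factor_def kernel_def sec)

lemma sec_mult:
  "x \<in> carrier H \<Longrightarrow> y \<in> carrier H \<Longrightarrow> sec x \<otimes>\<^bsub>G\<^esub> sec y = factor x y \<otimes>\<^bsub>G\<^esub> sec (x \<otimes>\<^bsub>H\<^esub> y)"
  by (simp add: factor_def sec G.m_assoc)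

lemma factor_cocycle:
  assumes "x \<in> carrier H" "y \<in> carrier H" "z \<in> carrier H"
  shows "factor y z \<otimes>\<^bsub>G\<^esub> factor x (y \<otimes>\<^bsub>H\<^esub> z) = factor (x \<otimes>\<^bsub>H\<^esub> y) z \<otimes>\<^bsub>G\<^esub> factor x y"
proof -
  note fc = factor_K[THEN K_closed]
  let ?s = "sec (x \<otimes>\<^bsub>H\<^esub> y \<otimes>\<^bsub>H\<^esub> z)"
  have "factor y z \<otimes>\<^bsub>G\<^esub> factor x (y \<otimes>\<^bsub>H\<^esub> z) \<otimes>\<^bsub>G\<^esub> ?s = factor y z \<otimes>\<^bsub>G\<^esub> (sec x \<otimes>\<^bsub>G\<^esub> sec (y \<otimes>\<^bsub>H\<^esub> z))"
    using assms by (simp add: sec_mult fc sec G.m_assoc H.m_assoc)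
  also have "\<dots> = sec x \<otimes>\<^bsub>G\<^esub> (factor y z \<otimes>\<^bsub>G\<^esub> sec (y \<otimes>\<^bsub>H\<^esub> z))"
    using assms K_comm[OF factor_K[OF assms(2,3)] sec(1)[OF assms(1)]] by (simp add: fc sec flip: G.m_assoc)
  also have "\<dots> = sec x \<otimes>\<^bsub>G\<^esub> sec y \<otimes>\<^bsub>G\<^esub> sec z"
    using assms by (simp add: sec_mult[symmetric] sec G.m_assoc)
  also have "\<dots> = factor x y \<otimes>\<^bsub>G\<^esub> (factor (x \<otimes>\<^bsub>H\<^esub> y) z \<otimes>\<^bsub>G\<^esub> ?s)"
    using assms by (simp add: sec_mult fc sec G.m_assoc)
  also have "\<dots> = factor (x \<otimes>\<^bsub>H\<^esub> y) z \<otimes>\<^bsub>G\<^esub> factor x y \<otimes>\<^bsub>G\<^esub> ?s"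
    using assms K_comm[OF factor_K[OF assms(1,2)], of "factor (x \<otimes>\<^bsub>H\<^esub> y) z"]
    by (simp add: fc sec flip: G.m_assoc)
  finally show ?thesis using assms by (simp add: fc sec)
qed

abbreviation K_group :: "('g, 'c) monoid_scheme" where "K_group \<equiv> G\<lparr>carrier := K\<rparr>"

definition transgress :: "('g \<Rightarrow> complex) \<Rightarrow> 'q \<times> 'q \<Rightarrow> complex" where
  "transgress \<chi> = (\<lambda>(x, y)\<in>carrier H \<times> carrier H. \<chi> (factor x y))"

lemma character:
  assumes "\<chi> \<in> carrier (dual_group K_group)"
  shows "a \<in> K \<Longrightarrow> \<chi> a \<noteq> 0" "a \<in> K \<Longrightarrow> b \<in> K \<Longrightarrow> \<chi> (a \<otimes>\<^bsub>G\<^esub> b) = \<chi> a * \<chi> b"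
  using assms by (auto simp: dual_group_def hom_def complex_units_simps Pi_iff)

lemma transgress_cocycle:
  assumes "\<chi> \<in> carrier (dual_group K_group)"
  shows "transgress \<chi> \<in> carrier (cocycles2 H complex_units)"
  unfolding cocycle_iff
  using character[OF assms] factor_K factor_cocycle
  by (auto simp: transgress_def simp flip: character(2)[OF assms])

text \<open>Injectivity: if \<open>\<chi> \<circ> factor\<close> is the coboundary of \<open>h\<close>, then \<open>a sec(x) \<mapsto> \<chi>(a) h(x)\<close> is a homomorphism
  from \<open>G\<close> to an abelian group. It vanishes on the derived subgroup, hence on the kernel, where it
  agrees with \<open>\<chi>\<close>. Surjectivity: if the pullback of \<open>c\<close> to \<open>G\<close> is the coboundary of \<open>\<phi>\<close>, then \<open>\<phi>\<close>
  restricts to a character of the kernel, up to a constant, and the class of \<open>c\<close> is its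
  transgression.\<close>

theorem dual_iso_cohomology2:
  assumes derived: "K \<subseteq> derived G (carrier G)"
    and trivial: "\<And>c. c \<in> carrier (cocycles2 H complex_units) \<Longrightarrow>
      \<exists>\<phi>\<in>carrier G \<rightarrow> UNIV - {0}. \<forall>g\<in>carrier G. \<forall>g'\<in>carrier G.
        \<phi> (g \<otimes>\<^bsub>G\<^esub> g') = \<phi> g * \<phi> g' * c (\<pi> g, \<pi> g')"
  shows "dual_group K_group \<cong> cohomology2 H complex_units"
proof -
  let ?Z = "cocycles2 H complex_units" and ?B = "coboundaries2 H complex_units"
  interpret Z: comm_group ?Z by (rule comm_group_cocycles2[OF H.is_group comm_group_complex_units])
  have B: "subgroup ?B ?Z" by (rule subgroup_coboundaries2) (rule H.is_group)
  have nB: "?B \<lhd> ?Z" using B by (rule Z.subgroup_imp_normal)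
  interpret C: group "cohomology2 H complex_units"
    unfolding cohomology2_def by (rule normal.factorgroup_is_group[OF nB])
  interpret KG: group K_group by (rule G.subgroup_imp_group[OF subgroup_kernel])
  interpret D: comm_group "dual_group K_group" by (rule comm_group_dual_group) (rule KG.is_group)
  let ?\<Phi> = "\<lambda>\<chi>. ?B #>\<^bsub>?Z\<^esub> transgress \<chi>"
  have hom: "?\<Phi> \<in> hom (dual_group K_group) (cohomology2 H complex_units)"
  proof (rule homI)
    fix \<chi> assume "\<chi> \<in> carrier (dual_group K_group)"
    then show "?\<Phi> \<chi> \<in> carrier (cohomology2 H complex_units)"
      using transgress_cocycle by (auto simp: cohomology2_def carrier_FactGroup)
  next
    fix \<chi> \<psi> assume \<chi>: "\<chi> \<in> carrier (dual_group K_group)" "\<psi> \<in> carrier (dual_group K_group)"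
    have "transgress (\<chi> \<otimes>\<^bsub>dual_group K_group\<^esub> \<psi>) = transgress \<chi> \<otimes>\<^bsub>?Z\<^esub> transgress \<psi>"
      using factor_K by (auto simp: transgress_def dual_group_def cocycles2_def complex_units_simps fun_eq_iff)
    then show "?\<Phi> (\<chi> \<otimes>\<^bsub>dual_group K_group\<^esub> \<psi>) = ?\<Phi> \<chi> \<otimes>\<^bsub>cohomology2 H complex_units\<^esub> ?\<Phi> \<psi>"
      unfolding cohomology2_def mult_FactGroup
      using normal.rcos_sum[OF nB transgress_cocycle[OF \<chi>(1)] transgress_cocycle[OF \<chi>(2)]] by simp
  qed
  interpret \<Phi>: group_hom "dual_group K_group" "cohomology2 H complex_units" ?\<Phi>
    using hom by unfold_locales
  have "?\<Phi> \<in> iso (dual_group K_group) (cohomology2 H complex_units)"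
    unfolding \<Phi>.iso_iff
  proof (intro conjI subsetI ballI impI)
    fix W assume "W \<in> carrier (cohomology2 H complex_units)"
    then obtain c where c: "c \<in> carrier ?Z" "W = ?B #>\<^bsub>?Z\<^esub> c"
      by (auto simp: cohomology2_def carrier_FactGroup)
    obtain \<phi> where \<phi>: "\<phi> \<in> carrier G \<rightarrow> UNIV - {0}"
      "\<And>g g'. g \<in> carrier G \<Longrightarrow> g' \<in> carrier G \<Longrightarrow> \<phi> (g \<otimes>\<^bsub>G\<^esub> g') = \<phi> g * \<phi> g' * c (\<pi> g, \<pi> g')"
      using trivial[OF c(1)] by blast
    have \<phi>0: "\<phi> g \<noteq> 0" if "g \<in> carrier G" for g using \<phi>(1) that by auto
    have cc: "c (\<one>\<^bsub>H\<^esub>, z) = c (\<one>\<^bsub>H\<^esub>, \<one>\<^bsub>H\<^esub>)" if "z \<in> carrier H" for z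
    proof -
      have "c (\<one>\<^bsub>H\<^esub>, z) * c (\<one>\<^bsub>H\<^esub>, \<one>\<^bsub>H\<^esub> \<otimes>\<^bsub>H\<^esub> z) = c (\<one>\<^bsub>H\<^esub> \<otimes>\<^bsub>H\<^esub> \<one>\<^bsub>H\<^esub>, z) * c (\<one>\<^bsub>H\<^esub>, \<one>\<^bsub>H\<^esub>)"
        using c(1) that unfolding cocycle_iff by blast
      moreover have "c (\<one>\<^bsub>H\<^esub>, z) \<noteq> 0" using c(1) that unfolding cocycle_iff by blast
      ultimately show ?thesis using that by simp
    qed
    let ?c1 = "c (\<one>\<^bsub>H\<^esub>, \<one>\<^bsub>H\<^esub>)"
    have c1: "?c1 \<noteq> 0" using c(1) unfolding cocycle_iff by blast
    \<comment> \<open>On the kernel \<open>\<phi>\<close> is multiplicative up to the constant value \<open>c (\<one>, \<one>)\<close>.\<close>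
    define \<chi> where "\<chi> = (\<lambda>a\<in>K. \<phi> a * ?c1)"
    have \<phi>K: "\<phi> (a \<otimes>\<^bsub>G\<^esub> g) = \<chi> a * \<phi> g" if "a \<in> K" "g \<in> carrier G" for a g
      using that \<phi>(2)[of a g] cc[of "\<pi> g"] by (simp add: \<chi>_def kernel_def)
    have \<chi>: "\<chi> \<in> carrier (dual_group K_group)"
      using \<phi>K \<phi>0 c1 G.subgroup_self subgroup.m_closed[OF subgroup_kernel]
      by (auto simp: \<chi>_def dual_group_def hom_def complex_units_simps K_closed)
    have "transgress \<chi> = coboundary H (\<lambda>x. \<phi> (sec x)) \<otimes>\<^bsub>?Z\<^esub> c"
    proof (rule extensionalityI[where A = "carrier H \<times> carrier H"])
      fix u assume "u \<in> carrier H \<times> carrier H"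
      then obtain x y where u: "u = (x, y)" "x \<in> carrier H" "y \<in> carrier H" by auto
      have "\<chi> (factor x y) * \<phi> (sec (x \<otimes>\<^bsub>H\<^esub> y)) = \<phi> (sec x) * \<phi> (sec y) * c (x, y)"
        using \<phi>K[OF factor_K sec(1), of x y "x \<otimes>\<^bsub>H\<^esub> y"] sec_mult[of x y] \<phi>(2)[of "sec x" "sec y"] u
        by (simp add: sec)
      moreover have "\<phi> (sec (x \<otimes>\<^bsub>H\<^esub> y)) \<noteq> 0" using u by (intro \<phi>0) (simp add: sec)
      ultimately show "transgress \<chi> u = (coboundary H (\<lambda>x. \<phi> (sec x)) \<otimes>\<^bsub>?Z\<^esub> c) u"
        using u by (simp add: transgress_def coboundary_def cocycles2_def complex_units_simps field_simps)
    qed (auto simp: transgress_def cocycles2_def)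
    moreover have cb: "coboundary H (\<lambda>x. \<phi> (sec x)) \<in> ?B"
      unfolding coboundaries2_eq[OF H.is_group] using \<phi>0 sec by auto
    ultimately have "transgress \<chi> \<in> ?B #>\<^bsub>?Z\<^esub> c"
      unfolding r_coset_def by blast
    then have "W = ?\<Phi> \<chi>"
      unfolding c(2) by (rule Z.repr_independence[OF _ c(1) B])
    then show "W \<in> ?\<Phi> ` carrier (dual_group K_group)" using \<chi> by blast
  next
    fix \<chi> assume \<chi>: "\<chi> \<in> carrier (dual_group K_group)"
      and one: "?\<Phi> \<chi> = \<one>\<^bsub>cohomology2 H complex_units\<^esub>"
    have "transgress \<chi> \<in> ?\<Phi> \<chi>"
      by (rule Z.rcos_self[OF transgress_cocycle[OF \<chi>] B])
    then have "transgress \<chi> \<in> ?B" using one by (simp add: cohomology2_def)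
    then obtain h where h: "h \<in> carrier H \<rightarrow> UNIV - {0}" "transgress \<chi> = coboundary H h"
      unfolding coboundaries2_eq[OF H.is_group] by blast
    have f: "\<chi> (factor x y) * h (x \<otimes>\<^bsub>H\<^esub> y) = h x * h y" if "x \<in> carrier H" "y \<in> carrier H" for x y
    proof -
      have "\<chi> (factor x y) = h x * h y / h (x \<otimes>\<^bsub>H\<^esub> y)"
        using fun_cong[OF h(2), of "(x, y)"] that by (simp add: transgress_def coboundary_def)
      moreover have "h (x \<otimes>\<^bsub>H\<^esub> y) \<noteq> 0" using h(1) that by auto
      ultimately show ?thesis by simp
    qed
    \<comment> \<open>\<open>?r g\<close> is the kernel component of \<open>g\<close> in the decomposition \<open>g = a sec(x)\<close>.\<close>
    let ?r = "\<lambda>g. g \<otimes>\<^bsub>G\<^esub> inv\<^bsub>G\<^esub> sec (\<pi> g)"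
    define \<Psi> where "\<Psi> g = \<chi> (?r g) * h (\<pi> g)" for g
    have rK: "?r g \<in> K" if "g \<in> carrier G" for g
      using that by (simp add: kernel_def sec)
    have \<Psi>_mult: "\<Psi> (g \<otimes>\<^bsub>G\<^esub> g') = \<Psi> g * \<Psi> g'" if g: "g \<in> carrier G" "g' \<in> carrier G" for g g'
    proof -
      let ?f = "factor (\<pi> g) (\<pi> g')"
      have fK: "?f \<in> K" using g by (intro factor_K) simp_all
      have "?r g \<otimes>\<^bsub>G\<^esub> ?r g' \<otimes>\<^bsub>G\<^esub> ?f = ?r (g \<otimes>\<^bsub>G\<^esub> g')"
      proof -
        have "g \<otimes>\<^bsub>G\<^esub> g' = ?r g \<otimes>\<^bsub>G\<^esub> sec (\<pi> g) \<otimes>\<^bsub>G\<^esub> (?r g' \<otimes>\<^bsub>G\<^esub> sec (\<pi> g'))"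
          using g by (simp add: sec G.m_assoc)
        also have "\<dots> = ?r g \<otimes>\<^bsub>G\<^esub> (sec (\<pi> g) \<otimes>\<^bsub>G\<^esub> ?r g') \<otimes>\<^bsub>G\<^esub> sec (\<pi> g')"
          using g K_closed[OF rK[OF g(1)]] K_closed[OF rK[OF g(2)]] by (simp add: sec G.m_assoc G.cancel_inv)
        also have "sec (\<pi> g) \<otimes>\<^bsub>G\<^esub> ?r g' = ?r g' \<otimes>\<^bsub>G\<^esub> sec (\<pi> g)"
          using g by (intro K_comm[OF rK, symmetric]) (simp_all add: sec)
        also have "?r g \<otimes>\<^bsub>G\<^esub> (?r g' \<otimes>\<^bsub>G\<^esub> sec (\<pi> g)) \<otimes>\<^bsub>G\<^esub> sec (\<pi> g') =
            ?r g \<otimes>\<^bsub>G\<^esub> ?r g' \<otimes>\<^bsub>G\<^esub> (sec (\<pi> g) \<otimes>\<^bsub>G\<^esub> sec (\<pi> g'))"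
          using g K_closed[OF rK[OF g(1)]] K_closed[OF rK[OF g(2)]] by (simp add: sec G.m_assoc)
        also have "sec (\<pi> g) \<otimes>\<^bsub>G\<^esub> sec (\<pi> g') = ?f \<otimes>\<^bsub>G\<^esub> sec (\<pi> (g \<otimes>\<^bsub>G\<^esub> g'))"
          using g by (simp add: sec_mult)
        finally have e: "g \<otimes>\<^bsub>G\<^esub> g' = ?r g \<otimes>\<^bsub>G\<^esub> ?r g' \<otimes>\<^bsub>G\<^esub> (?f \<otimes>\<^bsub>G\<^esub> sec (\<pi> (g \<otimes>\<^bsub>G\<^esub> g')))" .
        show ?thesis
          by (subst e, use g K_closed[OF rK[OF g(1)]] K_closed[OF rK[OF g(2)]] K_closed[OF fK]
              in \<open>simp add: sec G.m_assoc\<close>)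
      qed
      then have "\<chi> (?r (g \<otimes>\<^bsub>G\<^esub> g')) = \<chi> (?r g) * \<chi> (?r g') * \<chi> ?f"
        using character(2)[OF \<chi>] rK g fK subgroup.m_closed[OF subgroup_kernel] by metis
      then show ?thesis
        using f[of "\<pi> g" "\<pi> g'"] g by (simp add: \<Psi>_def)
    qed
    have \<Psi>0: "\<Psi> g \<noteq> 0" if "g \<in> carrier G" for g
      using character(1)[OF \<chi> rK[OF that]] h(1) that by (auto simp: \<Psi>_def)
    interpret \<Psi>: group_hom G complex_units \<Psi>
      using \<Psi>_mult \<Psi>0 comm_group.axioms(2)[OF comm_group_complex_units]
      by (auto simp: group_hom_def group_hom_axioms_def hom_def complex_units_simps)
    have "derived G (carrier G) \<subseteq> kernel G complex_units \<Psi>"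
      unfolding derived_def
    proof (rule G.generate_subgroup_incl[OF _ \<Psi>.subgroup_kernel], rule subsetI)
      fix x assume "x \<in> derived_set G (carrier G)"
      then obtain a b where "a \<in> carrier G" "b \<in> carrier G"
        "x = a \<otimes>\<^bsub>G\<^esub> b \<otimes>\<^bsub>G\<^esub> inv\<^bsub>G\<^esub> a \<otimes>\<^bsub>G\<^esub> inv\<^bsub>G\<^esub> b" by auto
      then show "x \<in> kernel G complex_units \<Psi>"
        using \<Psi>0 by (simp add: kernel_def inv_complex_units) (simp add: complex_units_simps field_simps)
    qed
    then have \<Psi>K: "\<Psi> a = 1" if "a \<in> K" for a
      using that derived by (auto simp: kernel_def[of G complex_units] complex_units_simps)
    have "\<chi> a = 1" if a: "a \<in> K" for a
    proof -
      have s: "inv\<^bsub>G\<^esub> sec \<one>\<^bsub>H\<^esub> \<in> K" by (simp add: kernel_def sec)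
      have "\<Psi> a = \<chi> a * \<Psi> \<one>\<^bsub>G\<^esub>"
        using character(2)[OF \<chi> a s] s a by (simp add: \<Psi>_def kernel_def)
      then show ?thesis using \<Psi>K[OF a] \<Psi>.hom_one by (simp add: complex_units_simps)
    qed
    then show "\<chi> = \<one>\<^bsub>dual_group K_group\<^esub>"
      using \<chi> by (auto simp: dual_group_def extensional_def fun_eq_iff)
  qed
  then show ?thesis by (rule is_isoI)
qed

end

section \<open>Lifting the generators to a central extension by the multiplicative group\<close>

text \<open>The central extension of \<open>G\<close> by nonzero complex numbers with cocycle \<open>c\<close>. Cocycles are not
  normalized, so the identity is not \<open>(1, \<one>)\<close> in general.\<close>

definition extension_group ::
  "('a, 'b) monoid_scheme \<Rightarrow> ('a \<times> 'a \<Rightarrow> complex) \<Rightarrow> (complex \<times> 'a) monoid" where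
  "extension_group G c =
    \<lparr>carrier = (UNIV - {0}) \<times> carrier G,
     monoid.mult = (\<lambda>(a, x) (b, y). (a * b * c (x, y), x \<otimes>\<^bsub>G\<^esub> y)),
     one = (inverse (c (\<one>\<^bsub>G\<^esub>, \<one>\<^bsub>G\<^esub>)), \<one>\<^bsub>G\<^esub>)\<rparr>"

lemma extension_group_simps:
  "carrier (extension_group G c) = (UNIV - {0}) \<times> carrier G"
  "(a, x) \<otimes>\<^bsub>extension_group G c\<^esub> (b, y) = (a * b * c (x, y), x \<otimes>\<^bsub>G\<^esub> y)"
  "\<one>\<^bsub>extension_group G c\<^esub> = (inverse (c (\<one>\<^bsub>G\<^esub>, \<one>\<^bsub>G\<^esub>)), \<one>\<^bsub>G\<^esub>)"
  by (simp_all add: extension_group_def)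

locale multiplier_cocycle = group G for G (structure) +
  fixes c :: "'a \<times> 'a \<Rightarrow> complex"
  assumes c: "c \<in> carrier (cocycles2 G complex_units)"
begin

lemma c_nonzero: "x \<in> carrier G \<Longrightarrow> y \<in> carrier G \<Longrightarrow> c (x, y) \<noteq> 0"
  using c unfolding cocycle_iff by blast

lemma c_cocycle:
  "x \<in> carrier G \<Longrightarrow> y \<in> carrier G \<Longrightarrow> z \<in> carrier G \<Longrightarrow>
    c (y, z) * c (x, y \<otimes> z) = c (x \<otimes> y, z) * c (x, y)"
  using c unfolding cocycle_iff by blast

lemma c_one_left: "z \<in> carrier G \<Longrightarrow> c (\<one>, z) = c (\<one>, \<one>)"
  using c_cocycle[of \<one> \<one> z] c_nonzero[of \<one> z] by simp

lemma c_one_right: "x \<in> carrier G \<Longrightarrow> c (x, \<one>) = c (\<one>, \<one>)"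
  using c_cocycle[of x \<one> \<one>] c_nonzero[of x \<one>] by simp

abbreviation E :: "(complex \<times> 'a) monoid" where "E \<equiv> extension_group G c"

lemma group_extension_group: "group E"
proof (rule groupI)
  fix u assume "u \<in> carrier E"
  then obtain a x where u: "u = (a, x)" "a \<noteq> 0" "x \<in> carrier G"
    by (auto simp: extension_group_simps)
  let ?v = "(inverse (a * c (inv x, x) * c (\<one>, \<one>)), inv x)"
  have "?v \<in> carrier E" "?v \<otimes>\<^bsub>E\<^esub> u = \<one>\<^bsub>E\<^esub>"
    using u c_nonzero by (simp_all add: extension_group_simps field_simps)
  then show "\<exists>v\<in>carrier E. v \<otimes>\<^bsub>E\<^esub> u = \<one>\<^bsub>E\<^esub>" by blast
next
  fix u v w assume "u \<in> carrier E" "v \<in> carrier E" "w \<in> carrier E"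
  moreover obtain a x b y d z where "u = (a, x)" "v = (b, y)" "w = (d, z)"
    by (metis surj_pair)
  ultimately have u: "u = (a, x)" "v = (b, y)" "w = (d, z)"
    "x \<in> carrier G" "y \<in> carrier G" "z \<in> carrier G"
    by (simp_all add: extension_group_simps)
  have "c (x, y) * c (x \<otimes> y, z) = c (y, z) * c (x, y \<otimes> z)"
    using c_cocycle[of x y z] u by simp
  then show "u \<otimes>\<^bsub>E\<^esub> v \<otimes>\<^bsub>E\<^esub> w = u \<otimes>\<^bsub>E\<^esub> (v \<otimes>\<^bsub>E\<^esub> w)"
    using u by (simp add: extension_group_simps m_assoc)
next
  fix u assume "u \<in> carrier E"
  then obtain a x where u: "u = (a, x)" "x \<in> carrier G"
    by (auto simp: extension_group_simps)
  show "\<one>\<^bsub>E\<^esub> \<otimes>\<^bsub>E\<^esub> u = u"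
    using c_one_left[OF u(2)] c_nonzero[of \<one> \<one>] by (simp add: u extension_group_simps)
qed (auto simp: extension_group_simps c_nonzero)

lemma group_hom_snd: "group_hom E G snd"
  by (auto simp: group_hom_def group_hom_axioms_def group_extension_group hom_def extension_group_simps)

lemma extension_central:
  assumes "u \<in> carrier E" "snd u = \<one>"
  shows "u \<in> group_center E"
proof -
  obtain a where u: "u = (a, \<one>)" "a \<noteq> 0"
    using assms by (cases u) (simp add: extension_group_simps)
  have "u \<otimes>\<^bsub>E\<^esub> w = w \<otimes>\<^bsub>E\<^esub> u" if "w \<in> carrier E" for w
  proof -
    obtain b y where w: "w = (b, y)" "y \<in> carrier G"
      using \<open>w \<in> carrier E\<close> by (cases w) (simp add: extension_group_simps)
    show ?thesis
      using c_one_left[OF w(2)] c_one_right[OF w(2)] by (simp add: u w extension_group_simps)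
  qed
  then show ?thesis using assms(1) by (simp add: group_center_def)
qed

lemma complex_root_exists:
  assumes "0 < n"
  obtains b :: complex where "b ^ n = z"
proof
  have "(rcis (root n (cmod z)) (Arg z / n)) ^ n = rcis (cmod z) (Arg z)"
    using assms by (simp add: DeMoivre2 real_root_pow_pos2)
  then show "(rcis (root n (cmod z)) (Arg z / n)) ^ n = z" by (simp add: rcis_cmod_Arg)
qed

lemma extension_pow:
  assumes "x \<in> carrier G"
  shows "\<exists>\<gamma>. \<gamma> \<noteq> 0 \<and> (\<forall>b. b \<noteq> 0 \<longrightarrow> (b, x) [^]\<^bsub>E\<^esub> (n::nat) = (b ^ n * \<gamma>, x [^] n))"
proof (induction n)
  case 0
  show ?case by (intro exI[of _ "inverse (c (\<one>, \<one>))"]) (simp add: extension_group_simps c_nonzero)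
next
  case (Suc n)
  then obtain \<gamma> where "\<gamma> \<noteq> 0" "\<And>b. b \<noteq> 0 \<Longrightarrow> (b, x) [^]\<^bsub>E\<^esub> n = (b ^ n * \<gamma>, x [^] n)" by blast
  then show ?case
    using assms by (intro exI[of _ "\<gamma> * c (x [^] n, x)"]) (simp add: extension_group_simps c_nonzero)
qed

text \<open>Any lift of \<open>x\<close> has its \<open>p\<close>-th power in the central subgroup of complex numbers, and can be
  corrected by a \<open>p\<close>-th root.\<close>

lemma lift_of_order:
  assumes x: "x \<in> carrier G" "x [^] p = \<one>" and p: "0 < (p::nat)"
  obtains u where "u \<in> carrier E" "snd u = x" "u [^]\<^bsub>E\<^esub> p = \<one>\<^bsub>E\<^esub>"
proof -
  obtain \<gamma> where \<gamma>: "\<gamma> \<noteq> 0" "\<And>b. b \<noteq> 0 \<Longrightarrow> (b, x) [^]\<^bsub>E\<^esub> p = (b ^ p * \<gamma>, x [^] p)"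
    using extension_pow[OF x(1)] by blast
  obtain b where b: "b ^ p = inverse (\<gamma> * c (\<one>, \<one>))"
    using complex_root_exists[OF p] by blast
  have "b ^ p \<noteq> 0" using \<gamma>(1) c_nonzero by (simp add: b)
  then have b0: "b \<noteq> 0" using p by auto
  show ?thesis
  proof (rule that[of "(b, x)"])
    show "(b, x) [^]\<^bsub>E\<^esub> p = \<one>\<^bsub>E\<^esub>"
      using \<gamma>(1) by (simp add: \<gamma>(2)[OF b0] b x(2) extension_group_simps)
  qed (use x b0 in \<open>simp_all add: extension_group_simps\<close>)
qed

text \<open>In the extension the commutators \<open>t\<^sub>j\<close> of any lifts lie over \<open>\<one>\<close> and are therefore central.\<close>

lemma lift_star_tuple:
  assumes v: "\<And>g. v g \<in> carrier G" "\<And>g. v g [^] p = \<one>" "\<And>a. a \<in> tnames \<Longrightarrow> named_in G v a = \<one>"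
    and p: "0 < p"
  obtains w where "star_tuple p E w" "\<And>g. snd (w g) = v g"
proof -
  have "\<exists>u. u \<in> carrier E \<and> snd u = v g \<and> u [^]\<^bsub>E\<^esub> p = \<one>\<^bsub>E\<^esub>" for g
    by (rule lift_of_order[OF v(1,2) p]) blast
  then obtain w where w: "\<And>g. w g \<in> carrier E" "\<And>g. snd (w g) = v g" "\<And>g. w g [^]\<^bsub>E\<^esub> p = \<one>\<^bsub>E\<^esub>"
    by metis
  interpret E: group E by (rule group_extension_group)
  interpret snd: group_hom E G snd by (rule group_hom_snd)
  have "named_in E w a \<in> group_center E" if "a \<in> tnames" for a
    by (rule extension_central)
      (use that in \<open>simp_all only: E.named_in_closed w snd.hom_named_in v(3)\<close>)
  then have "star_tuple p E w" using w(1,3) unfolding star_tuple_def by blast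
  then show ?thesis using w(2) by (rule that)
qed

end

section \<open>The representation group\<close>

context heisenberg_mod
begin

sublocale central_extension "G_star p" "heisenberg3 (zp2 p)" star_pi
  by unfold_locales (simp_all only: star_pi_surj kernel_star_pi star_kernel_center)

text \<open>The first component of a lift \<open>G_star p \<rightarrow> extension_group G c\<close> of the projection has the pullback of
  \<open>c\<close> as its coboundary. The lift covers \<open>star_pi\<close> because both homomorphisms agree on the
  generators.\<close>

lemma pullback_coboundary:
  assumes c: "c \<in> carrier (cocycles2 (heisenberg3 (zp2 p)) complex_units)"
  shows "\<exists>\<phi>\<in>carrier (G_star p) \<rightarrow> UNIV - {0}. \<forall>g\<in>carrier (G_star p). \<forall>g'\<in>carrier (G_star p).
    \<phi> (g \<otimes>\<^bsub>G_star p\<^esub> g') = \<phi> g * \<phi> g' * c (star_pi g, star_pi g')"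
proof -
  interpret c: multiplier_cocycle "heisenberg3 (zp2 p)" c
    by unfold_locales (rule c)
  obtain w where w: "star_tuple p c.E w" "\<And>g. snd (w g) = heis_gen g"
    by (rule c.lift_star_tuple[of heis_gen p])
      (use star_tuple_heis_gen named_heis_gen p_gt_1 in \<open>auto simp: star_tuple_def\<close>)
  have "\<exists>k. group_hom (G_star p) c.E k \<and> (\<forall>g. k (star_gen p g) = w g)"
    by (rule G_star_universal[OF c.group_extension_group odd_p w(1)]) (intro exI conjI allI)
  then obtain k where k: "group_hom (G_star p) c.E k" "\<And>g. k (star_gen p g) = w g"
    by blast
  interpret k: group_hom "G_star p" c.E k by (rule k(1))
  interpret snd: group_hom c.E "heisenberg3 (zp2 p)" snd by (rule c.group_hom_snd)
  have "group_hom (G_star p) (heisenberg3 (zp2 p)) (\<lambda>x. snd (k x))"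
    by (auto simp: group_hom_def group_hom_axioms_def hom_def)
  then have snd_k: "snd (k x) = star_pi x" if "x \<in> carrier (G_star p)" for x
    using group_hom_G_star_eqI[OF _ star_pi(1) _ that] w(2) k(2) star_pi(2) by metis
  have kc: "k x = (fst (k x), star_pi x)" "fst (k x) \<noteq> 0" if "x \<in> carrier (G_star p)" for x
    using k.hom_closed[OF that] snd_k[OF that] by (auto simp: extension_group_simps prod_eq_iff)
  show ?thesis
  proof (intro bexI[of _ "\<lambda>x. fst (k x)"] ballI)
    fix g g' assume g: "g \<in> carrier (G_star p)" "g' \<in> carrier (G_star p)"
    have "k (g \<otimes>\<^bsub>G_star p\<^esub> g') = (fst (k g), star_pi g) \<otimes>\<^bsub>c.E\<^esub> (fst (k g'), star_pi g')"
      using k.hom_mult[OF g] kc(1)[OF g(1)] kc(1)[OF g(2)] by simp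
    then show "fst (k (g \<otimes>\<^bsub>G_star p\<^esub> g')) = fst (k g) * fst (k g') * c (star_pi g, star_pi g')"
      by (simp add: extension_group_simps)
  qed (use kc(2) in auto)
qed

lemma star_kernel_iso_cohomology2:
  "star_kernel_group p \<cong> cohomology2 (heisenberg3 (zp2 p)) complex_units"
proof -
  interpret A: comm_group "star_kernel_group p" by (rule comm_group_star_kernel)
  have cA: "carrier (star_kernel_group p) = star_kernel p" by (simp add: star_kernel_group_def)
  let ?E = "product_group tnames (\<lambda>_. integer_mod_group p)"
  have E: "group ?E" by (rule product_group) simp
  have "star_kernel_group p \<cong> ?E"
    using group.iso_sym[OF E is_isoI[OF star_kernel_basis]] .
  moreover have "?E \<cong> dual_group (star_kernel_group p)"
  proof (rule A.dual_elementary_abelian[OF _ _ _ _ star_kernel_basis])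
    show "star_elt p \<in> tnames \<rightarrow> carrier (star_kernel_group p)"
      unfolding cA using star_elt_kernel by blast
    show "star_elt p a [^]\<^bsub>star_kernel_group p\<^esub> p = \<one>\<^bsub>star_kernel_group p\<^esub>" if "a \<in> tnames" for a
      using star_elt_pow[OF that] by (simp add: star_kernel_group_def S.nat_pow_consistent[symmetric] del: named_in_simps)
  qed (use p_gt_1 in simp_all)
  moreover have "dual_group (star_kernel_group p) \<cong> cohomology2 (heisenberg3 (zp2 p)) complex_units"
    using dual_iso_cohomology2[OF _ pullback_coboundary] star_kernel_derived
    unfolding kernel_star_pi star_kernel_group_def by blast
  ultimately show ?thesis by (blast intro: iso_trans)
qed

lemma finite_heisenberg3: "finite (carrier (heisenberg3 (zp2 p)))"
proof (rule finite_subset)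
  show "carrier (heisenberg3 (zp2 p)) \<subseteq> {..<3} \<times> {..<3} \<rightarrow>\<^sub>E carrier (zp2 p)"
    by (auto simp: unitriangular_def)
qed (auto simp: zp2_simps intro!: finite_PiE)

lemma finite_star_kernel: "finite (star_kernel p)"
proof -
  have "finite (carrier (product_group tnames (\<lambda>_. integer_mod_group p)))"
    unfolding carrier_product_group by (rule finite_PiE) (use p_gt_1 in \<open>simp_all add: carrier_integer_mod_group\<close>)
  then show ?thesis
    using iso_finite[OF is_isoI[OF star_kernel_basis]] by (simp add: star_kernel_group_def)
qed

lemma finite_G_star: "finite (carrier (G_star p))"
proof -
  let ?s = "\<lambda>(a, x). a \<otimes>\<^bsub>G_star p\<^esub> sec x"
  have "carrier (G_star p) \<subseteq> ?s ` (star_kernel p \<times> carrier (heisenberg3 (zp2 p)))"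
  proof
    fix g assume g: "g \<in> carrier (G_star p)"
    have "g \<otimes>\<^bsub>G_star p\<^esub> inv\<^bsub>G_star p\<^esub> sec (star_pi g) \<in> star_kernel p"
      using g unfolding kernel_star_pi[symmetric] by (simp add: kernel_def sec)
    moreover have "g = ?s (g \<otimes>\<^bsub>G_star p\<^esub> inv\<^bsub>G_star p\<^esub> sec (star_pi g), star_pi g)"
      using g by (simp add: sec S.m_assoc)
    ultimately show "g \<in> ?s ` (star_kernel p \<times> carrier (heisenberg3 (zp2 p)))"
      using g by (intro image_eqI) (auto simp del: split_paired_all)
  qed
  then show ?thesis
    by (rule finite_subset) (intro finite_imageI finite_cartesian_product finite_star_kernel finite_heisenberg3)
qed

lemma representation_group_G_star: "representation_group (heisenberg3 (zp2 p)) (G_star p)"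
  unfolding representation_group_def
  using H.is_group finite_heisenberg3 S.is_group finite_G_star subgroup_star_kernel
    star_kernel_center star_kernel_derived G_star_Mod_kernel
    star_kernel_iso_cohomology2[unfolded star_kernel_group_def]
  by blast

end

section \<open>The nilpotency class\<close>

lemma (in group) commutator_lower_central:
  "a \<in> lower_central G n \<Longrightarrow> g \<in> carrier G \<Longrightarrow> commutator G a g \<in> lower_central G (Suc n)"
  by (auto intro: generate.incl)

lemma (in group) lower_central_Suc_least:
  assumes "subgroup K G" "\<And>a g. a \<in> lower_central G n \<Longrightarrow> g \<in> carrier G \<Longrightarrow> commutator G a g \<in> K"
  shows "lower_central G (Suc n) \<subseteq> K"
  unfolding lower_central.simps by (rule generate_subgroup_incl) (use assms in auto)

context heisenberg_mod
begin

lemma T1_nontrivial: "star_elt p T1 \<noteq> \<one>\<^bsub>G_star p\<^esub>"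
proof
  assume one: "star_elt p T1 = \<one>\<^bsub>G_star p\<^esub>"
  obtain k c where k: "group_hom (G_star p) (quad_group p) k" "coprime c (int p)"
    "k (star_elt p T1) = qmod p 0 0 0 c"
    using separating_hom[of T1] by (metis insertI1)
  interpret k: group_hom "G_star p" "quad_group p" k by (rule k(1))
  have "int p dvd c"
    using k(3) k.hom_one unfolding one by (simp add: qmod_one qmod_eq_iff cong_0_iff cong_sym_eq[of 0 c])
  then have "is_unit (int p)" using k(2) by (metis coprime_commute coprime_absorb_left)
  then show False using p_gt_1 by simp
qed

lemma nilpotency_class_G_star: "has_nilpotency_class (G_star p) 3"
proof -
  let ?L = "lower_central (G_star p)"
  let ?C = "{x \<in> carrier (G_star p). star_pi x \<in> group_center (heisenberg3 (zp2 p))}"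
  have "?L 1 \<subseteq> ?C"
    unfolding One_nat_def
  proof (rule S.lower_central_Suc_least)
    show "subgroup ?C (G_star p)"
    proof (rule S.subgroupI)
      show "?C \<noteq> {}" using subgroup.one_closed[OF H.subgroup_group_center] by auto
    qed (use subgroup.m_closed[OF H.subgroup_group_center] subgroup.m_inv_closed[OF H.subgroup_group_center] in auto)
    fix a g assume "a \<in> ?L 0" "g \<in> carrier (G_star p)"
    then have a: "a \<in> carrier (G_star p)" "g \<in> carrier (G_star p)" by simp_all
    obtain x y z x' y' z' where x: "star_pi a = hz p x y z x' y' z'"
      using hz_exhaust[OF pi.hom_closed[OF a(1)]] .
    obtain u v w u' v' w' where u: "star_pi g = hz p u v w u' v' w'"
      using hz_exhaust[OF pi.hom_closed[OF a(2)]] .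
    show "commutator (G_star p) a g \<in> ?C"
      using a by (simp add: pi.hom_commutator x u commutator_hz hz_center)
  qed
  then have L2: "?L 2 \<subseteq> star_kernel p"
    unfolding kernel_star_pi[symmetric] Suc_1[symmetric]
    by (intro S.lower_central_Suc_least pi.subgroup_kernel) (auto simp: kernel_def pi.hom_commutator)
  have "?L 3 \<subseteq> {\<one>\<^bsub>G_star p\<^esub>}"
    unfolding numeral_3_eq_3 Suc_1[unfolded One_nat_def]
    by (rule S.lower_central_Suc_least[OF S.triv_subgroup])
      (use L2 star_kernel_center in auto)
  moreover have "\<one>\<^bsub>G_star p\<^esub> \<in> ?L 3"
    unfolding numeral_3_eq_3 lower_central.simps(2) by (rule generate.one)
  moreover have "?L d \<noteq> {\<one>\<^bsub>G_star p\<^esub>}" if d3: "d < 3" for d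
  proof
    assume L: "?L d = {\<one>\<^bsub>G_star p\<^esub>}"
    let ?x = "star_gen p GX1" and ?z = "star_elt p Z1"
    have z: "?z \<in> ?L 1"
      using S.commutator_lower_central[of ?x 0 "star_gen p GX2"] by simp
    have t: "star_elt p T1 \<in> ?L 2"
      using S.commutator_lower_central[OF z, of ?x] by (simp add: numeral_2_eq_2)
    consider "d = 0" | "d = 1" | "d = 2" using d3 by linarith
    then show False
    proof cases
      case 1 then show ?thesis using L T1_nontrivial star_elt_closed[of T1] by simp
    next
      case 2
      then have "?z = \<one>\<^bsub>G_star p\<^esub>" using L z by simp
      then have "star_elt p T1 = \<one>\<^bsub>G_star p\<^esub>" by simp
      then show ?thesis using T1_nontrivial by simp
    next
      case 3 then show ?thesis using L t T1_nontrivial by simp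
    qed
  qed
  ultimately show ?thesis unfolding has_nilpotency_class_def by blast
qed

end

theorem theorem4p3:
  fixes p :: nat
  assumes "Factorial_Ring.prime p" and "odd p"
  shows "representation_group
           (heisenberg3 (RDirProd (residue_ring (int p)) (residue_ring (int p)))) (G_star p)
         \<and> has_nilpotency_class (G_star p) 3"
proof -
  interpret heisenberg_mod p
    by unfold_locales (use assms prime_gt_1_nat in auto)
  show ?thesis
    using representation_group_G_star nilpotency_class_G_star by blast
qed

end
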